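(* Let $\sigma$ be an operator-valued symbol on $P\times\widehat P$, i.e. $\sigma(b,a,\vartheta,\pi_i^j)\in B(L^2(C_i^j))$ for all $(b,a,\vartheta)\in P$ and $i,j=1,2$, such that $D_i^j\sigma(b,a,\vartheta,\pi_i^j)\in S_2(C_i^j)$ for all $(b,a,\vartheta)\in P$ and $i,j=1,2$. Let $K_{\sigma(b,a,\vartheta,\pi_i^j)}$ denote the kernel of the integral operator $D_i^j\sigma(b,a,\vartheta,\pi_i^j)$, and suppose that for $i,j=1,2$ the function $G_i^j:P\to\mathbb C$, $$G_i^j(b,a,\vartheta)=\Delta(b,a,\vartheta)^{-1/2}\,\|K_{\sigma(b,a,\vartheta,\pi_i^j)}\|_{L^2(C_i^j\times C_i^j)},$$ belongs to $L^2(P)$. Then $T_\sigma:L^2(P)\to L^2(P)$ is a bounded operator and $$\|T_\sigma\|_{B(L^2(P))}\le \|G_1^1\|_{L^2(P)}+\|G_2^1\|_{L^2(P)}+\|G_1^2\|_{L^2(P)}+\|G_2^2\|_{L^2(P)}.$$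
   Context: The affine Poincar\'e group is $P=\{(b,a,\vartheta):b\in\mathbb R^2,\ a>0,\ \vartheta\in\mathbb R\}$ with product $(b,a,\vartheta)*(b',a',\vartheta')=(b+a\Lambda_\vartheta b',\,aa',\,\vartheta+\vartheta')$, where $\Lambda_\vartheta=\begin{pmatrix}\cosh\vartheta&\sinh\vartheta\\ \sinh\vartheta&\cosh\vartheta\end{pmatrix}$. Its left Haar measure is $d\mu(b,a,\vartheta)=\frac{db\,da\,d\vartheta}{a^3}$ and its modular function is $\Delta(b,a,\vartheta)=a^{-2}$. $L^p(P)$ is taken with respect to $\mu$. $\langle x;y\rangle=x_1y_1-x_2y_2$ is the Minkowski form on $\mathbb R^2$. The four cones are $C_1^1=\{x_1^2>x_2^2,\ x_1>0\}$, $C_2^1=\{x_1^2>x_2^2,\ x_1<0\}$, $C_1^2=\{x_1^2<x_2^2,\ x_2>0\}$, $C_2^2=\{x_1^2<x_2^2,\ x_2<0\}$ in $\mathbb R^2$. For $i,j=1,2$, $\pi_i^j$ is the unitary representation of $P$ on $L^2(C_i^j)$ given by $(\pi_i^j(b,a,\vartheta)\varphi)(x)=a\,e^{i\langle x;b\rangle}\varphi(a\Lambda_{-\vartheta}x)$, and $\widehat P=\{\pi_i^j:i,j=1,2\}$. The Duflo--Moore operators are the unbounded operators $(D_i^j\varphi)(x)=\frac1{2\pi}|\langle x;x\rangle|^{1/2}\varphi(x)$ on $L^2(C_i^j)$. For $f\in L^1(P)\cap L^2(P)$ the Fourier transform is the operator $(\widehat f(\pi_i^j)\varphi)(x)=\int_P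 f(b,a,\vartheta)\,\big(\pi_i^j(b,a,\vartheta)D_i^j\varphi\big)(x)\,d\mu(b,a,\vartheta)$ on $L^2(C_i^j)$; it is a Hilbert--Schmidt operator, and $f\mapsto\widehat f(\pi_i^j)$ is extended by continuity to $f\in L^2(P)$ with values in Hilbert--Schmidt operators. $B(L^2(C_i^j))$ is the space of bounded operators and $S_2(C_i^j)$ the Hilbert--Schmidt operators on $L^2(C_i^j)$. The pseudo-differential operator with symbol $\sigma$ is $$(T_\sigma f)(b,a,\vartheta)=\Delta(b,a,\vartheta)^{-1/2}\sum_{i,j=1}^2\mathrm{Tr}\big[D_i^j\,\sigma(b,a,\vartheta,\pi_i^j)\,\widehat f(\pi_i^j)\,\pi_i^j(b,a,\vartheta)^*\big].$$
   Formalization: The symbol is additionally assumed weakly measurable in (b,a,ϑ), i.e. each ⟨σ(b,a,ϑ,π_i^j)φ,ψ⟩ is a measurable function on P; without this T_σ f may be non-measurable (multiply a symbol by a non-measurable unimodular function). *)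

theory Defs
  imports "HOL-Analysis.Analysis"
begin

section \<open>Square-integrable functions and operators on them\<close>

text \<open>
  Elements of \<open>L\<^sup>2(M)\<close> are handled through representatives: square-integrable functions, identified
  when they agree almost everywhere.  An operator is a map on representatives, and every
  equation between its values is an almost-everywhere equation.
\<close>

definition L2 :: "'a measure \<Rightarrow> ('a \<Rightarrow> complex) set" where
  "L2 M = {f \<in> borel_measurable M. integrable M (\<lambda>x. (norm (f x))\<^sup>2)}"

definition l2_inner :: "'a measure \<Rightarrow> ('a \<Rightarrow> complex) \<Rightarrow> ('a \<Rightarrow> complex) \<Rightarrow> complex" where
  "l2_inner M f g = (LINT x|M. f x * cnj (g x))"

definition l2_norm :: "'a measure \<Rightarrow> ('a \<Rightarrow> complex) \<Rightarrow> real" where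
  "l2_norm M f = sqrt (LINT x|M. (norm (f x))\<^sup>2)"

type_synonym 'a operator = "('a \<Rightarrow> complex) \<Rightarrow> ('a \<Rightarrow> complex)"

text \<open>
  By linearity and the norm bound, almost everywhere equal arguments automatically have almost
  everywhere equal images, so such a map induces an element of \<open>B(L\<^sup>2(M))\<close>.
\<close>

definition bounded_operator :: "'a measure \<Rightarrow> 'a operator \<Rightarrow> bool" where
  "bounded_operator M A \<longleftrightarrow>
     (\<forall>f \<in> L2 M. A f \<in> L2 M) \<and>
     (\<forall>f \<in> L2 M. \<forall>g \<in> L2 M. AE x in M. A (\<lambda>y. f y + g y) x = A f x + A g x) \<and>
     (\<forall>c. \<forall>f \<in> L2 M. AE x in M. A (\<lambda>y. c * f y) x = c * A f x) \<and>
     (\<exists>c. \<forall>f \<in> L2 M. l2_norm M (A f) \<le> c * l2_norm M f)"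

text \<open>The operator norm, in the form of \<^const>\<open>onorm\<close>; null functions contribute \<open>0 / 0 = 0\<close>.\<close>

definition op_norm :: "'a measure \<Rightarrow> 'a operator \<Rightarrow> real" where
  "op_norm M A = (SUP f\<in>L2 M. l2_norm M (A f) / l2_norm M f)"

definition adjoint_op :: "'a measure \<Rightarrow> 'a operator \<Rightarrow> 'a operator" where
  "adjoint_op M A = (SOME B. bounded_operator M B \<and>
     (\<forall>f \<in> L2 M. \<forall>g \<in> L2 M. l2_inner M (A f) g = l2_inner M f (B g)))"

definition orthonormal_basis :: "'a measure \<Rightarrow> ('a \<Rightarrow> complex) set \<Rightarrow> bool" where
  "orthonormal_basis M E \<longleftrightarrow>
     E \<subseteq> L2 M \<and>
     (\<forall>e \<in> E. \<forall>e' \<in> E. l2_inner M e e' = (if e = e' then 1 else 0)) \<and>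
     (\<forall>f \<in> L2 M. (\<forall>e \<in> E. l2_inner M f e = 0) \<longrightarrow> (AE x in M. f x = 0))"

definition some_onb :: "'a measure \<Rightarrow> ('a \<Rightarrow> complex) set" where
  "some_onb M = (SOME E. orthonormal_basis M E)"

definition hilbert_schmidt :: "'a measure \<Rightarrow> 'a operator \<Rightarrow> bool" where
  "hilbert_schmidt M A \<longleftrightarrow> bounded_operator M A \<and>
     (\<exists>E. orthonormal_basis M E \<and> (\<lambda>e. (l2_norm M (A e))\<^sup>2) summable_on E)"

text \<open>
  For Hilbert--Schmidt (respectively trace class) operators the next two sums do not depend on
  the orthonormal basis.
\<close>

definition hs_norm :: "'a measure \<Rightarrow> 'a operator \<Rightarrow> real" where
  "hs_norm M A = sqrt (\<Sum>\<^sub>\<infinity>e\<in>some_onb M. (l2_norm M (A e))\<^sup>2)"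

definition op_trace :: "'a measure \<Rightarrow> 'a operator \<Rightarrow> complex" where
  "op_trace M A = (\<Sum>\<^sub>\<infinity>e\<in>some_onb M. l2_inner M (A e) e)"

definition is_kernel :: "'a measure \<Rightarrow> 'a operator \<Rightarrow> ('a \<times> 'a \<Rightarrow> complex) \<Rightarrow> bool" where
  "is_kernel M A K \<longleftrightarrow> K \<in> L2 (M \<Otimes>\<^sub>M M) \<and>
     (\<forall>f \<in> L2 M. AE x in M. A f x = (LINT y|M. K (x, y) * f y))"

definition hs_kernel :: "'a measure \<Rightarrow> 'a operator \<Rightarrow> ('a \<times> 'a \<Rightarrow> complex)" where
  "hs_kernel M A = (SOME K. is_kernel M A K)"


section \<open>The affine Poincare group and its representations\<close>

type_synonym plane = "real \<times> real"
type_synonym affine_poincare = "plane \<times> real \<times> real"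

definition P :: "affine_poincare set" where
  "P = {(b, a, \<theta>). a > 0}"

definition haar :: "affine_poincare measure" where
  "haar = density (restrict_space lborel P) (\<lambda>(b, a, \<theta>). ennreal (1 / a ^ 3))"

definition modular :: "affine_poincare \<Rightarrow> real" where
  "modular = (\<lambda>(b, a, \<theta>). 1 / a\<^sup>2)"

definition lorentz :: "real \<Rightarrow> plane \<Rightarrow> plane" where
  "lorentz \<theta> = (\<lambda>(x1, x2). (cosh \<theta> * x1 + sinh \<theta> * x2, sinh \<theta> * x1 + cosh \<theta> * x2))"

definition minkowski :: "plane \<Rightarrow> plane \<Rightarrow> real" where
  "minkowski x y = fst x * fst y - snd x * snd y"

text \<open>\<open>cone i j\<close> is the cone with lower index \<open>i\<close> and upper index \<open>j\<close>, for \<open>i, j \<in> {1, 2}\<close>.\<close>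

definition cone :: "nat \<Rightarrow> nat \<Rightarrow> plane set" where
  "cone i j = {(x1, x2).
     if j = 1 then x1\<^sup>2 > x2\<^sup>2 \<and> (if i = 1 then x1 > 0 else x1 < 0)
     else x1\<^sup>2 < x2\<^sup>2 \<and> (if i = 1 then x2 > 0 else x2 < 0)}"

definition cone_measure :: "nat \<Rightarrow> nat \<Rightarrow> plane measure" where
  "cone_measure i j = restrict_space lborel (cone i j)"

text \<open>
  The formulas for the representation and for the Duflo--Moore operator are the same on all four
  cones; the indices \<open>i, j\<close> enter only through the space \<open>L2 (cone_measure i j)\<close> acted upon.
\<close>

definition irrep :: "affine_poincare \<Rightarrow> plane operator" where
  "irrep = (\<lambda>(b, a, \<theta>) \<phi> x.
     of_real a * exp (\<i> * of_real (minkowski x b)) * \<phi> (a *\<^sub>R lorentz (- \<theta>) x))"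

definition duflo_moore :: "plane operator" where
  "duflo_moore \<phi> = (\<lambda>x. of_real (1 / (2 * pi) * sqrt \<bar>minkowski x x\<bar>) * \<phi> x)"

definition duflo_moore_domain :: "nat \<Rightarrow> nat \<Rightarrow> (plane \<Rightarrow> complex) set" where
  "duflo_moore_domain i j =
     {\<phi> \<in> L2 (cone_measure i j). duflo_moore \<phi> \<in> L2 (cone_measure i j)}"


section \<open>The Fourier transform\<close>

text \<open>
  For \<open>f\<close> in \<open>L\<^sup>1 \<inter> L\<^sup>2\<close> the defining integral makes sense on the (dense) domain of the unbounded
  Duflo--Moore operator; the transform is the Hilbert--Schmidt operator that it determines there.
\<close>

definition is_fourier_L1_L2 ::
    "(affine_poincare \<Rightarrow> complex) \<Rightarrow> nat \<Rightarrow> nat \<Rightarrow> plane operator \<Rightarrow> bool" where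
  "is_fourier_L1_L2 f i j A \<longleftrightarrow>
     integrable haar f \<and> f \<in> L2 haar \<and>
     hilbert_schmidt (cone_measure i j) A \<and>
     (\<forall>\<phi> \<in> duflo_moore_domain i j. AE x in cone_measure i j.
        A \<phi> x = (LINT p|haar. f p * irrep p (duflo_moore \<phi>) x))"

text \<open>Extension by continuity from \<open>L\<^sup>1 \<inter> L\<^sup>2\<close> to \<open>L\<^sup>2\<close>, in Hilbert--Schmidt norm.\<close>

definition is_fourier ::
    "(affine_poincare \<Rightarrow> complex) \<Rightarrow> nat \<Rightarrow> nat \<Rightarrow> plane operator \<Rightarrow> bool" where
  "is_fourier f i j A \<longleftrightarrow>
     hilbert_schmidt (cone_measure i j) A \<and>
     (\<exists>(F :: nat \<Rightarrow> affine_poincare \<Rightarrow> complex) (B :: nat \<Rightarrow> plane operator).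
        (\<forall>n. is_fourier_L1_L2 (F n) i j (B n)) \<and>
        (\<lambda>n. l2_norm haar (\<lambda>p. F n p - f p)) \<longlonglongrightarrow> 0 \<and>
        (\<lambda>n. hs_norm (cone_measure i j) (\<lambda>\<phi> x. B n \<phi> x - A \<phi> x)) \<longlonglongrightarrow> 0)"

definition fourier ::
    "(affine_poincare \<Rightarrow> complex) \<Rightarrow> nat \<Rightarrow> nat \<Rightarrow> plane operator" where
  "fourier f i j = (SOME A. is_fourier f i j A)"


section \<open>Symbols and pseudo-differential operators\<close>

type_synonym op_symbol = "affine_poincare \<Rightarrow> nat \<Rightarrow> nat \<Rightarrow> plane operator"

text \<open>
  \<open>\<sigma> p i j\<close> is the value of the symbol at the point \<open>p\<close> and the representation with indices
  \<open>i, j\<close>.  As usual for operator-valued functions, a symbol is understood to be weakly measurable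
  in \<open>p\<close>: otherwise the functions produced by the pseudo-differential operator need not be
  measurable (multiply a symbol by a non-measurable unimodular function of \<open>p\<close>).
\<close>

definition operator_valued_symbol :: "op_symbol \<Rightarrow> bool" where
  "operator_valued_symbol \<sigma> \<longleftrightarrow>
     (\<forall>i \<in> {1, 2}. \<forall>j \<in> {1, 2}.
        (\<forall>p \<in> P. bounded_operator (cone_measure i j) (\<sigma> p i j)) \<and>
        (\<forall>\<phi> \<in> L2 (cone_measure i j). \<forall>\<psi> \<in> L2 (cone_measure i j).
           (\<lambda>p. l2_inner (cone_measure i j) (\<sigma> p i j \<phi>) \<psi>) \<in> borel_measurable haar))"

definition dm_symbol :: "op_symbol \<Rightarrow> op_symbol" where
  "dm_symbol \<sigma> p i j = (\<lambda>\<phi>. duflo_moore (\<sigma> p i j \<phi>))"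

definition pseudo_diff :: "op_symbol \<Rightarrow> affine_poincare operator" where
  "pseudo_diff \<sigma> f = (\<lambda>p. of_real (modular p powr (- 1 / 2)) *
     (\<Sum>i\<in>{1, 2}. \<Sum>j\<in>{1, 2}. op_trace (cone_measure i j)
        (\<lambda>\<phi>. dm_symbol \<sigma> p i j (fourier f i j (adjoint_op (cone_measure i j) (irrep p) \<phi>)))))"

definition G :: "op_symbol \<Rightarrow> nat \<Rightarrow> nat \<Rightarrow> affine_poincare \<Rightarrow> complex" where
  "G \<sigma> i j = (\<lambda>p. of_real (modular p powr (- 1 / 2) *
     l2_norm (cone_measure i j \<Otimes>\<^sub>M cone_measure i j)
       (hs_kernel (cone_measure i j) (dm_symbol \<sigma> p i j))))"

end

theory Submission
  imports Defs "HOL-Probability.Characteristic_Functions"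
begin

text \<open>
  In polar coordinates \<open>y = a \<Lambda>\<^sub>-\<^sub>\<theta> x\<close> on a cone, the Fourier transform of \<open>f\<close> is an integral operator
  whose kernel is, up to an explicit factor, the partial Fourier transform of \<open>f\<close> in the variable
  \<open>b\<close>; the Duflo--Moore factor is exactly what makes the Plancherel inequality in the plane bound
  the Hilbert--Schmidt norm by the norm of \<open>f\<close> in \<open>L\<^sup>2(P)\<close>.  Since \<open>irrep p\<close> is unitary, the trace that
  defines \<open>T\<^sub>\<sigma> f\<close> is the Hilbert--Schmidt pairing of the symbol with this operator, and Cauchy--Schwarz
  yields \<open>|T\<^sub>\<sigma> f| \<le> (\<Sum>i j. G i j) * \<parallel>f\<parallel>\<close> pointwise.
\<close>

section \<open>Square-integrable functions\<close>

text \<open>The maps \<open>fourier f i j\<close>, \<open>adjoint_op\<close>,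
  \<open>hs_kernel\<close> and \<open>some_onb\<close> are choices by \<open>SOME\<close>, and
  operators act on representatives. So each choice needs an existence proof before it can be used,
  and the linearity of \<open>pseudo_diff\<close> rests on the uniqueness, up to null sets, of the
  extended Fourier transform. A second obstacle is measurability: the value at p is a sum over an
  orthonormal basis of terms in which the symbol and the representation both depend on p. It becomes
  a countable series of products of scalar functions of p once every orthonormal system is known to
  be countable; this is why separability is proved for each cone. Constants: the factor 1/(2 pi) of
  the Duflo-Moore operator enters squared and cancels the (2 pi)^2 that Plancherel costs for the
  unnormalised exponential exp(i <x;b>). For a single cone only an inequality can be expected, since
  a cone sees just a part of the frequency plane.\<close>

lemma L2_measurable [measurable_dest]: "f \<in> L2 M \<Longrightarrow> f \<in> borel_measurable M"
  by (simp add: L2_def)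

lemma L2_integrable: "f \<in> L2 M \<Longrightarrow> integrable M (\<lambda>x. (norm (f x))\<^sup>2)"
  by (simp add: L2_def)

lemma L2_I: "f \<in> borel_measurable M \<Longrightarrow> integrable M (\<lambda>x. (norm (f x))\<^sup>2) \<Longrightarrow> f \<in> L2 M"
  by (simp add: L2_def)

lemma l2_norm_nonneg [simp]: "0 \<le> l2_norm M f"
  by (simp add: l2_norm_def)

lemma l2_norm_sq: "(l2_norm M f)\<^sup>2 = (LINT x|M. (norm (f x))\<^sup>2)"
  by (simp add: l2_norm_def)

lemma nn_integral_L2:
  "f \<in> L2 M \<Longrightarrow> (\<integral>\<^sup>+x. ennreal ((norm (f x))\<^sup>2) \<partial>M) = ennreal ((l2_norm M f)\<^sup>2)"
  by (simp add: l2_norm_sq nn_integral_eq_integral L2_integrable)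

text \<open>The Bochner integral inside \<open>l2_norm\<close> is 0 by default when the integrand is
  not integrable, so a small \<open>l2_norm\<close> alone proves nothing. Estimates are therefore
  made with the nonnegative integral, which yields membership and bound together.\<close>

lemma L2_bounded_I:
  assumes "f \<in> borel_measurable M" "(\<integral>\<^sup>+x. ennreal ((norm (f x))\<^sup>2) \<partial>M) \<le> ennreal c"
  shows "f \<in> L2 M" and "0 \<le> c \<Longrightarrow> (l2_norm M f)\<^sup>2 \<le> c"
proof -
  have "(\<integral>\<^sup>+x. ennreal ((norm (f x))\<^sup>2) \<partial>M) < \<infinity>"
    using assms(2) by (simp add: le_less_trans)
  then show L2: "f \<in> L2 M"
    using assms(1) by (intro L2_I integrableI_nonneg) auto
  show "(l2_norm M f)\<^sup>2 \<le> c" if "0 \<le> c"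
    using assms(2) that by (simp add: nn_integral_L2[OF L2])
qed

lemma L2_bounded:
  assumes "f \<in> borel_measurable M" "(\<integral>\<^sup>+x. ennreal ((norm (f x))\<^sup>2) \<partial>M) \<le> ennreal (c\<^sup>2)" "0 \<le> c"
  shows "f \<in> L2 M" and "l2_norm M f \<le> c"
  using L2_bounded_I[OF assms(1,2)] assms(3) by (auto intro: power2_le_imp_le)

lemma L2_zero [simp]: "(\<lambda>x. 0) \<in> L2 M"
  by (simp add: L2_def)

lemma l2_norm_zero [simp]: "l2_norm M (\<lambda>x. 0) = 0"
  by (simp add: l2_norm_def)

lemma norm_add_sq_le: "(norm (a + b :: complex))\<^sup>2 \<le> 2 * (norm a)\<^sup>2 + 2 * (norm b)\<^sup>2"
proof -
  have "(norm (a + b))\<^sup>2 \<le> (norm a + norm b)\<^sup>2"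
    by (intro power_mono norm_triangle_ineq) auto
  also have "\<dots> \<le> 2 * (norm a)\<^sup>2 + 2 * (norm b)\<^sup>2"
    using sum_squares_bound[of "norm a" "norm b"] by (simp add: power2_sum)
  finally show ?thesis .
qed

lemma L2_add [intro]:
  assumes "f \<in> L2 M" "g \<in> L2 M" shows "(\<lambda>x. f x + g x) \<in> L2 M"
proof (rule L2_I)
  show "integrable M (\<lambda>x. (norm (f x + g x))\<^sup>2)"
    by (rule Bochner_Integration.integrable_bound[of _ "\<lambda>x. 2 * (norm (f x))\<^sup>2 + 2 * (norm (g x))\<^sup>2"])
      (use assms norm_add_sq_le in \<open>auto simp: L2_integrable L2_measurable\<close>)
qed (use assms in \<open>auto simp: L2_measurable\<close>)

lemma L2_scale [intro]: "f \<in> L2 M \<Longrightarrow> (\<lambda>x. c * f x) \<in> L2 M"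
  by (auto simp: L2_def norm_mult power_mult_distrib)

lemma L2_uminus [intro]: "f \<in> L2 M \<Longrightarrow> (\<lambda>x. - f x) \<in> L2 M"
  by (auto simp: L2_def)

lemma L2_diff [intro]: "f \<in> L2 M \<Longrightarrow> g \<in> L2 M \<Longrightarrow> (\<lambda>x. f x - g x) \<in> L2 M"
  using L2_add[of f M "\<lambda>x. - g x"] by auto

lemma L2_cnj [intro]: "f \<in> L2 M \<Longrightarrow> (\<lambda>x. cnj (f x)) \<in> L2 M"
  by (auto simp: L2_def intro: borel_measurable_continuous_onI[of cnj, THEN measurable_compose_rev])

lemma L2_sum [intro]: "(\<And>i. i \<in> I \<Longrightarrow> f i \<in> L2 M) \<Longrightarrow> (\<lambda>x. \<Sum>i\<in>I. f i x) \<in> L2 M"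
  by (induction I rule: infinite_finite_induct) auto

lemma borel_measurable_cnj [measurable]: "cnj \<in> borel_measurable borel"
  by (intro borel_measurable_continuous_onI continuous_intros)

lemma L2_mult_bounded:
  assumes "f \<in> L2 M" "w \<in> borel_measurable M" "\<And>x. x \<in> space M \<Longrightarrow> norm (w x) \<le> C"
  shows "(\<lambda>x. w x * f x) \<in> L2 M"
proof (rule L2_I)
  show "integrable M (\<lambda>x. (norm (w x * f x))\<^sup>2)"
  proof (rule Bochner_Integration.integrable_bound[of _ "\<lambda>x. C\<^sup>2 * (norm (f x))\<^sup>2"])
    show "AE x in M. norm ((norm (w x * f x))\<^sup>2) \<le> norm (C\<^sup>2 * (norm (f x))\<^sup>2)"
      using assms(3) by (auto simp: norm_mult power_mult_distrib intro!: mult_right_mono power_mono)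
  qed (use assms in \<open>auto simp: L2_integrable L2_measurable\<close>)
qed (use assms in \<open>auto simp: L2_measurable\<close>)

lemma l2_norm_cong_AE:
  assumes "f \<in> borel_measurable M" "g \<in> borel_measurable M" "AE x in M. f x = g x"
  shows "l2_norm M f = l2_norm M g"
  unfolding l2_norm_def using assms by (intro arg_cong[of _ _ sqrt] integral_cong_AE) auto

lemma l2_inner_cong_AE:
  assumes "f \<in> borel_measurable M" "f' \<in> borel_measurable M" "g \<in> borel_measurable M"
    "g' \<in> borel_measurable M" "AE x in M. f x = f' x" "AE x in M. g x = g' x"
  shows "l2_inner M f g = l2_inner M f' g'"
  unfolding l2_inner_def using assms by (intro integral_cong_AE) auto

lemma integrable_norm_mult:
  assumes "f \<in> L2 M" "g \<in> L2 M"
  shows "integrable M (\<lambda>x. norm (f x) * norm (g x))"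
proof (rule Bochner_Integration.integrable_bound[of _ "\<lambda>x. (norm (f x))\<^sup>2 + (norm (g x))\<^sup>2"])
  show "AE x in M. norm (norm (f x) * norm (g x)) \<le> norm ((norm (f x))\<^sup>2 + (norm (g x))\<^sup>2)"
  proof (rule AE_I2)
    fix x show "norm (norm (f x) * norm (g x)) \<le> norm ((norm (f x))\<^sup>2 + (norm (g x))\<^sup>2)"
    proof -
      have "0 \<le> norm (f x) * norm (g x)" by simp
      then show ?thesis
        using sum_squares_bound[of "norm (f x)" "norm (g x)"]
        unfolding real_norm_def abs_of_nonneg[OF \<open>0 \<le> norm (f x) * norm (g x)\<close>] by linarith
    qed
  qed
qed (use assms in \<open>auto simp: L2_integrable L2_measurable\<close>)

lemma integrable_l2_inner:
  assumes "f \<in> L2 M" "g \<in> L2 M"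
  shows "integrable M (\<lambda>x. f x * cnj (g x))"
  by (rule Bochner_Integration.integrable_bound[OF integrable_norm_mult[OF assms]])
    (use assms in \<open>auto simp: norm_mult L2_measurable\<close>)

lemma integrable_L2_mult:
  assumes "f \<in> L2 M" "g \<in> L2 M"
  shows "integrable M (\<lambda>x. f x * g x)"
  using integrable_l2_inner[OF assms(1) L2_cnj[OF assms(2)]] by simp

text \<open>The moduli stay inside the integral because the absolute convergence of the Fourier
  integral uses this form; the bound on \<open>l2_inner\<close> is a corollary.\<close>

lemma integral_norm_mult_le:
  assumes "f \<in> L2 M" "g \<in> L2 M"
  shows "(LINT x|M. norm (f x) * norm (g x)) \<le> l2_norm M f * l2_norm M g"
proof -
  let ?I = "LINT x|M. norm (f x) * norm (g x)"
  have nn: "0 \<le> ?I" by simp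
  have "ennreal ?I = (\<integral>\<^sup>+x. ennreal (norm (f x)) * ennreal (norm (g x)) \<partial>M)"
    using nn_integral_eq_integral[OF integrable_norm_mult[OF assms]] by (simp add: ennreal_mult')
  then have "ennreal (?I\<^sup>2) = (\<integral>\<^sup>+x. ennreal (norm (f x)) * ennreal (norm (g x)) \<partial>M)\<^sup>2"
    by (metis ennreal_power nn)
  also have "\<dots> \<le> (\<integral>\<^sup>+x. (ennreal (norm (f x)))\<^sup>2 \<partial>M) * (\<integral>\<^sup>+x. (ennreal (norm (g x)))\<^sup>2 \<partial>M)"
    using assms by (intro Cauchy_Schwarz_nn_integral) (auto simp: L2_measurable)
  also have "\<dots> = ennreal ((l2_norm M f)\<^sup>2) * ennreal ((l2_norm M g)\<^sup>2)"
    using assms by (simp add: ennreal_power nn_integral_L2)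
  also have "\<dots> = ennreal ((l2_norm M f * l2_norm M g)\<^sup>2)"
    by (simp add: ennreal_mult' power_mult_distrib)
  finally have "?I\<^sup>2 \<le> (l2_norm M f * l2_norm M g)\<^sup>2" by simp
  then show ?thesis by (rule power2_le_imp_le) simp
qed

lemma cauchy_schwarz:
  assumes "f \<in> L2 M" "g \<in> L2 M"
  shows "norm (l2_inner M f g) \<le> l2_norm M f * l2_norm M g"
proof -
  have "norm (l2_inner M f g) \<le> (LINT x|M. norm (f x * cnj (g x)))"
    unfolding l2_inner_def by (rule integral_norm_bound)
  also have "\<dots> \<le> l2_norm M f * l2_norm M g"
    using integral_norm_mult_le[OF assms] by (simp add: norm_mult)
  finally show ?thesis .
qed

lemma l2_inner_self: "l2_inner M f f = of_real ((l2_norm M f)\<^sup>2)"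
proof -
  have "f x * cnj (f x) = complex_of_real ((norm (f x))\<^sup>2)" for x
    by (metis complex_norm_square)
  then show ?thesis by (simp only: l2_inner_def l2_norm_sq integral_complex_of_real)
qed

lemma l2_inner_add_left:
  "f \<in> L2 M \<Longrightarrow> g \<in> L2 M \<Longrightarrow> h \<in> L2 M \<Longrightarrow>
    l2_inner M (\<lambda>x. f x + g x) h = l2_inner M f h + l2_inner M g h"
  by (simp add: l2_inner_def distrib_right integrable_l2_inner)

lemma l2_inner_diff_left:
  "f \<in> L2 M \<Longrightarrow> g \<in> L2 M \<Longrightarrow> h \<in> L2 M \<Longrightarrow>
    l2_inner M (\<lambda>x. f x - g x) h = l2_inner M f h - l2_inner M g h"
  by (simp add: l2_inner_def left_diff_distrib integrable_l2_inner)

lemma l2_inner_scale_left: "l2_inner M (\<lambda>x. c * f x) h = c * l2_inner M f h"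
  by (simp add: l2_inner_def mult.assoc)

lemma l2_inner_cnj: "l2_inner M g f = cnj (l2_inner M f g)"
  unfolding l2_inner_def by (subst Bochner_Integration.integral_cnj[symmetric]) (simp add: mult.commute)

lemma l2_inner_sum_left:
  assumes "\<And>i. i \<in> I \<Longrightarrow> f i \<in> L2 M" "h \<in> L2 M"
  shows "l2_inner M (\<lambda>x. \<Sum>i\<in>I. c i * f i x) h = (\<Sum>i\<in>I. c i * l2_inner M (f i) h)"
  using assms(1)
proof (induction I rule: infinite_finite_induct)
  case (insert i I)
  have "(\<lambda>x. \<Sum>i\<in>I. c i * f i x) \<in> L2 M"
    using insert by (intro L2_sum L2_scale) blast
  then show ?case
    using insert assms(2) by (simp add: l2_inner_add_left l2_inner_scale_left L2_scale)
qed (auto simp: l2_inner_def)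

lemma l2_norm_add_sq:
  assumes "f \<in> L2 M" "g \<in> L2 M"
  shows "(l2_norm M (\<lambda>x. f x + g x))\<^sup>2 = (l2_norm M f)\<^sup>2 + 2 * Re (l2_inner M f g) + (l2_norm M g)\<^sup>2"
proof -
  have eq: "(norm (f x + g x))\<^sup>2 = (norm (f x))\<^sup>2 + 2 * Re (f x * cnj (g x)) + (norm (g x))\<^sup>2" for x
    unfolding cmod_power2 by (simp add: power2_eq_square algebra_simps)
  have "integrable M (\<lambda>x. Re (f x * cnj (g x)))"
    using integrable_l2_inner[OF assms] by (rule integrable_Re)
  moreover have "(LINT x|M. Re (f x * cnj (g x))) = Re (l2_inner M f g)"
    unfolding l2_inner_def using integrable_l2_inner[OF assms] by (rule integral_Re)
  ultimately show ?thesis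
    using assms by (simp add: l2_norm_sq eq L2_integrable del: times_complex.sel)
qed

lemma l2_norm_triangle:
  assumes "f \<in> L2 M" "g \<in> L2 M"
  shows "l2_norm M (\<lambda>x. f x + g x) \<le> l2_norm M f + l2_norm M g"
proof (rule power2_le_imp_le)
  have "Re (l2_inner M f g) \<le> l2_norm M f * l2_norm M g"
    using cauchy_schwarz[OF assms] complex_Re_le_cmod order_trans by blast
  then show "(l2_norm M (\<lambda>x. f x + g x))\<^sup>2 \<le> (l2_norm M f + l2_norm M g)\<^sup>2"
    by (simp add: l2_norm_add_sq[OF assms] power2_sum)
qed simp

lemma l2_norm_scale: "l2_norm M (\<lambda>x. c * f x) = norm c * l2_norm M f"
  by (simp add: l2_norm_def norm_mult power_mult_distrib real_sqrt_mult)

lemma l2_norm_uminus [simp]: "l2_norm M (\<lambda>x. - f x) = l2_norm M f"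
  by (simp add: l2_norm_def)

lemma l2_norm_minus_commute: "l2_norm M (\<lambda>x. f x - g x) = l2_norm M (\<lambda>x. g x - f x)"
  by (simp add: l2_norm_def norm_minus_commute)

lemma l2_norm_triangle_diff:
  assumes "f \<in> L2 M" "g \<in> L2 M" "h \<in> L2 M"
  shows "l2_norm M (\<lambda>x. f x - h x) \<le> l2_norm M (\<lambda>x. f x - g x) + l2_norm M (\<lambda>x. g x - h x)"
  using l2_norm_triangle[of "\<lambda>x. f x - g x" M "\<lambda>x. g x - h x"] assms by auto

lemma l2_norm_triangle_minus:
  assumes "f \<in> L2 M" "g \<in> L2 M"
  shows "l2_norm M f \<le> l2_norm M (\<lambda>x. f x - g x) + l2_norm M g"
  using l2_norm_triangle[of "\<lambda>x. f x - g x" M g] assms by auto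

lemma l2_norm_sum_le:
  assumes "\<And>i. i \<in> I \<Longrightarrow> f i \<in> L2 M"
  shows "l2_norm M (\<lambda>x. \<Sum>i\<in>I. f i x) \<le> (\<Sum>i\<in>I. l2_norm M (f i))"
  using assms
proof (induction I rule: infinite_finite_induct)
  case (insert i I)
  have "l2_norm M (\<lambda>x. f i x + (\<Sum>i\<in>I. f i x)) \<le> l2_norm M (f i) + l2_norm M (\<lambda>x. \<Sum>i\<in>I. f i x)"
    using insert by (intro l2_norm_triangle) auto
  then show ?case using insert by simp
qed auto

lemma l2_norm_eq_0_iff:
  assumes "f \<in> L2 M"
  shows "l2_norm M f = 0 \<longleftrightarrow> (AE x in M. f x = 0)"
proof -
  have "l2_norm M f = 0 \<longleftrightarrow> (LINT x|M. (norm (f x))\<^sup>2) = 0"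
    by (simp add: l2_norm_def)
  also have "\<dots> \<longleftrightarrow> (AE x in M. (norm (f x))\<^sup>2 = 0)"
    using assms by (intro integral_nonneg_eq_0_iff_AE) (auto simp: L2_integrable)
  finally show ?thesis by simp
qed

lemma l2_norm_diff_eq_0:
  assumes "f \<in> L2 M" "g \<in> L2 M" "l2_norm M (\<lambda>x. f x - g x) = 0"
  shows "AE x in M. f x = g x"
  using assms l2_norm_eq_0_iff[of "\<lambda>x. f x - g x" M] by auto

lemma l2_inner_tendsto:
  assumes "\<And>n. f n \<in> L2 M" "g \<in> L2 M" "h \<in> L2 M"
    and "((\<lambda>n. l2_norm M (\<lambda>x. f n x - g x)) \<longlongrightarrow> 0) F"
  shows "((\<lambda>n. l2_inner M (f n) h) \<longlongrightarrow> l2_inner M g h) F"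
proof -
  have "((\<lambda>n. l2_inner M (f n) h - l2_inner M g h) \<longlongrightarrow> 0) F"
  proof (rule tendsto_0_le[where K="l2_norm M h", OF assms(4)], rule always_eventually, rule allI)
    fix n
    have "l2_inner M (f n) h - l2_inner M g h = l2_inner M (\<lambda>x. f n x - g x) h"
      using assms by (simp add: l2_inner_diff_left)
    then show "norm (l2_inner M (f n) h - l2_inner M g h)
        \<le> norm (l2_norm M (\<lambda>x. f n x - g x)) * l2_norm M h"
      using cauchy_schwarz[of "\<lambda>x. f n x - g x" M h] assms by auto
  qed
  then show ?thesis by (simp add: LIM_zero_iff)
qed

text \<open>Riesz--Fischer: a rapidly convergent subsequence converges almost everywhere, and Fatou's
  lemma identifies its limit as the limit in norm.\<close>

lemma L2_complete:
  assumes f: "\<And>n. f n \<in> L2 M"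
    and Cauchy: "\<And>e. 0 < e \<Longrightarrow> \<exists>N. \<forall>m\<ge>N. \<forall>n\<ge>N. l2_norm M (\<lambda>x. f m x - f n x) < e"
  obtains g where "g \<in> L2 M" "(\<lambda>n. l2_norm M (\<lambda>x. f n x - g x)) \<longlonglongrightarrow> 0"
proof -
  \<comment> \<open>The rate 1/8 leaves room for a weight: squared distances are below 64^(-n), and
    after multiplication by 4^n they are still summable. Finiteness of the weighted sum at a point
    then forces increments of at most 2^(-n) there for large n.\<close>
  have "\<exists>r. \<forall>n. (\<forall>m\<ge>r n. \<forall>k\<ge>r n. l2_norm M (\<lambda>x. f m x - f k x) < (1/8)^n) \<and> r n < r (Suc n)"
  proof (rule dependent_nat_choice)
    show "\<exists>x. \<forall>m\<ge>x. \<forall>k\<ge>x. l2_norm M (\<lambda>x. f m x - f k x) < (1/8)^0"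
      by (rule Cauchy) simp
  next
    fix x n
    obtain N where "\<forall>m\<ge>N. \<forall>k\<ge>N. l2_norm M (\<lambda>x. f m x - f k x) < (1/8)^Suc n"
      using Cauchy[of "(1/8)^Suc n"] by auto
    then show "\<exists>y. (\<forall>m\<ge>y. \<forall>k\<ge>y. l2_norm M (\<lambda>x. f m x - f k x) < (1/8)^Suc n) \<and> x < y"
      by (intro exI[of _ "max N (Suc x)"]) auto
  qed
  then obtain r where r: "\<And>n m k. m \<ge> r n \<Longrightarrow> k \<ge> r n \<Longrightarrow> l2_norm M (\<lambda>x. f m x - f k x) < (1/8)^n"
    and "\<And>n. r n < r (Suc n)" by blast
  then have mono: "strict_mono r" by (simp add: strict_mono_Suc_iff)
  define d where "d n x = (norm (f (r (Suc n)) x - f (r n) x))\<^sup>2" for n x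
  have d_meas [measurable]: "d n \<in> borel_measurable M" for n
    unfolding d_def using f by measurable
  have d_int: "(\<integral>\<^sup>+x. ennreal (4^n * d n x) \<partial>M) \<le> ennreal ((1/2)^n)" for n
  proof -
    have "(\<integral>\<^sup>+x. ennreal (4^n * d n x) \<partial>M) = ennreal (4^n) * (\<integral>\<^sup>+x. ennreal (d n x) \<partial>M)"
      by (subst nn_integral_cmult[symmetric]) (auto simp: ennreal_mult' d_meas)
    also have "\<dots> = ennreal (4^n * (l2_norm M (\<lambda>x. f (r (Suc n)) x - f (r n) x))\<^sup>2)"
      unfolding d_def using f by (subst nn_integral_L2) (auto simp: ennreal_mult')
    also have "\<dots> \<le> ennreal (4^n * ((1/8)^n)\<^sup>2)"
      using r[of n "r (Suc n)" "r n"] mono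
      by (intro ennreal_leI mult_left_mono power_mono) (auto simp: strict_mono_less_eq)
    also have "4^n * ((1/8)^n)\<^sup>2 = (1/16::real)^n"
      by (simp add: power2_eq_square flip: power_mult_distrib)
    also have "ennreal ((1/16)^n) \<le> ennreal ((1/2)^n)"
      by (intro ennreal_leI power_mono) auto
    finally show ?thesis .
  qed
  have "(\<integral>\<^sup>+x. (\<Sum>n. ennreal (4^n * d n x)) \<partial>M) = (\<Sum>n. \<integral>\<^sup>+x. ennreal (4^n * d n x) \<partial>M)"
    by (intro nn_integral_suminf) auto
  also have "\<dots> \<le> (\<Sum>n. ennreal ((1/2)^n))"
    by (intro suminf_le d_int) auto
  also have "\<dots> = ennreal 2"
    by (subst suminf_ennreal2) (auto simp: suminf_geometric)
  finally have "(\<integral>\<^sup>+x. (\<Sum>n. ennreal (4^n * d n x)) \<partial>M) \<noteq> \<infinity>"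
    by (auto simp: top_unique)
  then have "AE x in M. (\<Sum>n. ennreal (4^n * d n x)) \<noteq> \<infinity>"
    by (intro nn_integral_noteq_infinite) auto
  then have conv: "AE x in M. convergent (\<lambda>n. f (r n) x)"
  proof (rule AE_mp, intro AE_I2 impI)
    fix x assume "(\<Sum>n. ennreal (4^n * d n x)) \<noteq> \<infinity>"
    then have "summable (\<lambda>n. 4^n * d n x)"
      by (intro summable_suminf_not_top) (auto simp: d_def)
    then have "(\<lambda>n. 4^n * d n x) \<longlonglongrightarrow> 0" by (rule summable_LIMSEQ_zero)
    then have "\<forall>\<^sub>F n in sequentially. 4^n * d n x < 1" by (rule order_tendstoD) simp
    then have "\<forall>\<^sub>F n in sequentially. norm (f (r (Suc n)) x - f (r n) x) \<le> (1/2)^n"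
    proof eventually_elim
      case (elim n)
      have four: "((2::real)^n)\<^sup>2 = 4^n"
        by (subst power2_eq_square, subst power_mult_distrib[symmetric]) simp
      have "(2^n * norm (f (r (Suc n)) x - f (r n) x))\<^sup>2 = 4^n * d n x"
        unfolding d_def power_mult_distrib four ..
      then have "2^n * norm (f (r (Suc n)) x - f (r n) x) \<le> 1"
        using elim power2_le_imp_le[of "2^n * norm (f (r (Suc n)) x - f (r n) x)" 1] by auto
      then show ?case by (simp add: field_simps)
    qed
    then have "summable (\<lambda>n. f (r (Suc n)) x - f (r n) x)"
      by (rule summable_comparison_test_ev) (simp add: summable_geometric)
    then have "(\<lambda>n. \<Sum>k<n. f (r (Suc k)) x - f (r k) x) \<longlonglongrightarrow> (\<Sum>n. f (r (Suc n)) x - f (r n) x)"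
      by (rule summable_LIMSEQ)
    then have "(\<lambda>n. (f (r n) x - f (r 0) x) + f (r 0) x)
        \<longlonglongrightarrow> (\<Sum>n. f (r (Suc n)) x - f (r n) x) + f (r 0) x"
      by (intro tendsto_add tendsto_const) (simp add: sum_lessThan_telescope[of "\<lambda>n. f (r n) x"])
    then show "convergent (\<lambda>n. f (r n) x)" by (auto simp: convergent_def)
  qed
  define g where "g x = lim (\<lambda>n. f (r n) x)" for x
  have [measurable]: "f n \<in> borel_measurable M" for n using f by (simp add: L2_measurable)
  have g_meas [measurable]: "g \<in> borel_measurable M" unfolding g_def by measurable
  have lim: "AE x in M. (\<lambda>n. f (r n) x) \<longlonglongrightarrow> g x"
    using conv by eventually_elim (simp add: g_def convergent_LIMSEQ_iff)
  have bound: "(\<integral>\<^sup>+x. ennreal ((norm (f m x - g x))\<^sup>2) \<partial>M) \<le> ennreal (((1/8)^n)\<^sup>2)"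
    if "m \<ge> r n" for m n
  proof -
    have "(\<integral>\<^sup>+x. ennreal ((norm (f m x - g x))\<^sup>2) \<partial>M) =
        (\<integral>\<^sup>+x. liminf (\<lambda>k. ennreal ((norm (f m x - f (r k) x))\<^sup>2)) \<partial>M)"
      using lim
      by (intro nn_integral_cong_AE, eventually_elim)
        (rule sym, intro lim_imp_Liminf tendsto_ennrealI tendsto_intros, auto)
    also have "\<dots> \<le> liminf (\<lambda>k. \<integral>\<^sup>+x. ennreal ((norm (f m x - f (r k) x))\<^sup>2) \<partial>M)"
      by (intro nn_integral_liminf) auto
    also have "\<dots> = liminf (\<lambda>k. ennreal ((l2_norm M (\<lambda>x. f m x - f (r k) x))\<^sup>2))"
      using f by (subst nn_integral_L2) auto
    also have "\<dots> \<le> ennreal (((1/8)^n)\<^sup>2)"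
    proof (rule Liminf_le)
      show "\<forall>\<^sub>F k in sequentially. ennreal ((l2_norm M (\<lambda>x. f m x - f (r k) x))\<^sup>2) \<le> ennreal (((1/8)^n)\<^sup>2)"
        using eventually_ge_at_top[of n]
      proof eventually_elim
        case (elim k)
        then show ?case
          using r[of n m "r k"] that mono
          by (intro ennreal_leI power_mono) (auto simp: strict_mono_less_eq)
      qed
    qed simp
    finally show ?thesis .
  qed
  have B: "(\<lambda>x. f m x - g x) \<in> L2 M" "l2_norm M (\<lambda>x. f m x - g x) \<le> (1/8)^n"
    if "m \<ge> r n" for m n
    using L2_bounded[OF _ bound[OF that]] by auto
  have "(\<lambda>x. f (r 0) x - g x) \<in> L2 M" using B(1)[of 0 "r 0"] by auto
  from L2_diff[OF f[of "r 0"] this] have g: "g \<in> L2 M" by simp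
  moreover have "(\<lambda>n. l2_norm M (\<lambda>x. f n x - g x)) \<longlonglongrightarrow> 0"
  proof (rule LIMSEQ_I)
    fix e :: real assume "0 < e"
    then obtain n where "(1/8::real)^n < e"
      using real_arch_pow_inv[of e "1/8"] by auto
    then show "\<exists>no. \<forall>n\<ge>no. norm (l2_norm M (\<lambda>x. f n x - g x) - 0) < e"
      using B(2)[of n] by (intro exI[of _ "r n"]) (auto intro: le_less_trans)
  qed
  ultimately show ?thesis by (rule that)
qed

section \<open>Orthonormal bases and bounded operators\<close>

text \<open>Completeness is split off from \<open>orthonormal_basis\<close> because Zorn's lemma,
  Bessel's inequality and countability concern orthonormal systems. Two distinct representatives of
  one class cannot both belong: their inner product would be 1 instead of 0.\<close>

definition orthonormal :: "'a measure \<Rightarrow> ('a \<Rightarrow> complex) set \<Rightarrow> bool" where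
  "orthonormal M E \<longleftrightarrow> E \<subseteq> L2 M \<and>
     (\<forall>e\<in>E. \<forall>e'\<in>E. l2_inner M e e' = (if e = e' then 1 else 0))"

lemma orthonormal_L2: "orthonormal M E \<Longrightarrow> e \<in> E \<Longrightarrow> e \<in> L2 M"
  by (auto simp: orthonormal_def)

lemma orthonormal_inner:
  "orthonormal M E \<Longrightarrow> e \<in> E \<Longrightarrow> e' \<in> E \<Longrightarrow> l2_inner M e e' = (if e = e' then 1 else 0)"
  by (auto simp: orthonormal_def)

lemma orthonormal_norm: "orthonormal M E \<Longrightarrow> e \<in> E \<Longrightarrow> l2_norm M e = 1"
  using l2_inner_self[of M e] orthonormal_inner[of M E e e]
  by (metis l2_norm_nonneg of_real_eq_1_iff power2_eq_1_iff zero_le_one not_one_le_zero neg_0_le_iff_le)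

lemma orthonormal_basis_orthonormal: "orthonormal_basis M E \<Longrightarrow> orthonormal M E"
  by (auto simp: orthonormal_def orthonormal_basis_def)

lemma l2_inner_orthonormal_sum:
  assumes "orthonormal M E" "finite F" "F \<subseteq> E" "e \<in> E"
  shows "l2_inner M (\<lambda>x. \<Sum>e\<in>F. c e * e x) e = (if e \<in> F then c e else 0)"
proof -
  have "l2_inner M (\<lambda>x. \<Sum>e\<in>F. c e * e x) e = (\<Sum>e'\<in>F. c e' * l2_inner M e' e)"
    using assms by (intro l2_inner_sum_left) (auto simp: orthonormal_def)
  also have "\<dots> = (\<Sum>e'\<in>F. if e' = e then c e' else 0)"
    using assms by (intro sum.cong) (auto simp: orthonormal_inner)
  also have "\<dots> = (if e \<in> F then c e else 0)"
    using assms by (simp add: sum.delta')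
  finally show ?thesis .
qed

lemma L2_orthonormal_sum:
  "orthonormal M E \<Longrightarrow> F \<subseteq> E \<Longrightarrow> (\<lambda>x. \<Sum>e\<in>F. c e * e x) \<in> L2 M"
  by (intro L2_sum L2_scale) (auto simp: orthonormal_def)

lemma l2_norm_orthonormal_sum:
  assumes "orthonormal M E" "finite F" "F \<subseteq> E"
  shows "(l2_norm M (\<lambda>x. \<Sum>e\<in>F. c e * e x))\<^sup>2 = (\<Sum>e\<in>F. (norm (c e))\<^sup>2)"
proof -
  let ?s = "\<lambda>x. \<Sum>e\<in>F. c e * e x"
  have "l2_inner M ?s ?s = (\<Sum>e\<in>F. c e * l2_inner M e ?s)"
    using assms L2_orthonormal_sum[OF assms(1,3)]
    by (intro l2_inner_sum_left) (auto simp: orthonormal_def)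
  also have "\<dots> = (\<Sum>e\<in>F. c e * cnj (c e))"
  proof (rule sum.cong[OF refl])
    fix e assume "e \<in> F"
    then have "l2_inner M e ?s = cnj (c e)"
      using assms l2_inner_orthonormal_sum[OF assms, of e c]
      by (subst l2_inner_cnj) auto
    then show "c e * l2_inner M e ?s = c e * cnj (c e)" by simp
  qed
  also have "\<dots> = of_real (\<Sum>e\<in>F. (norm (c e))\<^sup>2)"
    by (simp only: of_real_sum complex_norm_square)
  finally show ?thesis
    unfolding l2_inner_self by (simp only: of_real_eq_iff)
qed

lemma bessel_identity:
  assumes "orthonormal M E" "finite F" "F \<subseteq> E" "f \<in> L2 M"
  shows "(l2_norm M (\<lambda>x. f x - (\<Sum>e\<in>F. l2_inner M f e * e x)))\<^sup>2
    = (l2_norm M f)\<^sup>2 - (\<Sum>e\<in>F. (norm (l2_inner M f e))\<^sup>2)"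
proof -
  let ?s = "\<lambda>x. \<Sum>e\<in>F. l2_inner M f e * e x"
  have s: "?s \<in> L2 M" using assms by (intro L2_orthonormal_sum)
  have "l2_inner M ?s f = (\<Sum>e\<in>F. l2_inner M f e * l2_inner M e f)"
    using assms by (intro l2_inner_sum_left) (auto simp: orthonormal_def)
  also have "\<dots> = of_real (\<Sum>e\<in>F. (norm (l2_inner M f e))\<^sup>2)"
    unfolding of_real_sum complex_norm_square by (intro sum.cong refl) (subst l2_inner_cnj, simp)
  finally have "Re (l2_inner M ?s f) = (\<Sum>e\<in>F. (norm (l2_inner M f e))\<^sup>2)" by simp
  then have "Re (l2_inner M f ?s) = (\<Sum>e\<in>F. (norm (l2_inner M f e))\<^sup>2)"
    by (subst l2_inner_cnj) simp
  moreover have "l2_inner M f (\<lambda>x. - ?s x) = - l2_inner M f ?s"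
    by (simp add: l2_inner_def)
  ultimately show ?thesis
    using l2_norm_add_sq[OF assms(4) L2_uminus[OF s]] l2_norm_orthonormal_sum[OF assms(1-3)]
    by simp
qed

lemma bessel:
  assumes "orthonormal M E" "finite F" "F \<subseteq> E" "f \<in> L2 M"
  shows "(\<Sum>e\<in>F. (norm (l2_inner M f e))\<^sup>2) \<le> (l2_norm M f)\<^sup>2"
  using bessel_identity[OF assms]
    zero_le_power2[of "l2_norm M (\<lambda>x. f x - (\<Sum>e\<in>F. l2_inner M f e * e x))"]
  by linarith

lemma bessel_summable:
  assumes "orthonormal M E" "f \<in> L2 M"
  shows "(\<lambda>e. (norm (l2_inner M f e))\<^sup>2) summable_on E"
  by (rule nonneg_bdd_above_summable_on)
    (use bessel[OF assms(1) _ _ assms(2)] in \<open>auto intro!: bdd_aboveI2\<close>)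

text \<open>Zorn's lemma: a function that is not null and is orthogonal to a maximal orthonormal
  system could be normalised and added to it. This makes the choice \<open>some_onb\<close>, over
  which \<open>hs_norm\<close> and \<open>op_trace\<close> sum, a genuine basis.\<close>

lemma orthonormal_basis_exists: "\<exists>E. orthonormal_basis M E"
proof -
  have "\<exists>E\<in>{E. orthonormal M E}. \<forall>X\<in>{E. orthonormal M E}. E \<subseteq> X \<longrightarrow> X = E"
  proof (rule subset_Zorn')
    fix C assume C: "subset.chain {E. orthonormal M E} C"
    have C_on: "orthonormal M X" if "X \<in> C" for X
      using C that by (auto simp: subset_chain_def)
    have "\<Union>C \<subseteq> L2 M" using C_on by (auto simp: orthonormal_def)
    moreover have "l2_inner M e e' = (if e = e' then 1 else 0)"
      if "e \<in> \<Union>C" and "e' \<in> \<Union>C" for e e'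
    proof -
      obtain X Y where XY: "X \<in> C" "e \<in> X" "Y \<in> C" "e' \<in> Y"
        using \<open>e \<in> \<Union>C\<close> \<open>e' \<in> \<Union>C\<close> by blast
      then have "X \<subseteq> Y \<or> Y \<subseteq> X" using C by (auto simp: subset_chain_def)
      then obtain Z where "Z \<in> C" "e \<in> Z" "e' \<in> Z" using XY by auto
      then show ?thesis by (intro orthonormal_inner[OF C_on])
    qed
    ultimately show "\<Union>C \<in> {E. orthonormal M E}"
      by (simp add: orthonormal_def)
  qed
  then obtain E where E: "orthonormal M E" and max: "\<And>X. orthonormal M X \<Longrightarrow> E \<subseteq> X \<Longrightarrow> X = E"
    by auto
  have "AE x in M. f x = 0" if f: "f \<in> L2 M" "\<And>e. e \<in> E \<Longrightarrow> l2_inner M f e = 0" for f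
  proof (rule ccontr)
    assume "\<not> (AE x in M. f x = 0)"
    then have pos: "l2_norm M f \<noteq> 0" using f l2_norm_eq_0_iff by blast
    define g where "g x = of_real (1 / l2_norm M f) * f x" for x
    have g: "g \<in> L2 M" unfolding g_def by (rule L2_scale[OF f(1)])
    have ge: "l2_inner M g e = 0" if "e \<in> E" for e
      unfolding g_def l2_inner_scale_left f(2)[OF that] by simp
    have eg: "l2_inner M e g = 0" if "e \<in> E" for e
      using ge[OF that] by (subst l2_inner_cnj) simp
    have "l2_norm M g = 1"
      using pos unfolding g_def l2_norm_scale by (simp add: norm_divide)
    then have gg: "l2_inner M g g = 1" by (simp add: l2_inner_self)
    have "orthonormal M (insert g E)"
      using E g ge eg gg by (auto simp: orthonormal_def)
    from max[OF this] have "g \<in> E" by auto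
    with ge gg show False by (metis zero_neq_one)
  qed
  then show ?thesis
    using E unfolding orthonormal_basis_def orthonormal_def by (intro exI[of _ E]) simp
qed

lemma some_onb: "orthonormal_basis M (some_onb M)"
  unfolding some_onb_def using orthonormal_basis_exists by (rule someI_ex)

lemma some_onb_orthonormal: "orthonormal M (some_onb M)"
  by (intro orthonormal_basis_orthonormal some_onb)

lemma some_onb_L2: "e \<in> some_onb M \<Longrightarrow> e \<in> L2 M"
  using some_onb_orthonormal orthonormal_L2 by blast

text \<open>\<open>has_sum\<close> is a limit along the net of finite subsets. Completeness of
  \<open>L2\<close> and measurability of limits are statements about sequences, and F is the
  sequence that replaces the net.\<close>

lemma countable_exhaustion:
  assumes "countable E"
  obtains F :: "nat \<Rightarrow> 'a set" where "\<And>n. finite (F n)" "\<And>n. F n \<subseteq> E" "incseq F"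
    "filterlim F (finite_subsets_at_top E) sequentially"
proof
  define F where "F n = {e\<in>E. to_nat_on E e < n}" for n
  have inj: "inj_on (to_nat_on E) E" using assms by (rule inj_on_to_nat_on)
  show "finite (F n)" for n
    by (rule finite_imageD[OF finite_subset[of _ "{..<n}"]])
      (auto simp: F_def intro: inj_on_subset[OF inj])
  show "F n \<subseteq> E" for n by (auto simp: F_def)
  show "incseq F" by (auto simp: F_def incseq_def)
  show "filterlim F (finite_subsets_at_top E) sequentially"
    unfolding filterlim_finite_subsets_at_top
  proof (intro allI impI)
    fix X assume X: "finite X \<and> X \<subseteq> E"
    show "\<forall>\<^sub>F n in sequentially. finite (F n) \<and> X \<subseteq> F n \<and> F n \<subseteq> E"
      using eventually_gt_at_top[of "Max (insert 0 (to_nat_on E ` X))"]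
    proof eventually_elim
      case (elim n)
      have "to_nat_on E e < n" if "e \<in> X" for e
        using elim X that by (auto intro: le_less_trans[OF Max_ge])
      then show ?case
        using X \<open>\<And>n. finite (F n)\<close> by (auto simp: F_def)
    qed
  qed
qed

text \<open>The squared distances of partial sums of an orthogonal series are differences of the partial
  sums of a convergent scalar series.\<close>

lemma L2_complete_partial_sums:
  fixes S :: "nat \<Rightarrow> real"
  assumes "\<And>n. f n \<in> L2 M" "convergent S"
    and "\<And>m n. n \<le> m \<Longrightarrow> (l2_norm M (\<lambda>x. f m x - f n x))\<^sup>2 \<le> S m - S n"
  obtains g where "g \<in> L2 M" "(\<lambda>n. l2_norm M (\<lambda>x. f n x - g x)) \<longlonglongrightarrow> 0"
proof (rule L2_complete)
  show "f n \<in> L2 M" for n by fact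
next
  have le: "(l2_norm M (\<lambda>x. f m x - f n x))\<^sup>2 \<le> \<bar>S m - S n\<bar>" for m n
  proof (cases "n \<le> m")
    case True
    then show ?thesis using assms(3)[of n m] by linarith
  next
    case False
    then show ?thesis using assms(3)[of m n] by (subst l2_norm_minus_commute) linarith
  qed
  fix e :: real assume e: "0 < e"
  have "Cauchy S" using assms(2) by (simp add: Cauchy_convergent_iff)
  then obtain N where N: "\<And>m n. m \<ge> N \<Longrightarrow> n \<ge> N \<Longrightarrow> \<bar>S m - S n\<bar> < e\<^sup>2"
    using e unfolding Cauchy_def dist_real_def by (metis zero_less_power)
  show "\<exists>N. \<forall>m\<ge>N. \<forall>n\<ge>N. l2_norm M (\<lambda>x. f m x - f n x) < e"
  proof (intro exI[of _ N] allI impI)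
    fix m n assume "m \<ge> N" "n \<ge> N"
    then have "(l2_norm M (\<lambda>x. f m x - f n x))\<^sup>2 < e\<^sup>2" using N le le_less_trans by blast
    then show "l2_norm M (\<lambda>x. f m x - f n x) < e"
      by (rule power2_less_imp_less) (use e in simp)
  qed
qed

lemma sum_diff_subset:
  fixes f :: "'a \<Rightarrow> 'b :: ab_group_add"
  shows "finite B \<Longrightarrow> A \<subseteq> B \<Longrightarrow> sum f B - sum f A = sum f (B - A)"
  by (simp add: sum_diff finite_subset)

context
  fixes M :: "'a measure" and E
  assumes onb: "orthonormal_basis M E" and countable: "countable E"
begin

text \<open>By completeness of the space the partial sums have a limit h. The difference of f and h
  is orthogonal to every basis vector, hence null, and Bessel's identity then evaluates the sum of
  the squared coefficients.\<close>

lemma parseval: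
  assumes f: "f \<in> L2 M"
  shows "((\<lambda>e. (norm (l2_inner M f e))\<^sup>2) has_sum (l2_norm M f)\<^sup>2) E"
proof -
  have on: "orthonormal M E" using onb by (rule orthonormal_basis_orthonormal)
  obtain F where F: "\<And>n. finite (F n)" "\<And>n. F n \<subseteq> E" "incseq F"
      "filterlim F (finite_subsets_at_top E) sequentially"
    using countable by (rule countable_exhaustion) blast
  define c where "c e = l2_inner M f e" for e
  define S where "S n = (\<Sum>e\<in>F n. (norm (c e))\<^sup>2)" for n
  define s where "s = (\<Sum>\<^sub>\<infinity>e\<in>E. (norm (c e))\<^sup>2)"
  have has_sum: "((\<lambda>e. (norm (c e))\<^sup>2) has_sum s) E"
    unfolding s_def c_def using bessel_summable[OF on f] by (rule has_sum_infsum)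
  then have S: "S \<longlonglongrightarrow> s"
    unfolding S_def has_sum_def by (rule filterlim_compose) (rule F)
  define g where "g n x = (\<Sum>e\<in>F n. c e * e x)" for n x
  have g: "g n \<in> L2 M" for n
    unfolding g_def using on F by (intro L2_orthonormal_sum)
  obtain h where h: "h \<in> L2 M" "(\<lambda>n. l2_norm M (\<lambda>x. g n x - h x)) \<longlonglongrightarrow> 0"
  proof (rule L2_complete_partial_sums[of g M S])
    show "convergent S" using S by (auto simp: convergent_def)
    fix m n :: nat assume "n \<le> m"
    then have sub: "F n \<subseteq> F m" using F(3) by (auto simp: incseq_def)
    have "(\<lambda>x. g m x - g n x) = (\<lambda>x. \<Sum>e\<in>F m - F n. c e * e x)"
      unfolding g_def using F(1) sub by (intro ext sum_diff_subset)
    then have "(l2_norm M (\<lambda>x. g m x - g n x))\<^sup>2 = (\<Sum>e\<in>F m - F n. (norm (c e))\<^sup>2)"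
      using l2_norm_orthonormal_sum[OF on, of "F m - F n" c] F by auto
    then show "(l2_norm M (\<lambda>x. g m x - g n x))\<^sup>2 \<le> S m - S n"
      unfolding S_def using F(1) sub by (simp add: sum_diff_subset)
  qed (use g in auto)
  have "AE x in M. f x - h x = 0"
  proof -
    have "l2_inner M (\<lambda>x. f x - h x) e = 0" if e: "e \<in> E" for e
    proof -
      have "(\<lambda>n. l2_inner M (g n) e) \<longlonglongrightarrow> l2_inner M h e"
        using g h e on by (intro l2_inner_tendsto) (auto simp: orthonormal_def)
      moreover have "\<forall>\<^sub>F n in sequentially. l2_inner M (g n) e = c e"
      proof -
        have "\<forall>\<^sub>F n in sequentially. {e} \<subseteq> F n"
          using F(4) e unfolding filterlim_finite_subsets_at_top
          by (auto elim!: allE[of _ "{e}"] elim: eventually_mono)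
        then show ?thesis
          unfolding g_def by eventually_elim (use l2_inner_orthonormal_sum[OF on F(1,2) e] in auto)
      qed
      ultimately have "l2_inner M h e = c e"
        by (intro LIMSEQ_unique[OF _ tendsto_eventually])
      then show ?thesis
        using f h e on by (simp add: l2_inner_diff_left orthonormal_L2 c_def)
    qed
    moreover have "(\<lambda>x. f x - h x) \<in> L2 M" using f h by auto
    ultimately show ?thesis using onb by (auto simp: orthonormal_basis_def)
  qed
  then have fh: "AE x in M. f x = h x" by simp
  have "(l2_norm M (\<lambda>x. g n x - h x))\<^sup>2 = (l2_norm M f)\<^sup>2 - S n" for n
  proof -
    have "l2_norm M (\<lambda>x. g n x - h x) = l2_norm M (\<lambda>x. f x - g n x)"
      by (subst l2_norm_minus_commute, rule l2_norm_cong_AE)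
        (use fh f h g in \<open>auto simp: L2_measurable\<close>)
    then show ?thesis
      using bessel_identity[OF on F(1,2) f] by (simp add: g_def S_def c_def)
  qed
  then have "S = (\<lambda>n. (l2_norm M f)\<^sup>2 - (l2_norm M (\<lambda>x. g n x - h x))\<^sup>2)" by (simp add: fun_eq_iff)
  moreover have "(\<lambda>n. (l2_norm M f)\<^sup>2 - (l2_norm M (\<lambda>x. g n x - h x))\<^sup>2) \<longlonglongrightarrow> (l2_norm M f)\<^sup>2 - 0\<^sup>2"
    by (intro tendsto_intros h)
  ultimately have "s = (l2_norm M f)\<^sup>2" using S LIMSEQ_unique by fastforce
  then show ?thesis using has_sum by (simp add: c_def)
qed

lemma fourier_series_tendsto:
  assumes f: "f \<in> L2 M"
  shows "((\<lambda>F. l2_norm M (\<lambda>x. f x - (\<Sum>e\<in>F. l2_inner M f e * e x))) \<longlongrightarrow> 0)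
    (finite_subsets_at_top E)"
proof -
  have on: "orthonormal M E" using onb by (rule orthonormal_basis_orthonormal)
  have "((\<lambda>F. sqrt ((l2_norm M f)\<^sup>2 - (\<Sum>e\<in>F. (norm (l2_inner M f e))\<^sup>2))) \<longlongrightarrow>
      sqrt ((l2_norm M f)\<^sup>2 - (l2_norm M f)\<^sup>2)) (finite_subsets_at_top E)"
    using parseval[OF f] unfolding has_sum_def by (intro tendsto_intros)
  moreover have "\<forall>\<^sub>F F in finite_subsets_at_top E.
      sqrt ((l2_norm M f)\<^sup>2 - (\<Sum>e\<in>F. (norm (l2_inner M f e))\<^sup>2)) =
      l2_norm M (\<lambda>x. f x - (\<Sum>e\<in>F. l2_inner M f e * e x))"
    by (rule eventually_finite_subsets_at_top_weakI)
      (simp add: bessel_identity[OF on _ _ f, symmetric])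
  ultimately show ?thesis by (simp add: tendsto_cong)
qed

end

section \<open>Bounded operators and their expansion in an orthonormal basis\<close>

lemma bounded_operator_L2: "bounded_operator M A \<Longrightarrow> f \<in> L2 M \<Longrightarrow> A f \<in> L2 M"
  by (auto simp: bounded_operator_def)

lemma bounded_operator_add:
  "bounded_operator M A \<Longrightarrow> f \<in> L2 M \<Longrightarrow> g \<in> L2 M \<Longrightarrow>
    AE x in M. A (\<lambda>y. f y + g y) x = A f x + A g x"
  by (auto simp: bounded_operator_def)

lemma bounded_operator_scale:
  "bounded_operator M A \<Longrightarrow> f \<in> L2 M \<Longrightarrow> AE x in M. A (\<lambda>y. c * f y) x = c * A f x"
  by (auto simp: bounded_operator_def)

lemma bounded_operator_bound:
  assumes "bounded_operator M A"
  obtains c where "0 \<le> c" "\<And>f. f \<in> L2 M \<Longrightarrow> l2_norm M (A f) \<le> c * l2_norm M f"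
proof -
  obtain c where c: "\<And>f. f \<in> L2 M \<Longrightarrow> l2_norm M (A f) \<le> c * l2_norm M f"
    using assms unfolding bounded_operator_def by metis
  show ?thesis
  proof (rule that[of "\<bar>c\<bar>"])
    show "l2_norm M (A f) \<le> \<bar>c\<bar> * l2_norm M f" if "f \<in> L2 M" for f
      using c[OF that] by (rule order_trans) (intro mult_right_mono, auto)
  qed simp
qed

lemma bounded_operator_diff:
  assumes "bounded_operator M A" "f \<in> L2 M" "g \<in> L2 M"
  shows "AE x in M. A (\<lambda>y. f y - g y) x = A f x - A g x"
  using bounded_operator_add[OF assms(1) L2_diff[OF assms(2,3)] assms(3)] by auto

lemma bounded_operator_diff_norm:
  assumes "bounded_operator M A" "f \<in> L2 M" "g \<in> L2 M"
  shows "l2_norm M (\<lambda>x. A f x - A g x) = l2_norm M (A (\<lambda>y. f y - g y))"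
  using bounded_operator_diff[OF assms] assms
  by (intro l2_norm_cong_AE L2_measurable L2_diff bounded_operator_L2[OF assms(1)]) auto

lemma bounded_operator_cong_AE:
  assumes "bounded_operator M A" "f \<in> L2 M" "g \<in> L2 M" "AE x in M. f x = g x"
  shows "AE x in M. A f x = A g x"
proof (rule l2_norm_diff_eq_0)
  obtain c where c: "\<And>f. f \<in> L2 M \<Longrightarrow> l2_norm M (A f) \<le> c * l2_norm M f"
    using bounded_operator_bound[OF assms(1)] by blast
  have "l2_norm M (\<lambda>y. f y - g y) = 0"
    using assms by (subst l2_norm_eq_0_iff) auto
  then show "l2_norm M (\<lambda>x. A f x - A g x) = 0"
    using c[of "\<lambda>y. f y - g y"] assms
    by (simp add: bounded_operator_diff_norm order_antisym L2_diff)
qed (use assms in \<open>auto intro: bounded_operator_L2\<close>)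

lemma bounded_operator_sum:
  assumes "bounded_operator M A" "finite F" "\<And>e. e \<in> F \<Longrightarrow> e \<in> L2 M"
  shows "AE x in M. A (\<lambda>y. \<Sum>e\<in>F. c e * e y) x = (\<Sum>e\<in>F. c e * A e x)"
  using assms(2,3)
proof (induction F)
  case empty
  then show ?case
    using bounded_operator_scale[OF assms(1) L2_zero, of 0] by simp
next
  case (insert e F)
  have s: "(\<lambda>x. \<Sum>e\<in>F. c e * e x) \<in> L2 M"
    using insert by (intro L2_sum L2_scale) blast
  have e: "e \<in> L2 M" using insert by auto
  have "AE x in M. A (\<lambda>y. \<Sum>e\<in>F. c e * e y) x = (\<Sum>e\<in>F. c e * A e x)"
    using insert by auto
  then show ?case
    using bounded_operator_add[OF assms(1) L2_scale[OF e] s, of "c e"]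
      bounded_operator_scale[OF assms(1) e, of "c e"]
    by eventually_elim (simp add: insert.hyps)
qed

lemma bounded_operator_lincomb:
  assumes A: "bounded_operator M A" and B: "bounded_operator M B"
  shows "bounded_operator M (\<lambda>f x. c * A f x + d * B f x)"
proof -
  obtain a where a: "0 \<le> a" "\<And>f. f \<in> L2 M \<Longrightarrow> l2_norm M (A f) \<le> a * l2_norm M f"
    using bounded_operator_bound[OF A] by blast
  obtain b where b: "0 \<le> b" "\<And>f. f \<in> L2 M \<Longrightarrow> l2_norm M (B f) \<le> b * l2_norm M f"
    using bounded_operator_bound[OF B] by blast
  show ?thesis unfolding bounded_operator_def
  proof (intro conjI ballI allI exI[of _ "norm c * a + norm d * b"])
    fix f assume f: "f \<in> L2 M"
    have AB: "(\<lambda>x. c * A f x) \<in> L2 M" "(\<lambda>x. d * B f x) \<in> L2 M"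
      using A B f by (auto intro: bounded_operator_L2)
    show "(\<lambda>x. c * A f x + d * B f x) \<in> L2 M" using AB by (rule L2_add)
    have "l2_norm M (\<lambda>x. c * A f x + d * B f x) \<le> norm c * l2_norm M (A f) + norm d * l2_norm M (B f)"
      using l2_norm_triangle[OF AB] by (simp add: l2_norm_scale)
    also have "\<dots> \<le> norm c * (a * l2_norm M f) + norm d * (b * l2_norm M f)"
      by (intro add_mono mult_left_mono a b f) auto
    finally show "l2_norm M (\<lambda>x. c * A f x + d * B f x) \<le> (norm c * a + norm d * b) * l2_norm M f"
      by (simp add: algebra_simps)
    fix k show "AE x in M. c * A (\<lambda>y. k * f y) x + d * B (\<lambda>y. k * f y) x = k * (c * A f x + d * B f x)"
      using bounded_operator_scale[OF A f, of k] bounded_operator_scale[OF B f, of k]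
      by eventually_elim (simp add: algebra_simps)
  next
    fix f g assume fg: "f \<in> L2 M" "g \<in> L2 M"
    show "AE x in M. c * A (\<lambda>y. f y + g y) x + d * B (\<lambda>y. f y + g y) x =
        c * A f x + d * B f x + (c * A g x + d * B g x)"
      using bounded_operator_add[OF A fg] bounded_operator_add[OF B fg]
      by eventually_elim (simp add: algebra_simps)
  qed
qed

lemma bounded_operator_minus:
  "bounded_operator M A \<Longrightarrow> bounded_operator M B \<Longrightarrow> bounded_operator M (\<lambda>f x. A f x - B f x)"
  using bounded_operator_lincomb[of M A B 1 "-1"] by simp

context
  fixes M :: "'a measure" and E
  assumes onb: "orthonormal_basis M E" and countable: "countable E"
begin

lemma bounded_operator_series:
  assumes A: "bounded_operator M A" and f: "f \<in> L2 M"
  shows "((\<lambda>F. l2_norm M (\<lambda>x. (\<Sum>e\<in>F. l2_inner M f e * A e x) - A f x)) \<longlongrightarrow> 0)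
    (finite_subsets_at_top E)"
proof -
  have on: "orthonormal M E" using onb by (rule orthonormal_basis_orthonormal)
  obtain c where c: "0 \<le> c" "\<And>f. f \<in> L2 M \<Longrightarrow> l2_norm M (A f) \<le> c * l2_norm M f"
    using bounded_operator_bound[OF A] by blast
  show ?thesis
  proof (rule tendsto_0_le[OF fourier_series_tendsto[OF onb countable f], where K=c],
      rule eventually_finite_subsets_at_top_weakI)
    fix F assume F: "finite F" "F \<subseteq> E"
    let ?s = "\<lambda>x. \<Sum>e\<in>F. l2_inner M f e * e x"
    have s: "?s \<in> L2 M" using on F by (intro L2_orthonormal_sum)
    have "AE x in M. A ?s x = (\<Sum>e\<in>F. l2_inner M f e * A e x)"
      using F on by (intro bounded_operator_sum[OF A]) (auto simp: orthonormal_def)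
    then have "l2_norm M (\<lambda>x. (\<Sum>e\<in>F. l2_inner M f e * A e x) - A f x) = l2_norm M (\<lambda>x. A ?s x - A f x)"
    proof (intro l2_norm_cong_AE)
      have "(\<lambda>x. \<Sum>e\<in>F. l2_inner M f e * A e x) \<in> L2 M"
        using F on A by (intro L2_sum L2_scale bounded_operator_L2[OF A]) (auto simp: orthonormal_def)
      then show "(\<lambda>x. (\<Sum>e\<in>F. l2_inner M f e * A e x) - A f x) \<in> borel_measurable M"
        using bounded_operator_L2[OF A f] by (auto simp: L2_measurable)
      show "(\<lambda>x. A ?s x - A f x) \<in> borel_measurable M"
        using bounded_operator_L2[OF A f] bounded_operator_L2[OF A s] by (auto simp: L2_measurable)
    qed auto
    also have "\<dots> = l2_norm M (A (\<lambda>y. ?s y - f y))"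
      using A s f by (intro bounded_operator_diff_norm)
    also have "\<dots> \<le> c * l2_norm M (\<lambda>y. ?s y - f y)"
      using s f by (intro c L2_diff)
    finally show "norm (l2_norm M (\<lambda>x. (\<Sum>e\<in>F. l2_inner M f e * A e x) - A f x))
        \<le> norm (l2_norm M (\<lambda>x. f x - ?s x)) * c"
      by (subst l2_norm_minus_commute[of M f]) (simp add: mult.commute)
  qed
qed

text \<open>The expansion separates the vector f from the operator A. In the trace both depend on
  the group element, and measurability of the product is obtained factor by factor from this
  series.\<close>

lemma bounded_operator_inner_series:
  assumes A: "bounded_operator M A" and f: "f \<in> L2 M" and g: "g \<in> L2 M"
  shows "((\<lambda>e. l2_inner M f e * l2_inner M (A e) g) has_sum l2_inner M (A f) g) E"
proof -
  have L2: "E \<subseteq> L2 M" using onb by (auto simp: orthonormal_basis_def)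
  \<comment> \<open>\<open>l2_inner_tendsto\<close> asks for square integrability at every index,
    also at sets F that the filter never meets; the intersection with E ensures it.\<close>
  define S where "S F = (\<lambda>x. \<Sum>e\<in>F \<inter> E. l2_inner M f e * A e x)" for F
  have ev: "\<forall>\<^sub>F F in finite_subsets_at_top E. F \<inter> E = F"
    by (rule eventually_finite_subsets_at_top_weakI) auto
  have "((\<lambda>F. l2_inner M (S F) g) \<longlongrightarrow> l2_inner M (A f) g) (finite_subsets_at_top E)"
  proof (rule l2_inner_tendsto)
    show "S F \<in> L2 M" for F
      unfolding S_def using L2 by (intro L2_sum L2_scale bounded_operator_L2[OF A]) auto
    show "((\<lambda>F. l2_norm M (\<lambda>x. S F x - A f x)) \<longlongrightarrow> 0) (finite_subsets_at_top E)"
      using bounded_operator_series[OF A f] ev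
      by (rule Lim_transform_eventually[OF _ eventually_mono]) (simp add: S_def)
  qed (use A f g in \<open>auto intro: bounded_operator_L2\<close>)
  moreover have "\<forall>\<^sub>F F in finite_subsets_at_top E.
      l2_inner M (S F) g = (\<Sum>e\<in>F. l2_inner M f e * l2_inner M (A e) g)"
    using ev
  proof eventually_elim
    case (elim F)
    then show ?case
      unfolding S_def using L2 g
      by (simp, intro l2_inner_sum_left) (auto intro!: bounded_operator_L2[OF A])
  qed
  ultimately show ?thesis
    unfolding has_sum_def by (rule Lim_transform_eventually)
qed

text \<open>Cauchy-Schwarz on finite partial sums, with Bessel controlling the coefficients of f,
  followed by a passage to the limit. Through this estimate the convergence in
  \<open>hs_norm\<close> that defines the extended Fourier transform becomes convergence at each
  vector.\<close>

lemma l2_norm_operator_le: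
  assumes A: "bounded_operator M A" and sum: "(\<lambda>e. (l2_norm M (A e))\<^sup>2) summable_on E"
    and f: "f \<in> L2 M"
  shows "l2_norm M (A f) \<le> sqrt (\<Sum>\<^sub>\<infinity>e\<in>E. (l2_norm M (A e))\<^sup>2) * l2_norm M f"
proof -
  have on: "orthonormal M E" using onb by (rule orthonormal_basis_orthonormal)
  let ?s = "\<Sum>\<^sub>\<infinity>e\<in>E. (l2_norm M (A e))\<^sup>2"
  let ?C = "sqrt ?s * l2_norm M f"
  have "((\<lambda>F. l2_norm M (\<lambda>x. (\<Sum>e\<in>F. l2_inner M f e * A e x) - A f x) + ?C) \<longlongrightarrow> 0 + ?C)
      (finite_subsets_at_top E)"
    by (intro tendsto_intros bounded_operator_series A f)
  moreover have "\<forall>\<^sub>F F in finite_subsets_at_top E. l2_norm M (A f) \<le>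
      l2_norm M (\<lambda>x. (\<Sum>e\<in>F. l2_inner M f e * A e x) - A f x) + ?C"
  proof (rule eventually_finite_subsets_at_top_weakI)
    fix F assume F: "finite F" "F \<subseteq> E"
    let ?g = "\<lambda>x. \<Sum>e\<in>F. l2_inner M f e * A e x"
    have L2: "e \<in> F \<Longrightarrow> e \<in> L2 M" for e using F on by (auto simp: orthonormal_def)
    have g: "?g \<in> L2 M" by (intro L2_sum L2_scale bounded_operator_L2[OF A] L2)
    have "l2_norm M ?g \<le> (\<Sum>e\<in>F. l2_norm M (\<lambda>x. l2_inner M f e * A e x))"
      by (intro l2_norm_sum_le L2_scale bounded_operator_L2[OF A] L2)
    also have "\<dots> = (\<Sum>e\<in>F. norm (l2_inner M f e) * l2_norm M (A e))"
      by (simp add: l2_norm_scale)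
    also have "\<dots> \<le> sqrt ((\<Sum>e\<in>F. (norm (l2_inner M f e))\<^sup>2) * (\<Sum>e\<in>F. (l2_norm M (A e))\<^sup>2))"
      by (intro real_le_rsqrt Cauchy_Schwarz_ineq_sum)
    also have "\<dots> \<le> sqrt ((l2_norm M f)\<^sup>2 * ?s)"
      using F by (intro real_sqrt_le_mono mult_mono bessel[OF on] f finite_sum_le_infsum sum sum_nonneg)
        auto
    also have "\<dots> = ?C" by (simp add: real_sqrt_mult mult.commute)
    finally have "l2_norm M ?g \<le> ?C" .
    moreover have "l2_norm M (A f) \<le> l2_norm M (\<lambda>x. ?g x - A f x) + l2_norm M ?g"
      using l2_norm_triangle_minus[of "A f" M ?g] g bounded_operator_L2[OF A f]
      by (simp add: l2_norm_minus_commute)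
    ultimately show "l2_norm M (A f) \<le> l2_norm M (\<lambda>x. ?g x - A f x) + ?C" by simp
  qed
  ultimately show ?thesis
    by (intro tendsto_lowerbound[where F="finite_subsets_at_top E"]) auto
qed

end

section \<open>Integral operators and Hilbert--Schmidt kernels\<close>

definition int_op :: "'a measure \<Rightarrow> ('a \<times> 'a \<Rightarrow> complex) \<Rightarrow> 'a operator" where
  "int_op M K \<phi> = (\<lambda>x. LINT y|M. K (x, y) * \<phi> y)"

lemma int_op_inner: "int_op M K \<phi> x = l2_inner M \<phi> (\<lambda>y. cnj (K (x, y)))"
  by (simp add: int_op_def l2_inner_def mult.commute)

context sigma_finite_measure
begin

lemma int_op_measurable [measurable (raw)]:
  assumes "K \<in> borel_measurable (M \<Otimes>\<^sub>M M)" "\<phi> \<in> borel_measurable M"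
  shows "int_op M K \<phi> \<in> borel_measurable M"
  unfolding int_op_def
  by (rule borel_measurable_lebesgue_integral) (use assms in measurable)

lemma
  assumes K: "K \<in> L2 (M \<Otimes>\<^sub>M M)"
  shows L2_section: "AE x in M. (\<lambda>y. K (x, y)) \<in> L2 M"
    and nn_integral_section_norm:
      "(\<integral>\<^sup>+x. ennreal ((l2_norm M (\<lambda>y. K (x, y)))\<^sup>2) \<partial>M) = ennreal ((l2_norm (M \<Otimes>\<^sub>M M) K)\<^sup>2)"
proof -
  have [measurable]: "K \<in> borel_measurable (M \<Otimes>\<^sub>M M)" using K by (rule L2_measurable)
  have eq: "(\<integral>\<^sup>+x. \<integral>\<^sup>+y. ennreal ((norm (K (x, y)))\<^sup>2) \<partial>M \<partial>M) = ennreal ((l2_norm (M \<Otimes>\<^sub>M M) K)\<^sup>2)"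
    using nn_integral_fst[of "\<lambda>p. ennreal ((norm (K p))\<^sup>2)" M] nn_integral_L2[OF K] by simp
  have "AE x in M. (\<integral>\<^sup>+y. ennreal ((norm (K (x, y)))\<^sup>2) \<partial>M) \<noteq> \<infinity>"
    by (rule nn_integral_PInf_AE) (use eq in auto)
  then show sec: "AE x in M. (\<lambda>y. K (x, y)) \<in> L2 M"
  proof (rule AE_mp, intro AE_I2 impI)
    fix x assume x: "x \<in> space M" "(\<integral>\<^sup>+y. ennreal ((norm (K (x, y)))\<^sup>2) \<partial>M) \<noteq> \<infinity>"
    show "(\<lambda>y. K (x, y)) \<in> L2 M"
      by (intro L2_I integrableI_nonneg) (use x in \<open>auto simp: top.not_eq_extremum\<close>)
  qed
  have "(\<integral>\<^sup>+x. ennreal ((l2_norm M (\<lambda>y. K (x, y)))\<^sup>2) \<partial>M) =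
      (\<integral>\<^sup>+x. \<integral>\<^sup>+y. ennreal ((norm (K (x, y)))\<^sup>2) \<partial>M \<partial>M)"
    by (rule nn_integral_cong_AE, rule AE_mp[OF sec]) (auto simp: nn_integral_L2)
  then show "(\<integral>\<^sup>+x. ennreal ((l2_norm M (\<lambda>y. K (x, y)))\<^sup>2) \<partial>M) = ennreal ((l2_norm (M \<Otimes>\<^sub>M M) K)\<^sup>2)"
    using eq by simp
qed

lemma
  assumes K: "K \<in> L2 (M \<Otimes>\<^sub>M M)" and \<phi>: "\<phi> \<in> L2 M"
  shows int_op_L2: "int_op M K \<phi> \<in> L2 M"
    and int_op_norm_le: "l2_norm M (int_op M K \<phi>) \<le> l2_norm (M \<Otimes>\<^sub>M M) K * l2_norm M \<phi>"
proof -
  have meas [measurable]: "K \<in> borel_measurable (M \<Otimes>\<^sub>M M)" "\<phi> \<in> borel_measurable M"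
    using K \<phi> by (auto intro: L2_measurable)
  have "(\<integral>\<^sup>+x. ennreal ((norm (int_op M K \<phi> x))\<^sup>2) \<partial>M) \<le>
      (\<integral>\<^sup>+x. ennreal ((l2_norm M \<phi>)\<^sup>2) * ennreal ((l2_norm M (\<lambda>y. K (x, y)))\<^sup>2) \<partial>M)"
  proof (rule nn_integral_mono_AE, rule AE_mp[OF L2_section[OF K]], intro AE_I2 impI)
    fix x assume x: "(\<lambda>y. K (x, y)) \<in> L2 M"
    have "norm (int_op M K \<phi> x) \<le> l2_norm M \<phi> * l2_norm M (\<lambda>y. cnj (K (x, y)))"
      unfolding int_op_inner by (intro cauchy_schwarz \<phi> L2_cnj x)
    also have "l2_norm M (\<lambda>y. cnj (K (x, y))) = l2_norm M (\<lambda>y. K (x, y))"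
      by (simp add: l2_norm_def)
    finally show "ennreal ((norm (int_op M K \<phi> x))\<^sup>2) \<le>
        ennreal ((l2_norm M \<phi>)\<^sup>2) * ennreal ((l2_norm M (\<lambda>y. K (x, y)))\<^sup>2)"
      unfolding ennreal_mult'[symmetric, OF zero_le_power2] power_mult_distrib[symmetric]
      by (intro ennreal_leI power_mono) auto
  qed
  also have "\<dots> = ennreal ((l2_norm M \<phi>)\<^sup>2) * ennreal ((l2_norm (M \<Otimes>\<^sub>M M) K)\<^sup>2)"
  proof (subst nn_integral_cmult)
    show "(\<lambda>x. ennreal ((l2_norm M (\<lambda>y. K (x, y)))\<^sup>2)) \<in> borel_measurable M"
      unfolding l2_norm_sq by measurable
  qed (simp add: nn_integral_section_norm[OF K])
  also have "\<dots> = ennreal ((l2_norm (M \<Otimes>\<^sub>M M) K * l2_norm M \<phi>)\<^sup>2)"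
    by (simp add: ennreal_mult' power_mult_distrib mult.commute)
  finally have *: "(\<integral>\<^sup>+x. ennreal ((norm (int_op M K \<phi> x))\<^sup>2) \<partial>M) \<le>
      ennreal ((l2_norm (M \<Otimes>\<^sub>M M) K * l2_norm M \<phi>)\<^sup>2)" .
  show "int_op M K \<phi> \<in> L2 M" "l2_norm M (int_op M K \<phi>) \<le> l2_norm (M \<Otimes>\<^sub>M M) K * l2_norm M \<phi>"
    using L2_bounded[OF _ *] by auto
qed

lemma int_op_diff:
  assumes "K \<in> L2 (M \<Otimes>\<^sub>M M)" "L \<in> L2 (M \<Otimes>\<^sub>M M)" "\<phi> \<in> L2 M"
  shows "AE x in M. int_op M (\<lambda>p. K p - L p) \<phi> x = int_op M K \<phi> x - int_op M L \<phi> x"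
  using L2_section[OF assms(1)] L2_section[OF assms(2)]
proof eventually_elim
  case (elim x)
  then show ?case
    unfolding int_op_def using integrable_L2_mult[OF elim(1) assms(3)] integrable_L2_mult[OF elim(2) assms(3)]
    by (simp add: left_diff_distrib)
qed

lemma bounded_operator_int_op:
  assumes K: "K \<in> L2 (M \<Otimes>\<^sub>M M)"
  shows "bounded_operator M (int_op M K)"
  unfolding bounded_operator_def
proof (intro conjI ballI allI exI[of _ "l2_norm (M \<Otimes>\<^sub>M M) K"])
  fix f g assume f: "f \<in> L2 M" and g: "g \<in> L2 M"
  show "AE x in M. int_op M K (\<lambda>y. f y + g y) x = int_op M K f x + int_op M K g x"
    using L2_section[OF K]
  proof eventually_elim
    case (elim x)
    show ?case
      unfolding int_op_def using integrable_L2_mult[OF elim f] integrable_L2_mult[OF elim g]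
      by (simp add: distrib_left)
  qed
next
  show "AE x in M. int_op M K (\<lambda>y. c * f y) x = c * int_op M K f x" for c f
    by (simp add: int_op_def mult.left_commute)
qed (use K in \<open>auto intro: int_op_L2 int_op_norm_le\<close>)

text \<open>The operator \<open>U\<close> enters only through its adjoint \<open>W\<close>, so that Bessel's inequality can be
  applied to the rows of the kernel.\<close>

lemma sum_int_op_le:
  assumes on: "orthonormal M E" and F: "finite F" "F \<subseteq> E" and K: "K \<in> L2 (M \<Otimes>\<^sub>M M)"
    and U: "\<And>e. e \<in> E \<Longrightarrow> U e \<in> L2 M"
    and W: "\<And>g. g \<in> L2 M \<Longrightarrow> W g \<in> L2 M" "\<And>g. g \<in> L2 M \<Longrightarrow> l2_norm M (W g) \<le> l2_norm M g"
    and UW: "\<And>e g. e \<in> E \<Longrightarrow> g \<in> L2 M \<Longrightarrow> l2_inner M (U e) g = l2_inner M e (W g)"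
  shows "(\<Sum>e\<in>F. (l2_norm M (int_op M K (U e)))\<^sup>2) \<le> (l2_norm (M \<Otimes>\<^sub>M M) K)\<^sup>2"
proof -
  have [measurable]: "K \<in> borel_measurable (M \<Otimes>\<^sub>M M)" using K by (rule L2_measurable)
  have IL: "int_op M K (U e) \<in> L2 M" if "e \<in> F" for e
    using that F U K by (auto intro: int_op_L2)
  then have [measurable]: "e \<in> F \<Longrightarrow> int_op M K (U e) \<in> borel_measurable M" for e
    by (simp add: L2_measurable)
  have "ennreal (\<Sum>e\<in>F. (l2_norm M (int_op M K (U e)))\<^sup>2) =
      (\<Sum>e\<in>F. \<integral>\<^sup>+x. ennreal ((norm (int_op M K (U e) x))\<^sup>2) \<partial>M)"
    by (simp add: nn_integral_L2 IL)
  also have "\<dots> = (\<integral>\<^sup>+x. ennreal (\<Sum>e\<in>F. (norm (int_op M K (U e) x))\<^sup>2) \<partial>M)"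
    by (subst nn_integral_sum[symmetric]) (auto simp: sum_ennreal)
  also have "\<dots> \<le> (\<integral>\<^sup>+x. ennreal ((l2_norm M (\<lambda>y. K (x, y)))\<^sup>2) \<partial>M)"
  proof (rule nn_integral_mono_AE, rule AE_mp[OF L2_section[OF K]], intro AE_I2 impI)
    fix x assume x: "(\<lambda>y. K (x, y)) \<in> L2 M"
    let ?k = "\<lambda>y. cnj (K (x, y))"
    have k: "?k \<in> L2 M" "l2_norm M ?k = l2_norm M (\<lambda>y. K (x, y))"
      using x by (auto simp: l2_norm_def)
    have "(\<Sum>e\<in>F. (norm (int_op M K (U e) x))\<^sup>2) = (\<Sum>e\<in>F. (norm (l2_inner M (W ?k) e))\<^sup>2)"
    proof (intro sum.cong refl)
      fix e assume "e \<in> F"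
      then have "int_op M K (U e) x = cnj (l2_inner M (W ?k) e)"
        unfolding int_op_inner using F UW k by (auto simp: l2_inner_cnj[of M _ e])
      then show "(norm (int_op M K (U e) x))\<^sup>2 = (norm (l2_inner M (W ?k) e))\<^sup>2" by simp
    qed
    also have "\<dots> \<le> (l2_norm M (W ?k))\<^sup>2"
      by (intro bessel[OF on F] W k)
    also have "\<dots> \<le> (l2_norm M (\<lambda>y. K (x, y)))\<^sup>2"
      using W(2)[OF k(1)] k(2) by (intro power_mono) auto
    finally show "ennreal (\<Sum>e\<in>F. (norm (int_op M K (U e) x))\<^sup>2) \<le> ennreal ((l2_norm M (\<lambda>y. K (x, y)))\<^sup>2)"
      by (rule ennreal_leI)
  qed
  also have "\<dots> = ennreal ((l2_norm (M \<Otimes>\<^sub>M M) K)\<^sup>2)"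
    by (rule nn_integral_section_norm[OF K])
  finally show ?thesis by simp
qed

lemma
  fixes U :: "'a operator"
  assumes on: "orthonormal M E" and K: "K \<in> L2 (M \<Otimes>\<^sub>M M)"
    and U: "\<And>e. e \<in> E \<Longrightarrow> U e \<in> L2 M"
    and W: "\<And>g. g \<in> L2 M \<Longrightarrow> W g \<in> L2 M" "\<And>g. g \<in> L2 M \<Longrightarrow> l2_norm M (W g) \<le> l2_norm M g"
    and UW: "\<And>e g. e \<in> E \<Longrightarrow> g \<in> L2 M \<Longrightarrow> l2_inner M (U e) g = l2_inner M e (W g)"
  shows summable_int_op: "(\<lambda>e. (l2_norm M (int_op M K (U e)))\<^sup>2) summable_on E"
    and infsum_int_op_le: "(\<Sum>\<^sub>\<infinity>e\<in>E. (l2_norm M (int_op M K (U e)))\<^sup>2) \<le> (l2_norm (M \<Otimes>\<^sub>M M) K)\<^sup>2"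
proof -
  note le = sum_int_op_le[OF on _ _ K U W UW]
  show s: "(\<lambda>e. (l2_norm M (int_op M K (U e)))\<^sup>2) summable_on E"
    by (rule nonneg_bdd_above_summable_on) (auto intro!: bdd_aboveI2 le)
  show "(\<Sum>\<^sub>\<infinity>e\<in>E. (l2_norm M (int_op M K (U e)))\<^sup>2) \<le> (l2_norm (M \<Otimes>\<^sub>M M) K)\<^sup>2"
    by (rule infsum_le_finite_sums[OF s]) (auto intro!: le)
qed

text \<open>For fixed x the conjugate of the row of the kernel is an orthonormal combination with
  coefficients \<open>cnj (A e x)\<close>, so its squared norm is a finite sum of squares, which is
  then integrated over x.\<close>

lemma
  assumes A: "\<And>e. e \<in> F \<Longrightarrow> A e \<in> L2 M" and on: "orthonormal M E" and F: "finite F" "F \<subseteq> E"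
  shows L2_finite_rank_kernel: "(\<lambda>(x, y). \<Sum>e\<in>F. A e x * cnj (e y)) \<in> L2 (M \<Otimes>\<^sub>M M)"
    and l2_norm_finite_rank_kernel:
      "(l2_norm (M \<Otimes>\<^sub>M M) (\<lambda>(x, y). \<Sum>e\<in>F. A e x * cnj (e y)))\<^sup>2 = (\<Sum>e\<in>F. (l2_norm M (A e))\<^sup>2)"
proof -
  let ?K = "\<lambda>(x, y). \<Sum>e\<in>F. A e x * cnj (e y)"
  have [measurable]: "A e \<in> borel_measurable M" "e \<in> borel_measurable M" if "e \<in> F" for e
    using that A on F by (auto simp: orthonormal_def intro: L2_measurable)
  have meas [measurable]: "?K \<in> borel_measurable (M \<Otimes>\<^sub>M M)"
    by measurable
  have "(\<integral>\<^sup>+p. ennreal ((norm (?K p))\<^sup>2) \<partial>(M \<Otimes>\<^sub>M M)) =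
      (\<integral>\<^sup>+x. \<integral>\<^sup>+y. ennreal ((norm (?K (x, y)))\<^sup>2) \<partial>M \<partial>M)"
    by (subst nn_integral_fst) auto
  also have "\<dots> = (\<integral>\<^sup>+x. (\<Sum>e\<in>F. ennreal ((norm (A e x))\<^sup>2)) \<partial>M)"
  proof (intro nn_integral_cong)
    fix x
    let ?s = "\<lambda>y. \<Sum>e\<in>F. cnj (A e x) * e y"
    have "(\<integral>\<^sup>+y. ennreal ((norm (?K (x, y)))\<^sup>2) \<partial>M) = (\<integral>\<^sup>+y. ennreal ((norm (?s y))\<^sup>2) \<partial>M)"
    proof (intro nn_integral_cong)
      fix y
      have "?K (x, y) = cnj (?s y)" by simp
      then have "norm (?K (x, y)) = norm (?s y)" by (simp only: complex_mod_cnj)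
      then show "ennreal ((norm (?K (x, y)))\<^sup>2) = ennreal ((norm (?s y))\<^sup>2)" by simp
    qed
    also have "\<dots> = ennreal (\<Sum>e\<in>F. (norm (A e x))\<^sup>2)"
      using l2_norm_orthonormal_sum[OF on F, of "\<lambda>e. cnj (A e x)"]
      by (subst nn_integral_L2) (auto intro: L2_orthonormal_sum[OF on F(2)])
    finally show "(\<integral>\<^sup>+y. ennreal ((norm (?K (x, y)))\<^sup>2) \<partial>M) = (\<Sum>e\<in>F. ennreal ((norm (A e x))\<^sup>2))"
      by (simp add: sum_ennreal)
  qed
  also have "\<dots> = (\<Sum>e\<in>F. ennreal ((l2_norm M (A e))\<^sup>2))"
    by (subst nn_integral_sum) (auto simp: nn_integral_L2 A intro!: sum.cong)
  also have "\<dots> = ennreal (\<Sum>e\<in>F. (l2_norm M (A e))\<^sup>2)"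
    by (simp add: sum_ennreal)
  finally have eq: "(\<integral>\<^sup>+p. ennreal ((norm (?K p))\<^sup>2) \<partial>(M \<Otimes>\<^sub>M M)) = ennreal (\<Sum>e\<in>F. (l2_norm M (A e))\<^sup>2)" .
  show L2: "?K \<in> L2 (M \<Otimes>\<^sub>M M)"
    using eq by (intro L2_bounded_I(1)[OF meas]) auto
  show "(l2_norm (M \<Otimes>\<^sub>M M) ?K)\<^sup>2 = (\<Sum>e\<in>F. (l2_norm M (A e))\<^sup>2)"
    using eq unfolding nn_integral_L2[OF L2] by (simp add: sum_nonneg)
qed

text \<open>The kernel of a Hilbert--Schmidt operator is the sum of the series
  \<open>\<Sum>e. (A e) x * cnj (e y)\<close>, which converges in the square mean.\<close>

lemma hilbert_schmidt_kernel:
  assumes A: "bounded_operator M A" and onb: "orthonormal_basis M E" and cnt: "countable E"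
    and summable: "(\<lambda>e. (l2_norm M (A e))\<^sup>2) summable_on E"
  obtains K where "is_kernel M A K"
proof -
  have on: "orthonormal M E" using onb by (rule orthonormal_basis_orthonormal)
  have AE: "e \<in> E \<Longrightarrow> A e \<in> L2 M" for e using on A by (auto simp: orthonormal_def intro: bounded_operator_L2)
  obtain F where F: "\<And>n. finite (F n)" "\<And>n. F n \<subseteq> E" "incseq F"
      "filterlim F (finite_subsets_at_top E) sequentially"
    using cnt by (rule countable_exhaustion) blast
  define S where "S n = (\<Sum>e\<in>F n. (l2_norm M (A e))\<^sup>2)" for n
  have S: "S \<longlonglongrightarrow> (\<Sum>\<^sub>\<infinity>e\<in>E. (l2_norm M (A e))\<^sup>2)"
    using has_sum_infsum[OF summable]
    unfolding S_def has_sum_def by (rule filterlim_compose) (rule F)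
  define k where "k n = (\<lambda>(x, y). \<Sum>e\<in>F n. A e x * cnj (e y))" for n
  have k: "k n \<in> L2 (M \<Otimes>\<^sub>M M)" for n
    unfolding k_def using AE F on by (intro L2_finite_rank_kernel) auto
  obtain K where K: "K \<in> L2 (M \<Otimes>\<^sub>M M)" "(\<lambda>n. l2_norm (M \<Otimes>\<^sub>M M) (\<lambda>p. k n p - K p)) \<longlonglongrightarrow> 0"
  proof (rule L2_complete_partial_sums[of k "M \<Otimes>\<^sub>M M" S])
    show "convergent S" using S by (auto simp: convergent_def)
    fix m n :: nat assume "n \<le> m"
    then have sub: "F n \<subseteq> F m" using F(3) by (auto simp: incseq_def)
    have "(\<lambda>p. k m p - k n p) = (\<lambda>(x, y). \<Sum>e\<in>F m - F n. A e x * cnj (e y))"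
      unfolding k_def using F(1) sub by (simp add: fun_eq_iff sum_diff_subset)
    then have "(l2_norm (M \<Otimes>\<^sub>M M) (\<lambda>p. k m p - k n p))\<^sup>2 = (\<Sum>e\<in>F m - F n. (l2_norm M (A e))\<^sup>2)"
      using l2_norm_finite_rank_kernel[of "F m - F n" A E] F on AE by auto
    then show "(l2_norm (M \<Otimes>\<^sub>M M) (\<lambda>p. k m p - k n p))\<^sup>2 \<le> S m - S n"
      unfolding S_def using F(1) sub by (simp add: sum_diff_subset)
  qed (use k in auto)
  have "AE x in M. A \<phi> x = int_op M K \<phi> x" if \<phi>: "\<phi> \<in> L2 M" for \<phi>
  proof (rule l2_norm_diff_eq_0)
    define s where "s n x = (\<Sum>e\<in>F n. l2_inner M \<phi> e * A e x)" for n x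
    have s: "s n \<in> L2 M" for n
      unfolding s_def using AE F by (intro L2_sum L2_scale) auto
    have k_s: "int_op M (k n) \<phi> = s n" for n
    proof
      fix x
      have "integrable M (\<lambda>y. A e x * (\<phi> y * cnj (e y)))" if "e \<in> F n" for e
        using that F on \<phi> by (intro integrable_mult_right integrable_l2_inner) (auto simp: orthonormal_def)
      then have "int_op M (k n) \<phi> x = (\<Sum>e\<in>F n. LINT y|M. A e x * (\<phi> y * cnj (e y)))"
        unfolding int_op_def k_def
        by (subst Bochner_Integration.integral_sum[symmetric])
          (auto simp: sum_distrib_left mult_ac)
      then show "int_op M (k n) \<phi> x = s n x"
        by (simp add: s_def l2_inner_def mult.commute)
    qed
    have "l2_norm M (\<lambda>x. A \<phi> x - int_op M K \<phi> x) \<le>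
        l2_norm M (\<lambda>x. s n x - A \<phi> x) + l2_norm (M \<Otimes>\<^sub>M M) (\<lambda>p. k n p - K p) * l2_norm M \<phi>" for n
    proof -
      have "l2_norm M (\<lambda>x. s n x - int_op M K \<phi> x) = l2_norm M (int_op M (\<lambda>p. k n p - K p) \<phi>)"
        using int_op_diff[OF k[of n] K(1) \<phi>] k_s
        by (intro l2_norm_cong_AE L2_measurable L2_diff s int_op_L2 K k \<phi>) auto
      also have "\<dots> \<le> l2_norm (M \<Otimes>\<^sub>M M) (\<lambda>p. k n p - K p) * l2_norm M \<phi>"
        by (intro int_op_norm_le L2_diff K k \<phi>)
      finally show ?thesis
        using l2_norm_triangle_diff[OF bounded_operator_L2[OF A \<phi>] s[of n] int_op_L2[OF K(1) \<phi>]]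
        by (simp add: l2_norm_minus_commute[of M "A \<phi>"])
    qed
    moreover have "(\<lambda>n. l2_norm M (\<lambda>x. s n x - A \<phi> x) + l2_norm (M \<Otimes>\<^sub>M M) (\<lambda>p. k n p - K p) * l2_norm M \<phi>)
        \<longlonglongrightarrow> 0 + 0 * l2_norm M \<phi>"
      unfolding s_def using bounded_operator_series[OF onb cnt A \<phi>] F(4) K(2)
      by (intro tendsto_intros) (rule filterlim_compose)
    ultimately have "l2_norm M (\<lambda>x. A \<phi> x - int_op M K \<phi> x) \<le> 0"
      by (intro LIMSEQ_le_const[where X="\<lambda>n. _ n + _ n"]) auto
    then show "l2_norm M (\<lambda>x. A \<phi> x - int_op M K \<phi> x) = 0"
      by (intro antisym) auto
  qed (use A K \<phi> in \<open>auto intro: bounded_operator_L2 int_op_L2\<close>)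
  then have "is_kernel M A K" using K by (auto simp: is_kernel_def int_op_def)
  then show ?thesis by (rule that)
qed

end

text \<open>Separability in the form in which it is used: countable orthonormal systems supply the
  sequences of partial sums. This form also passes easily to subsets of the underlying
  space.\<close>

locale separable_L2 = sigma_finite_measure M for M :: "'a measure" +
  assumes countable_orthonormal: "orthonormal M E \<Longrightarrow> countable E"
begin

lemma countable_some_onb: "countable (some_onb M)"
  by (intro countable_orthonormal some_onb_orthonormal)

lemma hs_kernel_is_kernel:
  assumes "hilbert_schmidt M A"
  shows "is_kernel M A (hs_kernel M A)"
proof -
  obtain E where "bounded_operator M A" "orthonormal_basis M E"
      "(\<lambda>e. (l2_norm M (A e))\<^sup>2) summable_on E"
    using assms by (auto simp: hilbert_schmidt_def)
  then obtain K where "is_kernel M A K"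
    by (metis hilbert_schmidt_kernel countable_orthonormal orthonormal_basis_orthonormal)
  then show ?thesis unfolding hs_kernel_def by (metis someI)
qed

lemma hs_kernel_L2: "hilbert_schmidt M A \<Longrightarrow> hs_kernel M A \<in> L2 (M \<Otimes>\<^sub>M M)"
  using hs_kernel_is_kernel by (auto simp: is_kernel_def)

lemma hs_kernel_int_op:
  "hilbert_schmidt M A \<Longrightarrow> \<phi> \<in> L2 M \<Longrightarrow> AE x in M. A \<phi> x = int_op M (hs_kernel M A) \<phi> x"
  using hs_kernel_is_kernel by (auto simp: is_kernel_def int_op_def)

lemma
  assumes A: "bounded_operator M A" and K: "K \<in> L2 (M \<Otimes>\<^sub>M M)"
    and eq: "\<And>\<phi>. \<phi> \<in> L2 M \<Longrightarrow> AE x in M. A \<phi> x = int_op M K \<phi> x"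
  shows kernel_summable: "(\<lambda>e. (l2_norm M (A e))\<^sup>2) summable_on some_onb M"
    and kernel_infsum_le: "(\<Sum>\<^sub>\<infinity>e\<in>some_onb M. (l2_norm M (A e))\<^sup>2) \<le> (l2_norm (M \<Otimes>\<^sub>M M) K)\<^sup>2"
proof -
  have *: "l2_norm M (A e) = l2_norm M (int_op M K e)" if "e \<in> some_onb M" for e
    using eq[of e] A K that
    by (intro l2_norm_cong_AE L2_measurable) (auto intro: bounded_operator_L2 int_op_L2 some_onb_L2)
  note int_op = summable_int_op[OF some_onb_orthonormal K, of "\<lambda>e. e" "\<lambda>e. e"]
    infsum_int_op_le[OF some_onb_orthonormal K, of "\<lambda>e. e" "\<lambda>e. e"]
  show "(\<lambda>e. (l2_norm M (A e))\<^sup>2) summable_on some_onb M"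
    using int_op(1) by (simp add: * some_onb_L2 cong: summable_on_cong)
  show "(\<Sum>\<^sub>\<infinity>e\<in>some_onb M. (l2_norm M (A e))\<^sup>2) \<le> (l2_norm (M \<Otimes>\<^sub>M M) K)\<^sup>2"
    using int_op(2) by (simp add: * some_onb_L2 cong: infsum_cong)
qed

text \<open>Change of basis by way of the kernel: the kernel is built from the unspecified basis in
  \<open>hilbert_schmidt\<close>, and its norm bounds the sum over every other orthonormal system,
  in particular over \<open>some_onb\<close>.\<close>

lemma hilbert_schmidt_summable:
  "hilbert_schmidt M A \<Longrightarrow> (\<lambda>e. (l2_norm M (A e))\<^sup>2) summable_on some_onb M"
  by (rule kernel_summable[OF _ hs_kernel_L2 hs_kernel_int_op]) (auto simp: hilbert_schmidt_def)

lemma hilbert_schmidt_int_op: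
  assumes K: "K \<in> L2 (M \<Otimes>\<^sub>M M)"
  shows "hilbert_schmidt M (int_op M K)"
  unfolding hilbert_schmidt_def
  using bounded_operator_int_op[OF K] some_onb kernel_summable[OF bounded_operator_int_op[OF K] K] by auto

lemma l2_norm_diff_le_hs_norm:
  assumes A: "hilbert_schmidt M A" and B: "hilbert_schmidt M B" and f: "f \<in> L2 M"
  shows "l2_norm M (\<lambda>x. A f x - B f x) \<le> hs_norm M (\<lambda>f x. A f x - B f x) * l2_norm M f"
proof -
  have bd: "bounded_operator M A" "bounded_operator M B"
    using A B by (auto simp: hilbert_schmidt_def)
  \<comment> \<open>Summability of the difference has to be established: otherwise the infinite sum
    in \<open>hs_norm\<close> could be its default value 0, which bounds nothing.\<close>
  have "(\<lambda>e. (l2_norm M (\<lambda>x. A e x - B e x))\<^sup>2) summable_on some_onb M"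
  proof (rule summable_on_comparison_test)
    show "(\<lambda>e. 2 * (l2_norm M (A e))\<^sup>2 + 2 * (l2_norm M (B e))\<^sup>2) summable_on some_onb M"
      by (intro summable_on_add summable_on_cmult_right hilbert_schmidt_summable A B)
    fix e assume "e \<in> some_onb M"
    then have e: "A e \<in> L2 M" "B e \<in> L2 M"
      using bd by (auto intro: bounded_operator_L2 some_onb_L2)
    have "(l2_norm M (\<lambda>x. A e x - B e x))\<^sup>2 \<le> (l2_norm M (A e) + l2_norm M (B e))\<^sup>2"
      using l2_norm_triangle[OF e(1) L2_uminus[OF e(2)]] by (intro power_mono) auto
    also have "\<dots> \<le> 2 * (l2_norm M (A e))\<^sup>2 + 2 * (l2_norm M (B e))\<^sup>2"
      using sum_squares_bound[of "l2_norm M (A e)" "l2_norm M (B e)"] by (simp add: power2_sum)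
    finally show "(l2_norm M (\<lambda>x. A e x - B e x))\<^sup>2 \<le> 2 * (l2_norm M (A e))\<^sup>2 + 2 * (l2_norm M (B e))\<^sup>2" .
  qed auto
  then show ?thesis
    unfolding hs_norm_def
    by (rule l2_norm_operator_le[OF some_onb countable_some_onb bounded_operator_minus[OF bd] _ f])
qed

end

section \<open>Polar coordinates on the cones\<close>

lemma borel_measurable_fst_snd [measurable (raw)]:
  fixes f :: "'z \<Rightarrow> 'a::topological_space \<times> 'b::topological_space"
  assumes "f \<in> borel_measurable N"
  shows "(\<lambda>z. fst (f z)) \<in> borel_measurable N" "(\<lambda>z. snd (f z)) \<in> borel_measurable N"
  by (rule measurable_compose[OF assms], intro borel_measurable_continuous_onI continuous_intros)+

lemma nn_integral_lborel_pair:
  fixes h :: "'a::euclidean_space \<times> 'b::euclidean_space \<Rightarrow> ennreal"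
  assumes "h \<in> borel_measurable borel"
  shows "(\<integral>\<^sup>+x. h x \<partial>lborel) = (\<integral>\<^sup>+a. \<integral>\<^sup>+b. h (a, b) \<partial>lborel \<partial>lborel)"
    and "(\<integral>\<^sup>+x. h x \<partial>lborel) = (\<integral>\<^sup>+b. \<integral>\<^sup>+a. h (a, b) \<partial>lborel \<partial>lborel)"
proof -
  have [measurable]: "h \<in> borel_measurable (lborel \<Otimes>\<^sub>M lborel)"
    using assms by (simp add: lborel_prod)
  show "(\<integral>\<^sup>+x. h x \<partial>lborel) = (\<integral>\<^sup>+a. \<integral>\<^sup>+b. h (a, b) \<partial>lborel \<partial>lborel)"
    unfolding lborel_prod[symmetric] by (subst lborel.nn_integral_fst) auto
  show "(\<integral>\<^sup>+x. h x \<partial>lborel) = (\<integral>\<^sup>+b. \<integral>\<^sup>+a. h (a, b) \<partial>lborel \<partial>lborel)"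
    unfolding lborel_prod[symmetric] by (subst lborel_pair.nn_integral_snd) auto
qed

text \<open>The coordinates u = x1 + x2 and v = x1 - x2 diagonalise all Lorentz boosts. The change
  of variables is a shift in x1 and, after Tonelli, the substitution x2 = (u - v)/2, whose slope
  contributes the factor 1/2.\<close>

lemma nn_integral_light_coordinates:
  fixes h :: "plane \<Rightarrow> ennreal"
  assumes [measurable]: "h \<in> borel_measurable borel"
  shows "(\<integral>\<^sup>+x. h x \<partial>lborel) =
    ennreal (1/2) * (\<integral>\<^sup>+u. \<integral>\<^sup>+v. h ((u + v) / 2, (u - v) / 2) \<partial>lborel \<partial>lborel)"
proof -
  have "(\<integral>\<^sup>+x. h x \<partial>lborel) = (\<integral>\<^sup>+x2. \<integral>\<^sup>+x1. h (x1, x2) \<partial>lborel \<partial>lborel)"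
    by (rule nn_integral_lborel_pair) fact
  also have "\<dots> = (\<integral>\<^sup>+x2. \<integral>\<^sup>+u. h (u - x2, x2) \<partial>lborel \<partial>lborel)"
  proof (rule nn_integral_cong)
    fix x2 :: real
    show "(\<integral>\<^sup>+x1. h (x1, x2) \<partial>lborel) = (\<integral>\<^sup>+u. h (u - x2, x2) \<partial>lborel)"
      by (subst nn_integral_real_affine[where c=1 and t="- x2"]) auto
  qed
  also have "\<dots> = (\<integral>\<^sup>+u. \<integral>\<^sup>+x2. h (u - x2, x2) \<partial>lborel \<partial>lborel)"
    by (rule lborel_pair.Fubini') (simp add: lborel_prod split_beta')
  also have "\<dots> = (\<integral>\<^sup>+u. ennreal (1/2) * \<integral>\<^sup>+v. h ((u + v) / 2, (u - v) / 2) \<partial>lborel \<partial>lborel)"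
  proof (intro nn_integral_cong)
    fix u :: real
    have eq: "u - (u / 2 + (-1/2) * v) = (u + v) / 2" "u / 2 + (-1/2) * v = (u - v) / 2" for v :: real
      by (auto simp: field_simps)
    have "(\<integral>\<^sup>+x2. h (u - x2, x2) \<partial>lborel) =
        ennreal \<bar>-1/2\<bar> * (\<integral>\<^sup>+v. h (u - (u / 2 + (-1/2) * v), u / 2 + (-1/2) * v) \<partial>lborel)"
      by (rule nn_integral_real_affine) auto
    then show "(\<integral>\<^sup>+x2. h (u - x2, x2) \<partial>lborel) =
        ennreal (1/2) * (\<integral>\<^sup>+v. h ((u + v) / 2, (u - v) / 2) \<partial>lborel)"
      unfolding eq(1) unfolding eq(2) by simp
  qed
  also have "\<dots> = ennreal (1/2) * (\<integral>\<^sup>+u. \<integral>\<^sup>+v. h ((u + v) / 2, (u - v) / 2) \<partial>lborel \<partial>lborel)"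
    by (subst nn_integral_cmult) auto
  finally show ?thesis .
qed

text \<open>The point at which \<open>irrep\<close> evaluates its argument. The pair (a, \<theta>)
  is the group element modulo translations, and with x fixed it serves as polar coordinates on the
  cone of x.\<close>

definition orbit :: "plane \<Rightarrow> real \<times> real \<Rightarrow> plane" where
  "orbit x = (\<lambda>(a, \<theta>). a *\<^sub>R lorentz (- \<theta>) x)"

lemma orbit_light_coordinates:
  "fst (orbit x (a, \<theta>)) + snd (orbit x (a, \<theta>)) = a * exp (- \<theta>) * (fst x + snd x)"
  "fst (orbit x (a, \<theta>)) - snd (orbit x (a, \<theta>)) = a * exp \<theta> * (fst x - snd x)"
proof -
  have e: "exp (- \<theta>) = cosh \<theta> - sinh \<theta>" "exp \<theta> = cosh \<theta> + sinh \<theta>"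
    by (simp_all add: cosh_minus_sinh cosh_plus_sinh)
  show "fst (orbit x (a, \<theta>)) + snd (orbit x (a, \<theta>)) = a * exp (- \<theta>) * (fst x + snd x)"
    "fst (orbit x (a, \<theta>)) - snd (orbit x (a, \<theta>)) = a * exp \<theta> * (fst x - snd x)"
    unfolding e by (simp_all add: orbit_def lorentz_def split_beta algebra_simps)
qed

lemma plane_eqI:
  fixes x y :: plane
  assumes "fst x + snd x = fst y + snd y" "fst x - snd x = fst y - snd y"
  shows "x = y"
  using assms by (auto simp: prod_eq_iff)

lemma orbit_eq:
  "orbit x (a, \<theta>) = ((a * exp (- \<theta>) * (fst x + snd x) + a * exp \<theta> * (fst x - snd x)) / 2,
    (a * exp (- \<theta>) * (fst x + snd x) - a * exp \<theta> * (fst x - snd x)) / 2)"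
  by (rule plane_eqI) (simp_all add: orbit_light_coordinates field_simps)

lemma minkowski_self: "minkowski x x = (fst x + snd x) * (fst x - snd x)"
  by (simp add: minkowski_def algebra_simps)

lemma minkowski_orbit: "minkowski (orbit x (a, \<theta>)) (orbit x (a, \<theta>)) = a\<^sup>2 * minkowski x x"
proof -
  have "exp (- \<theta>) * exp \<theta> = (1::real)" by (simp add: mult_exp_exp)
  then have "a * exp (- \<theta>) * u * (a * exp \<theta> * v) = a\<^sup>2 * (u * v)" for u v
    by (simp add: power2_eq_square)
  then show ?thesis by (simp only: minkowski_self orbit_light_coordinates)
qed

text \<open>In light coordinates the four cones are the four open quadrants, so invariance of the
  cones and the polar coordinates reduce to signs of products.\<close>

lemma cone_iff:
  assumes "i \<in> {1, 2}" "j \<in> {1, 2}"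
  shows "x \<in> cone i j \<longleftrightarrow> 0 < (if i = 1 then 1 else -1) * (fst x + snd x) \<and>
    0 < (if i = j then 1 else -1) * (fst x - snd x)"
proof -
  obtain x1 x2 where x: "x = (x1, x2)" by (cases x)
  have sq: "x1\<^sup>2 > x2\<^sup>2 \<longleftrightarrow> \<bar>x2\<bar> < \<bar>x1\<bar>" "x1\<^sup>2 < x2\<^sup>2 \<longleftrightarrow> \<bar>x1\<bar> < \<bar>x2\<bar>"
    by (metis abs_le_square_iff not_le)+
  have "\<bar>x2\<bar> < \<bar>x1\<bar> \<and> 0 < x1 \<longleftrightarrow> 0 < 1 * (x1 + x2) \<and> 0 < 1 * (x1 - x2)"
    "\<bar>x2\<bar> < \<bar>x1\<bar> \<and> x1 < 0 \<longleftrightarrow> 0 < -1 * (x1 + x2) \<and> 0 < -1 * (x1 - x2)"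
    "\<bar>x1\<bar> < \<bar>x2\<bar> \<and> 0 < x2 \<longleftrightarrow> 0 < 1 * (x1 + x2) \<and> 0 < -1 * (x1 - x2)"
    "\<bar>x1\<bar> < \<bar>x2\<bar> \<and> x2 < 0 \<longleftrightarrow> 0 < -1 * (x1 + x2) \<and> 0 < 1 * (x1 - x2)"
    by (auto simp: abs_if split: if_splits)
  then show ?thesis
    using assms unfolding x cone_def sq fst_conv snd_conv mem_Collect_eq prod.case
    by (elim insertE emptyE) (simp_all only: if_True if_False, simp_all)
qed

lemma cone_minkowski:
  assumes "i \<in> {1, 2}" "j \<in> {1, 2}" "x \<in> cone i j"
  shows "fst x + snd x \<noteq> 0" "fst x - snd x \<noteq> 0" "minkowski x x \<noteq> 0"
proof -
  show "fst x + snd x \<noteq> 0" "fst x - snd x \<noteq> 0"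
    using assms cone_iff[OF assms(1,2), of x] by (auto split: if_splits)
  then show "minkowski x x \<noteq> 0" by (simp add: minkowski_self)
qed

lemma orbit_in_cone_iff:
  assumes "i \<in> {1, 2}" "j \<in> {1, 2}" "0 < a"
  shows "orbit x (a, \<theta>) \<in> cone i j \<longleftrightarrow> x \<in> cone i j"
proof -
  have "0 < s * (c * t) \<longleftrightarrow> 0 < s * t" if "0 < c" for s c t :: real
    using that by (simp add: zero_less_mult_iff mult_less_0_iff)
  then show ?thesis
    unfolding cone_iff[OF assms(1,2)] orbit_light_coordinates using \<open>0 < a\<close> by simp
qed

text \<open>Here \<alpha> and \<beta> are the light coordinates of the point relative to those of x.
  In relative coordinates each of the four cones is the positive quadrant, so one computation serves
  them all.\<close>

lemma cone_mem_relative: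
  assumes "i \<in> {1, 2}" "j \<in> {1, 2}" "x \<in> cone i j"
  shows "((fst x + snd x) * \<alpha> + (fst x - snd x) * \<beta>) / 2 = y1 \<Longrightarrow>
    ((fst x + snd x) * \<alpha> - (fst x - snd x) * \<beta>) / 2 = y2 \<Longrightarrow>
    (y1, y2) \<in> cone i j \<longleftrightarrow> 0 < \<alpha> \<and> 0 < \<beta>"
proof -
  assume y: "((fst x + snd x) * \<alpha> + (fst x - snd x) * \<beta>) / 2 = y1"
    "((fst x + snd x) * \<alpha> - (fst x - snd x) * \<beta>) / 2 = y2"
  have "y1 + y2 = (fst x + snd x) * \<alpha>" "y1 - y2 = (fst x - snd x) * \<beta>"
    using y by (auto simp: field_simps)
  moreover have "0 < s * (t * c) \<longleftrightarrow> 0 < c" if "0 < s * t" for s c t :: real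
    using that by (auto simp: zero_less_mult_iff mult_less_0_iff)
  ultimately show ?thesis
    using assms(3) unfolding cone_iff[OF assms(1,2)] by simp
qed

lemma cone_sets [measurable]: "cone i j \<in> sets borel"
proof -
  have "cone i j = {x \<in> space borel. if j = 1 then (fst x)\<^sup>2 > (snd x)\<^sup>2 \<and> (if i = 1 then fst x > 0 else fst x < 0)
     else (fst x)\<^sup>2 < (snd x)\<^sup>2 \<and> (if i = 1 then snd x > 0 else snd x < 0)}"
    by (auto simp: cone_def)
  also have "\<dots> \<in> sets borel" by measurable
  finally show ?thesis .
qed

lemma orbit_measurable [measurable (raw)]:
  assumes [measurable]: "f \<in> borel_measurable N" "g \<in> borel_measurable N"
  shows "(\<lambda>z. orbit (f z) (g z)) \<in> borel_measurable N"
proof -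
  have "orbit x q = (fst q * (cosh (snd q) * fst x - sinh (snd q) * snd x),
      fst q * (cosh (snd q) * snd x - sinh (snd q) * fst x))" for x q
    by (simp add: orbit_def lorentz_def split_beta prod_eq_iff)
  moreover have [measurable]: "cosh \<in> borel_measurable (borel :: real measure)"
    "sinh \<in> borel_measurable (borel :: real measure)"
    by (intro borel_measurable_continuous_onI continuous_intros)+
  ultimately show ?thesis by simp
qed

lemma minkowski_measurable [measurable (raw)]:
  assumes [measurable]: "f \<in> borel_measurable N" "g \<in> borel_measurable N"
  shows "(\<lambda>z. minkowski (f z) (g z)) \<in> borel_measurable N"
  unfolding minkowski_def by measurable

text \<open>The map scales the light coordinates by a exp(-\<theta>) and a exp(\<theta>). The
  product of the two factors is the square of a: boosts preserve area and only the dilation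
  contributes.\<close>

lemma nn_integral_orbit:
  fixes h :: "plane \<Rightarrow> ennreal"
  assumes [measurable]: "h \<in> borel_measurable borel" and a: "0 < a"
  shows "(\<integral>\<^sup>+x. h (orbit x (a, \<theta>)) \<partial>lborel) = ennreal (1 / a\<^sup>2) * (\<integral>\<^sup>+x. h x \<partial>lborel)"
proof -
  define c d where "c = a * exp (- \<theta>)" and "d = a * exp \<theta>"
  have cd: "c > 0" "d > 0" "c * d = a\<^sup>2"
    using a by (auto simp: c_def d_def power2_eq_square mult_exp_exp)
  let ?g = "\<lambda>u v. h ((u + v) / 2, (u - v) / 2)"
  have "orbit ((u + v) / 2, (u - v) / 2) (a, \<theta>) = ((c * u + d * v) / 2, (c * u - d * v) / 2)" for u v
    unfolding orbit_eq c_def d_def by (simp add: field_simps)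
  then have "(\<integral>\<^sup>+x. h (orbit x (a, \<theta>)) \<partial>lborel) =
      ennreal (1/2) * (\<integral>\<^sup>+u. \<integral>\<^sup>+v. ?g (c * u) (d * v) \<partial>lborel \<partial>lborel)"
    by (subst nn_integral_light_coordinates) auto
  moreover have "(\<integral>\<^sup>+x. h x \<partial>lborel) = ennreal (1/2) * (\<integral>\<^sup>+u. \<integral>\<^sup>+v. ?g u v \<partial>lborel \<partial>lborel)"
    by (subst nn_integral_light_coordinates) auto
  moreover have "(\<integral>\<^sup>+u. \<integral>\<^sup>+v. ?g u v \<partial>lborel \<partial>lborel) =
      ennreal (a\<^sup>2) * (\<integral>\<^sup>+u. \<integral>\<^sup>+v. ?g (c * u) (d * v) \<partial>lborel \<partial>lborel)"
  proof -
    have "(\<integral>\<^sup>+u. \<integral>\<^sup>+v. ?g u v \<partial>lborel \<partial>lborel) =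
        ennreal c * (\<integral>\<^sup>+u. \<integral>\<^sup>+v. ?g (c * u) v \<partial>lborel \<partial>lborel)"
      using cd by (subst nn_integral_real_affine[where c=c and t=0]) auto
    also have "(\<integral>\<^sup>+u. \<integral>\<^sup>+v. ?g (c * u) v \<partial>lborel \<partial>lborel) =
        (\<integral>\<^sup>+u. ennreal d * \<integral>\<^sup>+v. ?g (c * u) (d * v) \<partial>lborel \<partial>lborel)"
      using cd by (intro nn_integral_cong, subst nn_integral_real_affine[where c=d and t=0]) auto
    also have "\<dots> = ennreal d * (\<integral>\<^sup>+u. \<integral>\<^sup>+v. ?g (c * u) (d * v) \<partial>lborel \<partial>lborel)"
      by (subst nn_integral_cmult) auto
    finally show ?thesis
      using cd by (simp add: ennreal_mult'[symmetric] mult.assoc[symmetric])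
  qed
  moreover have "ennreal (1 / a\<^sup>2) * (ennreal (1/2) * (ennreal (a\<^sup>2) * J)) = ennreal (1/2) * J" for J
  proof -
    have "ennreal (1 / a\<^sup>2) * (ennreal (1/2) * (ennreal (a\<^sup>2) * J)) =
        ennreal (1 / a\<^sup>2) * ennreal (a\<^sup>2) * (ennreal (1/2) * J)"
      by (simp only: ac_simps)
    moreover have "ennreal (1 / a\<^sup>2) * ennreal (a\<^sup>2) = 1"
      using a by (simp add: ennreal_mult'[symmetric])
    ultimately show ?thesis by simp
  qed
  ultimately show ?thesis by (simp only:)
qed

text \<open>The substitution rule is applied on the compact intervals \<open>X n\<close>; their
  images \<open>Y n\<close> exhaust the half line, and monotone convergence removes the
  restriction.\<close>

lemma nn_integral_exp_substitution:
  fixes G :: "real \<Rightarrow> ennreal"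
  assumes [measurable]: "G \<in> borel_measurable borel" and c: "0 < c"
  shows "(\<integral>\<^sup>+t. G (c * exp (2 * t)) * ennreal (2 * c * exp (2 * t)) \<partial>lborel) =
    (\<integral>\<^sup>+b. G b * indicator {0<..} b \<partial>lborel)"
proof -
  define g where "g t = c * exp (2 * t)" for t
  define X where "X n = {- (real n + 1)..real n + 1}" for n
  define Y where "Y n = {g (- (real n + 1))..g (real n + 1)}" for n
  have mono: "g s \<le> g t \<longleftrightarrow> s \<le> t" for s t using c by (simp add: g_def)
  have eq: "(\<integral>\<^sup>+b. G b * indicator (Y n) b \<partial>lborel) =
      (\<integral>\<^sup>+t. G (g t) * ennreal (2 * c * exp (2 * t)) * indicator (X n) t \<partial>lborel)" for n
    unfolding X_def Y_def
    by (rule nn_integral_substitution_aux)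
      (use c in \<open>auto simp: g_def intro!: derivative_eq_intros continuous_intros\<close>)
  have X: "(\<Union>n. X n) = UNIV"
  proof -
    have "\<exists>n. t \<in> X n" for t
    proof -
      obtain n where "\<bar>t\<bar> \<le> real n" using real_arch_simple by blast
      then have "t \<in> X n" by (simp add: X_def abs_le_iff)
      then show ?thesis by blast
    qed
    then show ?thesis by auto
  qed
  have Y: "(\<Union>n. Y n) = {0<..}"
  proof -
    have "\<exists>n. b \<in> Y n" if "b > 0" for b
    proof -
      define t where "t = ln (b / c) / 2"
      have t: "g t = b" using that c by (simp add: g_def t_def)
      obtain n where "t \<in> X n" using X by blast
      then show ?thesis unfolding t[symmetric] Y_def X_def by (auto simp: mono)
    qed
    moreover have "0 < b" if "b \<in> Y n" for b n
      using that c unfolding Y_def g_def by (auto intro: less_le_trans[rotated])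
    ultimately show ?thesis by auto
  qed
  have sup: "(SUP n. (\<integral>\<^sup>+t. f t * indicator (A n) t \<partial>lborel)) = (\<integral>\<^sup>+t. f t * indicator (\<Union>n. A n) t \<partial>lborel)"
    if [measurable]: "f \<in> borel_measurable borel" "\<And>n. A n \<in> sets borel" and "incseq A"
    for f :: "real \<Rightarrow> ennreal" and A :: "nat \<Rightarrow> real set"
  proof -
    have "incseq (\<lambda>n t. f t * indicator (A n) t)"
      using \<open>incseq A\<close> by (auto simp: incseq_def le_fun_def indicator_def intro!: mult_left_mono)
    then have "(SUP n. (\<integral>\<^sup>+t. f t * indicator (A n) t \<partial>lborel)) =
        (\<integral>\<^sup>+t. (SUP n. f t * indicator (A n) t) \<partial>lborel)"
      by (intro nn_integral_monotone_convergence_SUP[symmetric]) auto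
    also have "\<dots> = (\<integral>\<^sup>+t. f t * indicator (\<Union>n. A n) t \<partial>lborel)"
    proof (intro nn_integral_cong)
      fix t
      have "(SUP n. indicator (A n) t :: ennreal) = indicator (\<Union>n. A n) t"
        by (auto simp: indicator_def intro!: antisym SUP_least intro: SUP_upper2)
      then show "(SUP n. f t * indicator (A n) t) = f t * indicator (\<Union>n. A n) t"
        by (metis SUP_mult_left_ennreal)
    qed
    finally show ?thesis .
  qed
  have "(SUP n. (\<integral>\<^sup>+b. G b * indicator (Y n) b \<partial>lborel)) = (\<integral>\<^sup>+b. G b * indicator {0<..} b \<partial>lborel)"
    unfolding Y[symmetric] by (rule sup) (auto simp: Y_def incseq_def mono intro: order_trans)
  moreover have "(SUP n. (\<integral>\<^sup>+t. G (g t) * ennreal (2 * c * exp (2 * t)) * indicator (X n) t \<partial>lborel)) =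
      (\<integral>\<^sup>+t. G (g t) * ennreal (2 * c * exp (2 * t)) \<partial>lborel)"
  proof -
    have "incseq X" "\<And>n. X n \<in> sets borel" by (auto simp: X_def incseq_def)
    then show ?thesis by (subst sup) (simp_all add: X g_def)
  qed
  ultimately show ?thesis by (simp add: eq g_def)
qed

text \<open>The coordinates are \<alpha> = a exp(-\<theta>) and \<beta> = a exp(\<theta>), with
  Jacobian 2 a. They are introduced one variable at a time: a = \<alpha> exp(\<theta>) with \<theta>
  fixed, then, after Tonelli, \<beta> = \<alpha> exp(2 \<theta>) with \<alpha> fixed.\<close>

lemma nn_integral_hyperbolic:
  fixes g :: "real \<Rightarrow> real \<Rightarrow> ennreal"
  assumes [measurable]: "(\<lambda>(\<alpha>, \<beta>). g \<alpha> \<beta>) \<in> borel_measurable borel"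
  shows "(\<integral>\<^sup>+\<alpha>. \<integral>\<^sup>+\<beta>. g \<alpha> \<beta> * indicator {0<..} \<alpha> * indicator {0<..} \<beta> \<partial>lborel \<partial>lborel) =
    (\<integral>\<^sup>+\<theta>. \<integral>\<^sup>+a. g (a * exp (- \<theta>)) (a * exp \<theta>) * ennreal (2 * a) * indicator {0<..} a \<partial>lborel \<partial>lborel)"
proof -
  have [measurable (raw)]: "(\<lambda>z. g (f z) (f' z)) \<in> borel_measurable N"
    if [measurable]: "f \<in> borel_measurable N" "f' \<in> borel_measurable N" for f f' and N :: "'z measure"
    using measurable_compose[of "\<lambda>z. (f z, f' z)" N borel, OF _ assms] by simp
  have "(\<integral>\<^sup>+\<theta>. \<integral>\<^sup>+a. g (a * exp (- \<theta>)) (a * exp \<theta>) * ennreal (2 * a) * indicator {0<..} a \<partial>lborel \<partial>lborel) =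
      (\<integral>\<^sup>+\<theta>. \<integral>\<^sup>+\<alpha>. g \<alpha> (\<alpha> * exp (2 * \<theta>)) * ennreal (2 * \<alpha> * exp (2 * \<theta>)) * indicator {0<..} \<alpha> \<partial>lborel \<partial>lborel)"
  proof (rule nn_integral_cong)
    fix \<theta> :: real
    have "(\<integral>\<^sup>+a. g (a * exp (- \<theta>)) (a * exp \<theta>) * ennreal (2 * a) * indicator {0<..} a \<partial>lborel) =
        ennreal (exp \<theta>) * (\<integral>\<^sup>+\<alpha>. g (exp \<theta> * \<alpha> * exp (- \<theta>)) (exp \<theta> * \<alpha> * exp \<theta>) *
          ennreal (2 * (exp \<theta> * \<alpha>)) * indicator {0<..} (exp \<theta> * \<alpha>) \<partial>lborel)"
      by (subst nn_integral_real_affine[where c="exp \<theta>" and t=0]) auto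
    also have "\<dots> = (\<integral>\<^sup>+\<alpha>. ennreal (exp \<theta>) * (g (exp \<theta> * \<alpha> * exp (- \<theta>)) (exp \<theta> * \<alpha> * exp \<theta>) *
          ennreal (2 * (exp \<theta> * \<alpha>)) * indicator {0<..} (exp \<theta> * \<alpha>)) \<partial>lborel)"
      by (subst nn_integral_cmult) auto
    also have "\<dots> = (\<integral>\<^sup>+\<alpha>. g \<alpha> (\<alpha> * exp (2 * \<theta>)) * ennreal (2 * \<alpha> * exp (2 * \<theta>)) * indicator {0<..} \<alpha> \<partial>lborel)"
    proof (intro nn_integral_cong)
      fix \<alpha> :: real
      have 1: "exp \<theta> * \<alpha> * exp (- \<theta>) = \<alpha>" "exp \<theta> * \<alpha> * exp \<theta> = \<alpha> * exp (2 * \<theta>)"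
        by (simp_all add: exp_minus field_simps flip: exp_add)
      have 2: "indicator {0<..} (exp \<theta> * \<alpha>) = (indicator {0<..} \<alpha> :: ennreal)"
        by (simp add: indicator_def zero_less_mult_iff)
      have 3: "ennreal (exp \<theta>) * ennreal (2 * (exp \<theta> * \<alpha>)) = ennreal (2 * \<alpha> * exp (2 * \<theta>))"
        by (simp only: mult_2 exp_add) (simp add: ennreal_mult'[symmetric] ac_simps)
      show "ennreal (exp \<theta>) * (g (exp \<theta> * \<alpha> * exp (- \<theta>)) (exp \<theta> * \<alpha> * exp \<theta>) *
          ennreal (2 * (exp \<theta> * \<alpha>)) * indicator {0<..} (exp \<theta> * \<alpha>)) =
          g \<alpha> (\<alpha> * exp (2 * \<theta>)) * ennreal (2 * \<alpha> * exp (2 * \<theta>)) * indicator {0<..} \<alpha>"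
        unfolding 1 2 3[symmetric] by (simp only: ac_simps)
    qed
    finally show "(\<integral>\<^sup>+a. g (a * exp (- \<theta>)) (a * exp \<theta>) * ennreal (2 * a) * indicator {0<..} a \<partial>lborel) =
      (\<integral>\<^sup>+\<alpha>. g \<alpha> (\<alpha> * exp (2 * \<theta>)) * ennreal (2 * \<alpha> * exp (2 * \<theta>)) * indicator {0<..} \<alpha> \<partial>lborel)" .
  qed
  also have "\<dots> = (\<integral>\<^sup>+\<alpha>. \<integral>\<^sup>+\<theta>. g \<alpha> (\<alpha> * exp (2 * \<theta>)) * ennreal (2 * \<alpha> * exp (2 * \<theta>)) * indicator {0<..} \<alpha> \<partial>lborel \<partial>lborel)"
    by (rule lborel_pair.Fubini') measurable
  also have "\<dots> = (\<integral>\<^sup>+\<alpha>. \<integral>\<^sup>+\<beta>. g \<alpha> \<beta> * indicator {0<..} \<alpha> * indicator {0<..} \<beta> \<partial>lborel \<partial>lborel)"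
  proof (rule nn_integral_cong)
    fix \<alpha> :: real
    show "(\<integral>\<^sup>+\<theta>. g \<alpha> (\<alpha> * exp (2 * \<theta>)) * ennreal (2 * \<alpha> * exp (2 * \<theta>)) * indicator {0<..} \<alpha> \<partial>lborel) =
        (\<integral>\<^sup>+\<beta>. g \<alpha> \<beta> * indicator {0<..} \<alpha> * indicator {0<..} \<beta> \<partial>lborel)"
    proof (cases "\<alpha> > 0")
      case True
      then show ?thesis
        using nn_integral_exp_substitution[of "g \<alpha>" \<alpha>] by simp
    qed simp
  qed
  finally show ?thesis ..
qed

text \<open>\<open>P\<close> modulo translations acts simply transitively on each cone.\<close>

lemma nn_integral_cone_polar:
  fixes h :: "plane \<Rightarrow> ennreal"
  assumes [measurable]: "h \<in> borel_measurable borel"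
    and ij: "i \<in> {1, 2}" "j \<in> {1, 2}" and x: "x \<in> cone i j"
  shows "(\<integral>\<^sup>+y. h y * indicator (cone i j) y \<partial>lborel) =
    (\<integral>\<^sup>+q. h (orbit x q) * ennreal (fst q * \<bar>minkowski x x\<bar>) * indicator {0<..} (fst q) \<partial>lborel)"
proof -
  define u0 v0 where "u0 = fst x + snd x" and "v0 = fst x - snd x"
  have nz: "u0 \<noteq> 0" "v0 \<noteq> 0" using cone_minkowski[OF ij x] by (auto simp: u0_def v0_def)
  define H where "H y = h y * indicator (cone i j) y" for y
  have [measurable]: "H \<in> borel_measurable borel" unfolding H_def by measurable
  let ?g = "\<lambda>u v. h ((u + v) / 2, (u - v) / 2)"
  let ?G = "\<lambda>u v. H ((u + v) / 2, (u - v) / 2)"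
  have H: "?G (u0 * \<alpha>) (v0 * \<beta>) = ?g (u0 * \<alpha>) (v0 * \<beta>) * indicator {0<..} \<alpha> * indicator {0<..} \<beta>" for \<alpha> \<beta>
    using cone_mem_relative[OF ij x, of \<alpha> \<beta>, OF refl refl]
    by (auto simp: H_def u0_def v0_def indicator_def)
  have "(\<integral>\<^sup>+y. H y \<partial>lborel) = ennreal (1/2) * (\<integral>\<^sup>+u. \<integral>\<^sup>+v. ?G u v \<partial>lborel \<partial>lborel)"
    by (rule nn_integral_light_coordinates) simp
  also have "(\<integral>\<^sup>+u. \<integral>\<^sup>+v. ?G u v \<partial>lborel \<partial>lborel) =
      ennreal \<bar>u0\<bar> * (\<integral>\<^sup>+\<alpha>. \<integral>\<^sup>+v. ?G (u0 * \<alpha>) v \<partial>lborel \<partial>lborel)"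
    using nz by (subst nn_integral_real_affine[where c=u0 and t=0]) auto
  also have "(\<integral>\<^sup>+\<alpha>. \<integral>\<^sup>+v. ?G (u0 * \<alpha>) v \<partial>lborel \<partial>lborel) =
      (\<integral>\<^sup>+\<alpha>. ennreal \<bar>v0\<bar> * (\<integral>\<^sup>+\<beta>. ?G (u0 * \<alpha>) (v0 * \<beta>) \<partial>lborel) \<partial>lborel)"
    using nz by (intro nn_integral_cong, subst nn_integral_real_affine[where c=v0 and t=0]) auto
  also have "\<dots> = ennreal \<bar>v0\<bar> * (\<integral>\<^sup>+\<alpha>. \<integral>\<^sup>+\<beta>. ?G (u0 * \<alpha>) (v0 * \<beta>) \<partial>lborel \<partial>lborel)"
    by (subst nn_integral_cmult) auto
  also have "(\<integral>\<^sup>+\<alpha>. \<integral>\<^sup>+\<beta>. ?G (u0 * \<alpha>) (v0 * \<beta>) \<partial>lborel \<partial>lborel) =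
      (\<integral>\<^sup>+\<theta>. \<integral>\<^sup>+a. ?g (u0 * (a * exp (- \<theta>))) (v0 * (a * exp \<theta>)) * ennreal (2 * a) * indicator {0<..} a \<partial>lborel \<partial>lborel)"
    unfolding H by (rule nn_integral_hyperbolic) (simp add: split_beta', measurable)
  also have "\<dots> = (\<integral>\<^sup>+\<theta>. \<integral>\<^sup>+a. h (orbit x (a, \<theta>)) * ennreal (2 * a) * indicator {0<..} a \<partial>lborel \<partial>lborel)"
    by (simp add: orbit_eq u0_def v0_def mult_ac)
  also have "\<dots> = (\<integral>\<^sup>+q. h (orbit x q) * ennreal (2 * fst q) * indicator {0<..} (fst q) \<partial>lborel)"
    by (subst nn_integral_lborel_pair(2)) auto
  finally have "(\<integral>\<^sup>+y. H y \<partial>lborel) = ennreal (1/2) * (ennreal \<bar>u0\<bar> * (ennreal \<bar>v0\<bar> *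
      (\<integral>\<^sup>+q. h (orbit x q) * ennreal (2 * fst q) * indicator {0<..} (fst q) \<partial>lborel)))" .
  \<comment> \<open>The scale factors multiply to |u0 v0| = |<x;x>|. The 1/2 of the light
    coordinates will cancel the 2 of the hyperbolic Jacobian, which leaves the density a
    |<x;x>|.\<close>
  also have "\<dots> = ennreal (\<bar>minkowski x x\<bar> / 2) *
      (\<integral>\<^sup>+q. h (orbit x q) * ennreal (2 * fst q) * indicator {0<..} (fst q) \<partial>lborel)"
    by (simp add: minkowski_self u0_def v0_def abs_mult ennreal_mult'[symmetric] mult.assoc[symmetric] del: ennreal_half)
  also have "\<dots> = (\<integral>\<^sup>+q. ennreal (\<bar>minkowski x x\<bar> / 2) *
      (h (orbit x q) * ennreal (2 * fst q) * indicator {0<..} (fst q)) \<partial>lborel)"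
    by (subst nn_integral_cmult) auto
  also have "\<dots> = (\<integral>\<^sup>+q. h (orbit x q) * ennreal (fst q * \<bar>minkowski x x\<bar>) * indicator {0<..} (fst q) \<partial>lborel)"
  proof (intro nn_integral_cong)
    fix q :: "real \<times> real"
    have "ennreal (\<bar>minkowski x x\<bar> / 2) * ennreal (2 * fst q) = ennreal (fst q * \<bar>minkowski x x\<bar>)"
      by (subst ennreal_mult'[symmetric]) (simp_all add: mult.commute)
    then show "ennreal (\<bar>minkowski x x\<bar> / 2) * (h (orbit x q) * ennreal (2 * fst q) * indicator {0<..} (fst q)) =
        h (orbit x q) * ennreal (fst q * \<bar>minkowski x x\<bar>) * indicator {0<..} (fst q)"
      by (metis mult.assoc mult.commute)
  qed
  finally show ?thesis by (simp add: H_def)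
qed

section \<open>The representations\<close>

lemma countable_Int_stable_borel_generator:
  obtains C :: "'a::second_countable_topology set set"
  where "countable C" "Int_stable C" "UNIV \<in> C" "sets borel = sigma_sets UNIV C"
proof -
  obtain B :: "'a set set" where B: "countable B" "topological_basis B"
    using ex_countable_basis by blast
  \<comment> \<open>Closing a countable base under finite intersections keeps it countable and makes
    it stable enough for uniqueness of measures; the empty intersection contributes
    \<open>UNIV\<close>.\<close>
  define C where "C = (\<lambda>F. \<Inter>F) ` {F. F \<subseteq> B \<and> finite F}"
  have "countable C"
    unfolding C_def using B(1) countable_Collect_finite_subset[of B]
    by (intro countable_image) (auto simp: conj_commute)
  moreover have "Int_stable C"
  proof (rule Int_stableI)
    fix X Y assume "X \<in> C" "Y \<in> C"
    then obtain F F' where "F \<subseteq> B" "finite F" "X = \<Inter>F" "F' \<subseteq> B" "finite F'" "Y = \<Inter>F'"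
      by (auto simp: C_def)
    then show "X \<inter> Y \<in> C"
      unfolding C_def by (intro image_eqI[of _ _ "F \<union> F'"]) auto
  qed
  moreover have "UNIV \<in> C" unfolding C_def by (intro image_eqI[of _ _ "{}"]) auto
  moreover have "sets borel = sigma_sets UNIV C"
  proof -
    have borel: "sets (borel :: 'a measure) = sigma_sets UNIV B"
      by (simp add: borel_eq_countable_basis[OF B])
    have "C \<subseteq> sigma_sets UNIV B"
    proof
      fix X assume "X \<in> C"
      then obtain F where F: "F \<subseteq> B" "finite F" "X = \<Inter>F" by (auto simp: C_def)
      have "open A" if "A \<in> F" for A using that F(1) B(2) topological_basis_open by blast
      then have "open X" unfolding F(3) by (intro open_Inter F(2)) auto
      then show "X \<in> sigma_sets UNIV B" using borel borel_open by blast
    qed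
    then have "sigma_sets UNIV C \<subseteq> sigma_sets UNIV B" by (rule sigma_sets_mono)
    moreover have "sigma_sets UNIV B \<subseteq> sigma_sets UNIV C"
    proof (rule sigma_sets_mono, rule subsetI)
      fix A assume "A \<in> B"
      then have "A \<in> C" unfolding C_def by (intro image_eqI[of _ _ "{A}"]) auto
      then show "A \<in> sigma_sets UNIV C" by (rule sigma_sets.Basic)
    qed
    ultimately show ?thesis using borel by simp
  qed
  ultimately show ?thesis by (rule that)
qed

text \<open>The positive and negative parts of f are densities of two finite measures that agree on
  an intersection-stable generator, hence everywhere. Uniqueness of densities makes the two parts
  equal almost everywhere, and so both vanish.\<close>

lemma AE_eq_0_of_integral_generator:
  fixes f :: "'a \<Rightarrow> real"
  assumes "sigma_finite_measure M" and f: "integrable M f"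
    and C: "Int_stable C" "space M \<in> C" "sets M = sigma_sets (space M) C"
    and zero: "\<And>A. A \<in> C \<Longrightarrow> (LINT x|M. indicator A x * f x) = 0"
  shows "AE x in M. f x = 0"
proof -
  interpret sigma_finite_measure M by fact
  have [measurable]: "f \<in> borel_measurable M" using f by simp
  have CM: "A \<in> sets M" if "A \<in> C" for A using that C(3) by auto
  \<comment> \<open>Since \<open>ennreal\<close> cuts off negative values, \<open>D 1\<close> and
    \<open>D (-1)\<close> have the positive and the negative part of f as densities.\<close>
  define D where "D s = density M (\<lambda>x. ennreal (s * f x))" for s :: real
  have em: "emeasure (D s) A = (\<integral>\<^sup>+x. ennreal (s * (indicator A x * f x)) \<partial>M)" if "A \<in> sets M" for A s
    using that unfolding D_def
    by (subst emeasure_density) (auto intro!: nn_integral_cong simp: indicator_def)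
  have int: "integrable M (\<lambda>x. indicator A x * f x)" if "A \<in> sets M" for A
    using integrable_mult_indicator[OF that f] by simp
  have fin: "emeasure (D s) A < \<infinity>" if "A \<in> sets M" for A s
  proof -
    have "emeasure (D s) A \<le> (\<integral>\<^sup>+x. ennreal (norm (s * (indicator A x * f x))) \<partial>M)"
      unfolding em[OF that] by (intro nn_integral_mono ennreal_leI) simp
    also have "\<dots> < \<infinity>"
      using integrable_mult_right[OF int[OF that], of s] by (simp only: integrable_iff_bounded)
    finally show ?thesis .
  qed
  have "D 1 = D (-1)"
  proof (rule measure_eqI_generator_eq[where A="\<lambda>_. space M"])
    show "Int_stable C" by fact
    show "C \<subseteq> Pow (space M)" using CM sets.sets_into_space by auto
    show "sets (D 1) = sigma_sets (space M) C" "sets (D (-1)) = sigma_sets (space M) C"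
      using C(3) by (auto simp: D_def)
    fix A assume A: "A \<in> C"
    have "0 = enn2real (emeasure (D 1) A) - enn2real (emeasure (D (-1)) A)"
      using zero[OF A] real_lebesgue_integral_def[OF int[OF CM[OF A]]] by (simp add: em CM A)
    then show "emeasure (D 1) A = emeasure (D (-1)) A"
      using fin[OF CM[OF A]] by (metis diff_eq_diff_eq diff_self ennreal_enn2real less_irrefl infinity_ennreal_def)
  next
    show "emeasure (D 1) (space M) \<noteq> \<infinity>" using fin[of "space M" 1] by auto
  qed (use C in auto)
  then have "AE x in M. ennreal (1 * f x) = ennreal (-1 * f x)"
    unfolding D_def by (intro density_unique) auto
  then show ?thesis
    by eventually_elim (auto simp: ennreal_eq_0_iff, metis ennreal_eq_0_iff ennreal_neg leI less_imp_le neg_le_0_iff_le order_antisym)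
qed

text \<open>The square root of a strictly positive integrable function stands in for the constant 1,
  which is not square integrable on a space of infinite measure. Testing against it loses no
  information, because it vanishes nowhere.\<close>

lemma (in sigma_finite_measure) L2_positive_weight:
  obtains w :: "'a \<Rightarrow> real" where "w \<in> borel_measurable M" "\<And>x. x \<in> space M \<Longrightarrow> 0 < w x"
    "(\<lambda>x. complex_of_real (w x)) \<in> L2 M"
proof -
  obtain h where h: "h \<in> borel_measurable M" "integral\<^sup>N M h \<noteq> \<infinity>"
      "\<And>x. x \<in> space M \<Longrightarrow> 0 < h x" "\<And>x. x \<in> space M \<Longrightarrow> h x < \<infinity>"
    using Ex_finite_integrable_function by auto
  define w where "w x = sqrt (enn2real (h x))" for x
  have meas [measurable]: "w \<in> borel_measurable M" unfolding w_def using h(1) by measurable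
  have pos: "w x > 0" if "x \<in> space M" for x
    using h(3,4)[OF that] by (simp add: w_def enn2real_positive_iff)
  have "(\<integral>\<^sup>+x. ennreal ((norm (complex_of_real (w x)))\<^sup>2) \<partial>M) = integral\<^sup>N M h"
    using h(4) by (intro nn_integral_cong) (simp add: w_def)
  also have "\<dots> = ennreal (enn2real (integral\<^sup>N M h))"
    using h(2) by (simp add: less_top)
  finally have "(\<lambda>x. complex_of_real (w x)) \<in> L2 M"
    by (intro L2_bounded_I(1)[where c="enn2real (integral\<^sup>N M h)"]) auto
  then show ?thesis using that meas pos by blast
qed

text \<open>If a member e of an orthonormal system were orthogonal to every \<open>R A\<close> with
  A in C, then w e would integrate to 0 over a generator and e would be null. So every e pairs
  nontrivially with one of countably many functions, while by Bessel each of these functions pairs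
  nontrivially with only countably many e.\<close>

lemma separable_L2_borel:
  fixes M :: "'a::second_countable_topology measure"
  assumes "sigma_finite_measure M" and sets: "sets M = sets borel"
  shows "separable_L2 M"
proof -
  interpret sigma_finite_measure M by fact
  have space: "space M = UNIV" using sets_eq_imp_space_eq[OF sets] by simp
  obtain C :: "'a set set" where C: "countable C" "Int_stable C" "UNIV \<in> C" "sets borel = sigma_sets UNIV C"
    by (rule countable_Int_stable_borel_generator)
  obtain w where w [measurable]: "w \<in> borel_measurable M" and w_pos: "\<And>x. 0 < w x"
    and w_L2: "(\<lambda>x. complex_of_real (w x)) \<in> L2 M"
    using L2_positive_weight space by auto
  define R where "R A x = complex_of_real (indicator A x * w x)" for A x
  have CM: "A \<in> sets M" if "A \<in> C" for A using that C(4) sets by auto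
  have R: "R A \<in> L2 M" if "A \<in> C" for A
    unfolding R_def of_real_mult
  proof (rule L2_mult_bounded[OF w_L2])
    show "norm (complex_of_real (indicator A x)) \<le> 1" for x by (simp add: indicator_def)
  qed (use CM[OF that] in measurable)
  show ?thesis
  proof
    fix E assume E: "orthonormal M E"
    have "\<exists>A\<in>C. l2_inner M (R A) e \<noteq> 0" if e: "e \<in> E" for e
    proof (rule ccontr)
      assume "\<not> ?thesis"
      then have zero: "l2_inner M (R A) e = 0" if "A \<in> C" for A using that by blast
      have L2: "e \<in> L2 M" using E e by (rule orthonormal_L2)
      define g where "g x = w x * e x" for x
      have "R UNIV x * cnj (e x) = cnj (g x)" for x by (simp add: R_def g_def)
      then have g: "integrable M g"
        using integrable_l2_inner[OF R[OF C(3)] L2] integrable_cnj by (metis (no_types, lifting) ext complex_cnj_cnj)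
      have g0: "(CLINT x|M. indicator A x *\<^sub>R g x) = 0" if "A \<in> C" for A
      proof -
        have "(CLINT x|M. indicator A x *\<^sub>R g x) = (CLINT x|M. cnj (R A x * cnj (e x)))"
          by (intro Bochner_Integration.integral_cong) (auto simp: R_def g_def scaleR_conv_of_real)
        then show ?thesis using zero[OF that] by (simp only: Bochner_Integration.integral_cnj l2_inner_def) simp
      qed
      have ig: "integrable M (\<lambda>x. indicator A x *\<^sub>R g x)" if "A \<in> C" for A
        using integrable_mult_indicator[OF CM[OF that] g] .
      have "AE x in M. Re (g x) = 0"
      proof (rule AE_eq_0_of_integral_generator[OF \<open>sigma_finite_measure M\<close>])
        fix A assume A: "A \<in> C"
        show "(LINT x|M. indicator A x * Re (g x)) = 0"
          using integral_Re[OF ig[OF A]] g0[OF A] by simp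
      qed (use C sets space g in auto)
      moreover have "AE x in M. Im (g x) = 0"
      proof (rule AE_eq_0_of_integral_generator[OF \<open>sigma_finite_measure M\<close>])
        fix A assume A: "A \<in> C"
        show "(LINT x|M. indicator A x * Im (g x)) = 0"
          using integral_Im[OF ig[OF A]] g0[OF A] by simp
      qed (use C sets space g in auto)
      ultimately have "AE x in M. e x = 0"
      proof eventually_elim
        case (elim x)
        then have "g x = 0" by (simp add: complex_eq_iff)
        then show ?case using w_pos[of x] by (simp add: g_def)
      qed
      then have "l2_norm M e = 0" using L2 by (simp add: l2_norm_eq_0_iff)
      then show False using orthonormal_norm[OF E e] by simp
    qed
    then have "E = (\<Union>A\<in>C. {e\<in>E. (norm (l2_inner M (R A) e))\<^sup>2 \<noteq> 0})" by auto
    also have "countable \<dots>"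
      using C(1) by (intro countable_UN summable_countable_real bessel_summable[OF E] R) auto
    finally show "countable E" .
  qed
qed

lemma borel_measurable_restrict_extend:
  fixes f :: "'a \<Rightarrow> 'b::real_normed_vector"
  assumes "f \<in> borel_measurable (restrict_space M \<Omega>)" "\<Omega> \<in> sets M"
  shows "(\<lambda>x. indicator \<Omega> x *\<^sub>R f x) \<in> borel_measurable M"
  using assms by (subst (asm) borel_measurable_restrict_space_iff) auto

text \<open>Extension by zero preserves inner products, so it sends orthonormal systems on the
  subset injectively to orthonormal systems on the whole space.\<close>

lemma separable_L2_restrict_space:
  assumes "separable_L2 M" and \<Omega>: "\<Omega> \<in> sets M"
  shows "separable_L2 (restrict_space M \<Omega>)"
proof -
  interpret separable_L2 M by fact
  interpret R: sigma_finite_measure "restrict_space M \<Omega>"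
    using \<Omega> by (intro sigma_finite_measure_restrict_space) unfold_locales
  define ext where "ext f x = indicator \<Omega> x *\<^sub>R f x" for f :: "'a \<Rightarrow> complex" and x
  show ?thesis
  proof
    fix E assume E: "orthonormal (restrict_space M \<Omega>) E"
    have inner: "l2_inner M (ext f) (ext g) = l2_inner (restrict_space M \<Omega>) f g" for f g
      unfolding l2_inner_def ext_def using \<Omega>
      by (subst integral_restrict_space) (auto intro!: Bochner_Integration.integral_cong simp: indicator_def)
    have L2: "ext f \<in> L2 M" if "f \<in> L2 (restrict_space M \<Omega>)" for f
    proof (rule L2_I)
      show "ext f \<in> borel_measurable M"
        unfolding ext_def using that \<Omega> by (intro borel_measurable_restrict_extend) (auto intro: L2_measurable)
      have "integrable M (\<lambda>x. indicator \<Omega> x *\<^sub>R (norm (f x))\<^sup>2)"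
        using L2_integrable[OF that] \<Omega> by (subst (asm) integrable_restrict_space) auto
      then show "integrable M (\<lambda>x. (norm (ext f x))\<^sup>2)"
        by (rule Bochner_Integration.integrable_cong[THEN iffD1, rotated -1])
          (auto simp: ext_def indicator_def)
    qed
    \<comment> \<open>Members of E are total functions and \<open>ext\<close> forgets their values
      outside \<Omega>. Injectivity therefore comes from orthonormality: equal extensions force the
      inner product 1.\<close>
    have inj: "inj_on ext E"
    proof
      fix e e' assume e: "e \<in> E" "e' \<in> E" "ext e = ext e'"
      have "l2_inner (restrict_space M \<Omega>) e e' = l2_inner (restrict_space M \<Omega>) e e"
        using e(3) inner by metis
      then show "e = e'" using E e by (auto simp: orthonormal_def split: if_splits)
    qed
    have "orthonormal M (ext ` E)"
      using E inj L2 by (auto simp: orthonormal_def inner inj_on_def)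
    then have "countable (ext ` E)" by (rule countable_orthonormal)
    then show "countable E" using inj by (rule countable_image_inj_on)
  qed
qed

section \<open>A single cone: invariant measure and unitarity of the representation\<close>

locale cone_space =
  fixes i j :: nat
  assumes i_mem: "i \<in> {1, 2}" and j_mem: "j \<in> {1, 2}"
begin

abbreviation M :: "plane measure" where "M \<equiv> cone_measure i j"

sublocale separable_L2 M
  unfolding cone_measure_def
  by (intro separable_L2_restrict_space separable_L2_borel) (auto intro: sigma_finite_lborel)

lemma space_M: "space M = cone i j"
  by (simp add: cone_measure_def space_restrict_space)

lemma sets_M: "sets M = sets (restrict_space borel (cone i j))"
  unfolding cone_measure_def by (rule sets_restrict_space_cong) simp

lemma measurable_borel_M: "f \<in> borel_measurable borel \<Longrightarrow> f \<in> borel_measurable M"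
  unfolding cone_measure_def by (rule measurable_restrict_space1) simp

lemma M_extend:
  fixes f :: "plane \<Rightarrow> 'b::real_normed_vector"
  shows "f \<in> borel_measurable M \<Longrightarrow> (\<lambda>x. indicator (cone i j) x *\<^sub>R f x) \<in> borel_measurable borel"
  using borel_measurable_restrict_extend[of f lborel "cone i j"] by (simp add: cone_measure_def)

lemma nn_integral_M: "(\<integral>\<^sup>+x. h x \<partial>M) = (\<integral>\<^sup>+x. h x * indicator (cone i j) x \<partial>lborel)"
  unfolding cone_measure_def by (subst nn_integral_restrict_space) auto

lemma integral_M:
  fixes h :: "plane \<Rightarrow> 'b::{banach, second_countable_topology}"
  shows "(LINT x|M. h x) = (LINT x|lborel. indicator (cone i j) x *\<^sub>R h x)"
  unfolding cone_measure_def by (subst integral_restrict_space) auto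

lemma orbit_measurable_M:
  assumes "0 < a"
  shows "(\<lambda>x. orbit x (a, \<theta>)) \<in> measurable M M"
  unfolding cone_measure_def
proof (rule measurable_restrict_space3)
  show "(\<lambda>x. orbit x (a, \<theta>)) \<in> cone i j \<rightarrow> cone i j"
    using orbit_in_cone_iff[OF i_mem j_mem assms] by auto
qed measurable

text \<open>As an identity of measures the change of variables yields both the nonnegative and the
  complex integral formula.\<close>

lemma distr_orbit:
  assumes a: "0 < a"
  shows "distr M M (\<lambda>x. orbit x (a, \<theta>)) = density M (\<lambda>_. ennreal (1 / a\<^sup>2))"
proof (rule measure_eqI)
  fix A assume "A \<in> sets (distr M M (\<lambda>x. orbit x (a, \<theta>)))"
  then have A: "A \<in> sets M" by simp
  then have [measurable]: "A \<in> sets borel" and sub: "A \<subseteq> cone i j"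
    by (auto simp: sets_M sets_restrict_space_iff)
  have "emeasure (distr M M (\<lambda>x. orbit x (a, \<theta>))) A = (\<integral>\<^sup>+y. indicator A y \<partial>distr M M (\<lambda>x. orbit x (a, \<theta>)))"
    using A by simp
  also have "\<dots> = (\<integral>\<^sup>+x. indicator A (orbit x (a, \<theta>)) \<partial>M)"
    using A by (intro nn_integral_distr orbit_measurable_M a) auto
  also have "\<dots> = (\<integral>\<^sup>+x. indicator A (orbit x (a, \<theta>)) \<partial>lborel)"
    unfolding nn_integral_M
  proof (rule nn_integral_cong)
    fix x
    have "orbit x (a, \<theta>) \<in> A \<Longrightarrow> x \<in> cone i j"
      using sub orbit_in_cone_iff[OF i_mem j_mem a, of x \<theta>] by blast
    then show "indicator A (orbit x (a, \<theta>)) * indicator (cone i j) x = (indicator A (orbit x (a, \<theta>)) :: ennreal)"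
      by (auto simp: indicator_def)
  qed
  also have "\<dots> = ennreal (1 / a\<^sup>2) * (\<integral>\<^sup>+x. indicator A x \<partial>lborel)"
    using a by (intro nn_integral_orbit) auto
  also have "(\<integral>\<^sup>+x. indicator A x \<partial>lborel) = (\<integral>\<^sup>+x. indicator A x \<partial>M)"
    unfolding nn_integral_M using sub by (intro nn_integral_cong) (auto simp: indicator_def)
  also have "ennreal (1 / a\<^sup>2) * (\<integral>\<^sup>+x. indicator A x \<partial>M) = emeasure (density M (\<lambda>_. ennreal (1 / a\<^sup>2))) A"
    using A by (simp add: emeasure_density_const)
  finally show "emeasure (distr M M (\<lambda>x. orbit x (a, \<theta>))) A = emeasure (density M (\<lambda>_. ennreal (1 / a\<^sup>2))) A" .
qed simp

lemma nn_integral_M_orbit: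
  assumes a: "0 < a" and [measurable]: "h \<in> borel_measurable M"
  shows "(\<integral>\<^sup>+x. h (orbit x (a, \<theta>)) \<partial>M) = ennreal (1 / a\<^sup>2) * (\<integral>\<^sup>+x. h x \<partial>M)"
proof -
  have "(\<integral>\<^sup>+x. h (orbit x (a, \<theta>)) \<partial>M) = (\<integral>\<^sup>+y. h y \<partial>distr M M (\<lambda>x. orbit x (a, \<theta>)))"
    by (subst nn_integral_distr) (auto intro: orbit_measurable_M a)
  then show ?thesis
    by (simp add: distr_orbit[OF a] nn_integral_density nn_integral_cmult)
qed

lemma integral_M_orbit:
  fixes h :: "plane \<Rightarrow> complex"
  assumes a: "0 < a" and [measurable]: "h \<in> borel_measurable M"
  shows "(LINT x|M. h (orbit x (a, \<theta>))) = (LINT x|M. h x) / of_real (a\<^sup>2)"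
proof -
  have "(LINT x|M. h (orbit x (a, \<theta>))) = (LINT y|distr M M (\<lambda>x. orbit x (a, \<theta>)). h y)"
    by (subst integral_distr) (auto intro: orbit_measurable_M a)
  then show ?thesis
    by (simp add: distr_orbit[OF a] integral_density scaleR_conv_of_real)
qed

lemma orbit_inverse:
  assumes "0 < a"
  shows "orbit (orbit x (a, \<theta>)) (1 / a, - \<theta>) = x"
  by (rule plane_eqI) (use assms in \<open>simp_all add: orbit_light_coordinates exp_minus field_simps\<close>)

text \<open>This is \<open>irrep\<close> at the inverse group element; Lorentz invariance of the
  Minkowski form was used to leave b unchanged and to transform x instead. It is the explicit
  witness for the choice in \<open>adjoint_op\<close>.\<close>

definition irrep_adjoint :: "affine_poincare \<Rightarrow> plane operator" where
  "irrep_adjoint = (\<lambda>(b, a, \<theta>) \<phi> x. of_real (1 / a) *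
     exp (- \<i> * of_real (minkowski (orbit x (1 / a, - \<theta>)) b)) * \<phi> (orbit x (1 / a, - \<theta>)))"

lemma irrep_orbit: "irrep (b, a, \<theta>) \<phi> x =
    of_real a * exp (\<i> * of_real (minkowski x b)) * \<phi> (orbit x (a, \<theta>))"
  by (simp add: irrep_def orbit_def)

text \<open>The modulus a of the prefactor, once squared, cancels the factor by which the dilation
  scales the measure. The phase is left free so that \<open>irrep\<close> and
  \<open>irrep_adjoint\<close> are both instances.\<close>

lemma L2_comp_orbit:
  assumes a: "0 < a" and \<phi>: "\<phi> \<in> L2 M" and c: "c \<in> borel_measurable M" "\<And>x. norm (c x) = a"
  shows "(\<lambda>x. c x * \<phi> (orbit x (a, \<theta>))) \<in> L2 M"
    and l2_norm_comp_orbit: "l2_norm M (\<lambda>x. c x * \<phi> (orbit x (a, \<theta>))) = l2_norm M \<phi>"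
proof -
  let ?g = "\<lambda>x. c x * \<phi> (orbit x (a, \<theta>))"
  have [measurable]: "\<phi> \<in> borel_measurable M" using \<phi> by (rule L2_measurable)
  have meas: "?g \<in> borel_measurable M"
    using c(1) measurable_compose[OF orbit_measurable_M[OF a] \<open>\<phi> \<in> borel_measurable M\<close>] by (intro borel_measurable_times) auto
  have "(\<integral>\<^sup>+x. ennreal ((norm (?g x))\<^sup>2) \<partial>M) = (\<integral>\<^sup>+x. ennreal (a\<^sup>2 * (norm (\<phi> (orbit x (a, \<theta>))))\<^sup>2) \<partial>M)"
    by (simp add: norm_mult power_mult_distrib c(2))
  also have "\<dots> = ennreal (1 / a\<^sup>2) * (\<integral>\<^sup>+x. ennreal (a\<^sup>2 * (norm (\<phi> x))\<^sup>2) \<partial>M)"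
    by (rule nn_integral_M_orbit[OF a]) measurable
  also have "\<dots> = (\<integral>\<^sup>+x. ennreal ((norm (\<phi> x))\<^sup>2) \<partial>M)"
    using a by (subst nn_integral_cmult[symmetric])
      (auto simp: ennreal_mult'[symmetric] intro!: nn_integral_cong)
  also have "\<dots> = ennreal ((l2_norm M \<phi>)\<^sup>2)" by (rule nn_integral_L2[OF \<phi>])
  finally have eq: "(\<integral>\<^sup>+x. ennreal ((norm (?g x))\<^sup>2) \<partial>M) = ennreal ((l2_norm M \<phi>)\<^sup>2)" .
  show L2: "?g \<in> L2 M" using eq by (intro L2_bounded_I(1)[OF meas]) auto
  show "l2_norm M ?g = l2_norm M \<phi>"
    using eq unfolding nn_integral_L2[OF L2] by (simp add: power2_eq_iff_nonneg)
qed

lemma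
  assumes "0 < a" "\<phi> \<in> L2 M"
  shows irrep_L2: "irrep (b, a, \<theta>) \<phi> \<in> L2 M"
    and l2_norm_irrep: "l2_norm M (irrep (b, a, \<theta>) \<phi>) = l2_norm M \<phi>"
proof -
  have meas: "(\<lambda>x. of_real a * exp (\<i> * of_real (minkowski x b))) \<in> borel_measurable M"
    by (rule measurable_borel_M) measurable
  have eq: "irrep (b, a, \<theta>) \<phi> = (\<lambda>x. of_real a * exp (\<i> * of_real (minkowski x b)) * \<phi> (orbit x (a, \<theta>)))"
    by (auto simp: irrep_orbit)
  show "irrep (b, a, \<theta>) \<phi> \<in> L2 M" "l2_norm M (irrep (b, a, \<theta>) \<phi>) = l2_norm M \<phi>"
    unfolding eq using assms
    by (intro L2_comp_orbit l2_norm_comp_orbit meas; simp add: norm_mult norm_divide)+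
qed

lemma
  assumes "0 < a" "\<phi> \<in> L2 M"
  shows irrep_adjoint_L2: "irrep_adjoint (b, a, \<theta>) \<phi> \<in> L2 M"
    and l2_norm_irrep_adjoint: "l2_norm M (irrep_adjoint (b, a, \<theta>) \<phi>) = l2_norm M \<phi>"
proof -
  have meas: "(\<lambda>x. of_real (1 / a) * exp (- \<i> * of_real (minkowski (orbit x (1 / a, - \<theta>)) b))) \<in> borel_measurable M"
    by (rule measurable_borel_M) measurable
  have eq: "irrep_adjoint (b, a, \<theta>) \<phi> = (\<lambda>x. of_real (1 / a) *
      exp (- \<i> * of_real (minkowski (orbit x (1 / a, - \<theta>)) b)) * \<phi> (orbit x (1 / a, - \<theta>)))"
    by (auto simp: irrep_adjoint_def)
  show "irrep_adjoint (b, a, \<theta>) \<phi> \<in> L2 M" "l2_norm M (irrep_adjoint (b, a, \<theta>) \<phi>) = l2_norm M \<phi>"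
    unfolding eq using assms
    by (intro L2_comp_orbit l2_norm_comp_orbit meas; simp add: norm_mult norm_divide)+
qed

lemma l2_inner_irrep:
  assumes a: "0 < a" and f: "f \<in> L2 M" and g: "g \<in> L2 M"
  shows "l2_inner M (irrep (b, a, \<theta>) f) g = l2_inner M f (irrep_adjoint (b, a, \<theta>) g)"
proof -
  \<comment> \<open>The factor \<open>a\<^sup>2\<close> anticipates the division by
    \<open>a\<^sup>2\<close> in the change of variables: one power replaces the 1/a of the adjoint,
    the other is the prefactor of \<open>irrep\<close>.\<close>
  define H where "H y = of_real (a\<^sup>2) * (f y * cnj (irrep_adjoint (b, a, \<theta>) g y))" for y
  have "H \<in> borel_measurable M"
    using L2_measurable[OF f] L2_measurable[OF irrep_adjoint_L2[OF a g, of b \<theta>]]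
    unfolding H_def by measurable
  have "irrep (b, a, \<theta>) f x * cnj (g x) = H (orbit x (a, \<theta>))" for x
    using a unfolding H_def irrep_adjoint_def irrep_orbit prod.case orbit_inverse[OF a]
    by (simp add: exp_cnj power2_eq_square)
  then have "l2_inner M (irrep (b, a, \<theta>) f) g = (LINT x|M. H (orbit x (a, \<theta>)))"
    by (simp add: l2_inner_def)
  also have "\<dots> = (LINT x|M. H x) / of_real (a\<^sup>2)"
    by (rule integral_M_orbit) fact+
  also have "\<dots> = l2_inner M f (irrep_adjoint (b, a, \<theta>) g)"
    using a by (simp add: H_def l2_inner_def)
  finally show ?thesis .
qed

text \<open>The explicit adjoint shows that the choice in \<open>adjoint_op\<close> is not vacuous.
  From here on only the two chosen properties, boundedness and the adjoint relation, are
  used.\<close>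

lemma
  assumes p: "p \<in> P"
  shows bounded_operator_adjoint_irrep: "bounded_operator M (adjoint_op M (irrep p))"
    and l2_inner_adjoint_irrep: "\<And>f g. f \<in> L2 M \<Longrightarrow> g \<in> L2 M \<Longrightarrow>
      l2_inner M (irrep p f) g = l2_inner M f (adjoint_op M (irrep p) g)"
proof -
  obtain b a \<theta> where p_eq: "p = (b, a, \<theta>)" and a: "0 < a" using p by (auto simp: P_def)
  have "bounded_operator M (irrep_adjoint p)"
    unfolding bounded_operator_def p_eq using a
    by (auto intro!: irrep_adjoint_L2 exI[of _ 1] simp: l2_norm_irrep_adjoint)
      (auto simp: irrep_adjoint_def distrib_left add_divide_distrib mult_ac)
  then have "\<exists>B. bounded_operator M B \<and>
     (\<forall>f \<in> L2 M. \<forall>g \<in> L2 M. l2_inner M (irrep p f) g = l2_inner M f (B g))"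
    using l2_inner_irrep[OF a] unfolding p_eq by blast
  from someI_ex[OF this] show "bounded_operator M (adjoint_op M (irrep p))"
    "\<And>f g. f \<in> L2 M \<Longrightarrow> g \<in> L2 M \<Longrightarrow>
      l2_inner M (irrep p f) g = l2_inner M f (adjoint_op M (irrep p) g)"
    unfolding adjoint_op_def by auto
qed

text \<open>Polar coordinates as an equality of measures, so that they apply to complex integrands
  as well as to nonnegative ones.\<close>

lemma distr_cone_polar:
  assumes x: "x \<in> cone i j"
  shows "distr (density lborel (\<lambda>q. ennreal (fst q * \<bar>minkowski x x\<bar>) * indicator {0<..} (fst q))) borel (orbit x)
    = density lborel (indicator (cone i j))"
proof (rule measure_eqI)
  fix A assume "A \<in> sets (distr (density lborel (\<lambda>q. ennreal (fst q * \<bar>minkowski x x\<bar>) * indicator {0<..} (fst q))) borel (orbit x))"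
  then have [measurable]: "A \<in> sets borel" by simp
  have "emeasure (distr D borel (orbit x)) A = (\<integral>\<^sup>+y. indicator A y \<partial>distr D borel (orbit x))" for D
    by simp
  then have "emeasure (distr (density lborel (\<lambda>q. ennreal (fst q * \<bar>minkowski x x\<bar>) * indicator {0<..} (fst q))) borel (orbit x)) A
      = (\<integral>\<^sup>+q. ennreal (fst q * \<bar>minkowski x x\<bar>) * indicator {0<..} (fst q) * indicator A (orbit x q) \<partial>lborel)"
    by (simp add: nn_integral_distr nn_integral_density del: nn_integral_indicator)
  also have "\<dots> = (\<integral>\<^sup>+y. indicator A y * indicator (cone i j) y \<partial>lborel)"
    using nn_integral_cone_polar[OF _ i_mem j_mem x, of "indicator A"] by (simp add: mult_ac)
  also have "\<dots> = emeasure (density lborel (indicator (cone i j))) A"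
    by (simp add: emeasure_density mult.commute)
  finally show "emeasure (distr (density lborel (\<lambda>q. ennreal (fst q * \<bar>minkowski x x\<bar>) * indicator {0<..} (fst q))) borel (orbit x)) A
      = emeasure (density lborel (indicator (cone i j))) A" .
qed simp

lemma integral_cone_polar:
  fixes h :: "plane \<Rightarrow> complex"
  assumes x: "x \<in> cone i j" and [measurable]: "h \<in> borel_measurable borel"
  shows "(LINT y|M. h y) =
      (LINT q|lborel. (fst q * \<bar>minkowski x x\<bar> * indicator {0<..} (fst q)) *\<^sub>R h (orbit x q))"
proof -
  let ?w = "\<lambda>q. fst q * \<bar>minkowski x x\<bar> * indicator {0<..} (fst q) :: real"
  have w: "(\<lambda>q. ennreal (fst q * \<bar>minkowski x x\<bar>) * indicator {0<..} (fst q)) = (\<lambda>q. ennreal (?w q))"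
    by (auto simp: indicator_def)
  have ind: "(indicator (cone i j) :: plane \<Rightarrow> ennreal) = (\<lambda>y. ennreal (indicator (cone i j) y))"
    by (auto simp: indicator_def)
  have "(LINT y|M. h y) = (LINT y|density lborel (indicator (cone i j)). h y)"
    unfolding integral_M ind by (subst integral_density) auto
  also have "\<dots> = (LINT q|density lborel (\<lambda>q. ennreal (?w q)). h (orbit x q))"
    unfolding distr_cone_polar[OF x, symmetric] w by (subst integral_distr) auto
  also have "\<dots> = (LINT q|lborel. ?w q *\<^sub>R h (orbit x q))"
    by (subst integral_density) (auto simp: indicator_def)
  finally show ?thesis .
qed

end

section \<open>The Plancherel inequality\<close>

lemma
  fixes u :: "'a::euclidean_space \<Rightarrow> 'c::{real_normed_field, banach, second_countable_topology}"
    and v :: "'b::euclidean_space \<Rightarrow> 'c"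
  assumes u: "integrable lborel u" and v: "integrable lborel v"
  shows integrable_lborel_prod: "integrable lborel (\<lambda>z. u (fst z) * v (snd z))"
    and integral_lborel_prod: "(\<integral>z. u (fst z) * v (snd z) \<partial>lborel) = (\<integral>a. u a \<partial>lborel) * (\<integral>b. v b \<partial>lborel)"
proof -
  have [measurable]: "u \<in> borel_measurable borel" "v \<in> borel_measurable borel" using u v by auto
  have int: "integrable (lborel \<Otimes>\<^sub>M lborel) (\<lambda>z. u (fst z) * v (snd z))"
  proof (rule lborel_pair.Fubini_integrable)
    have "integrable lborel (\<lambda>a. norm (u a) * (\<integral>b. norm (v b) \<partial>lborel))"
      using u by (intro integrable_mult_left integrable_norm) auto
    then show "integrable lborel (\<lambda>a. \<integral>b. norm (u (fst (a, b)) * v (snd (a, b))) \<partial>lborel)"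
      by (simp add: norm_mult)
  qed (use v in \<open>auto intro: integrable_mult_right\<close>)
  then show "integrable lborel (\<lambda>z. u (fst z) * v (snd z))" by (simp add: lborel_prod)
  show "(\<integral>z. u (fst z) * v (snd z) \<partial>lborel) = (\<integral>a. u a \<partial>lborel) * (\<integral>b. v b \<partial>lborel)"
    using lborel_pair.integral_fst'[OF int] by (simp add: lborel_prod)
qed

lemma integrable_std_normal_scaled:
  assumes "0 < n" shows "integrable lborel (\<lambda>x. std_normal_density (x / n))"
  using lborel_integrable_real_affine[of std_normal_density "1 / n" 0] assms
  by (simp add: integrable_normal_density)

text \<open>The integral is the characteristic function of the standard normal distribution after
  the rescaling x = n x', which contributes n; the value exp(-s^2/2) is rewritten as sqrt(2 pi)
  times the density at s = n t.\<close>

lemma integral_gauss_exp: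
  assumes n: "0 < n"
  shows "(CLINT x|lborel. of_real (std_normal_density (x / n)) * exp (\<i> * of_real (t * x))) =
    of_real (n * sqrt (2 * pi) * std_normal_density (n * t))"
proof -
  have "(CLINT x|lborel. of_real (std_normal_density x) * exp (\<i> * of_real (s * x))) =
      of_real (exp (- s\<^sup>2 / 2))" for s
  proof -
    have "char std_normal_distribution s = (CLINT x|lborel. std_normal_density x *\<^sub>R exp (\<i> * of_real (s * x)))"
      unfolding char_def by (subst integral_density) (auto simp: normal_density_nonneg)
    then show ?thesis by (simp add: char_std_normal_distribution scaleR_conv_of_real)
  qed
  from this[of "n * t"]
  have "(CLINT x|lborel. of_real (std_normal_density x) * exp (\<i> * of_real (n * t * x))) =
      of_real (sqrt (2 * pi) * std_normal_density (n * t))"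
    by (simp add: std_normal_density_def)
  moreover have "(CLINT x|lborel. of_real (std_normal_density (x / n)) * exp (\<i> * of_real (t * x))) =
      \<bar>n\<bar> *\<^sub>R (CLINT x|lborel. of_real (std_normal_density x) * exp (\<i> * of_real (n * t * x)))"
    using n by (subst lborel_integral_real_affine[where c=n and t=0]) (auto simp: mult_ac)
  ultimately show ?thesis using n by (simp add: scaleR_conv_of_real mult.assoc)
qed

text \<open>A summability weight: as n grows it tends pointwise to the constant 1/(2 pi), its value
  at the origin for every n.\<close>

definition gauss :: "real \<Rightarrow> plane \<Rightarrow> real" where
  "gauss n x = std_normal_density (fst x / n) * std_normal_density (snd x / n)"

text \<open>The Fourier transform of \<open>gauss n\<close> for the Minkowski form. It equals 2 pi
  times the centred Gaussian density with standard deviation 1/n in each coordinate.\<close>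

definition heat :: "real \<Rightarrow> plane \<Rightarrow> real" where
  "heat n c = 2 * pi * n\<^sup>2 * (std_normal_density (n * fst c) * std_normal_density (n * snd c))"

lemma gauss_nonneg [simp]: "0 \<le> gauss n x"
  by (simp add: gauss_def normal_density_nonneg)

lemma heat_nonneg [simp]: "0 \<le> heat n x"
  by (simp add: heat_def normal_density_nonneg)

lemma gauss_measurable [measurable]: "gauss n \<in> borel_measurable borel"
  unfolding gauss_def by measurable

lemma heat_measurable [measurable]: "heat n \<in> borel_measurable borel"
  unfolding heat_def by measurable

lemma heat_uminus: "heat n (c - d) = heat n (d - c)"
  unfolding heat_def std_normal_density_def
  by (simp add: power2_commute power_mult_distrib)

lemma integrable_gauss: "0 < n \<Longrightarrow> integrable lborel (gauss n)"
  unfolding gauss_def by (intro integrable_lborel_prod integrable_std_normal_scaled)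

text \<open>The integral factors over the coordinates. The sign in the Minkowski form only negates
  the second frequency, and the Gaussian is even.\<close>

lemma integral_gauss_minkowski:
  assumes n: "0 < n"
  shows "(CLINT x|lborel. of_real (gauss n x) * exp (\<i> * of_real (minkowski x c))) = of_real (heat n c)"
proof -
  let ?e = "\<lambda>t x. of_real (std_normal_density (x / n)) * exp (\<i> * of_real (t * x))"
  have int: "integrable lborel (?e t)" for t
    using integrable_std_normal_scaled[OF n]
    by (rule Bochner_Integration.integrable_bound) (auto simp: norm_mult)
  have "(CLINT x|lborel. of_real (gauss n x) * exp (\<i> * of_real (minkowski x c))) =
      (CLINT x|lborel. ?e (fst c) (fst x) * ?e (- snd c) (snd x))"
    by (intro Bochner_Integration.integral_cong)
      (auto simp: gauss_def minkowski_def algebra_simps exp_diff exp_minus divide_inverse)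
  also have "\<dots> = (CLINT x|lborel. ?e (fst c) x) * (CLINT x|lborel. ?e (- snd c) x)"
    by (rule integral_lborel_prod[OF int int])
  also have "\<dots> = of_real (heat n c)"
    unfolding integral_gauss_exp[OF n] of_real_mult[symmetric]
    by (simp add: heat_def std_normal_density_def power2_eq_square)
  finally show ?thesis .
qed

lemma nn_integral_heat:
  assumes n: "0 < n"
  shows "(\<integral>\<^sup>+c. ennreal (heat n c) \<partial>lborel) = ennreal (2 * pi)"
proof -
  let ?f = "\<lambda>t. std_normal_density (n * t)"
  have int: "integrable lborel ?f"
    using lborel_integrable_real_affine[of std_normal_density n 0] n by (simp add: integrable_normal_density)
  have I: "(\<integral>t. ?f t \<partial>lborel) = 1 / n"
    using lborel_integral_real_affine[of n std_normal_density 0] n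
    by (simp add: integral_normal_density field_simps)
  have "(\<integral>\<^sup>+c. ennreal (heat n c) \<partial>lborel) = ennreal (\<integral>c. heat n c \<partial>lborel)"
    unfolding heat_def
    by (intro nn_integral_eq_integral integrable_mult_right integrable_lborel_prod int)
      (simp add: normal_density_nonneg)
  also have "(\<integral>c. heat n c \<partial>lborel) = 2 * pi * n\<^sup>2 * ((\<integral>t. ?f t \<partial>lborel) * (\<integral>t. ?f t \<partial>lborel))"
    unfolding heat_def by (simp add: integral_lborel_prod[OF int int])
  also have "\<dots> = 2 * pi" unfolding I using n by (simp add: power2_eq_square)
  finally show ?thesis .
qed

lemma nn_integral_lborel_diff:
  fixes h :: "'a::euclidean_space \<Rightarrow> ennreal"
  assumes [measurable]: "h \<in> borel_measurable borel"
  shows "(\<integral>\<^sup>+x. h (x - c) \<partial>lborel) = (\<integral>\<^sup>+x. h x \<partial>lborel)"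
proof -
  have "(\<integral>\<^sup>+x. h x \<partial>lborel) = (\<integral>\<^sup>+x. h x \<partial>distr lborel borel ((+) (- c)))"
    by (simp only: lborel_distr_plus)
  then show ?thesis by (simp add: nn_integral_distr)
qed

text \<open>Schur's test: the heat kernel is symmetric and has constant mass in each variable.\<close>

lemma nn_integral_heat_convolution_le:
  fixes f :: "plane \<Rightarrow> complex"
  assumes [measurable]: "f \<in> borel_measurable borel" and n: "0 < n"
  shows "(\<integral>\<^sup>+z. ennreal (norm (f (fst z)) * norm (f (snd z)) * heat n (fst z - snd z)) \<partial>lborel)
    \<le> ennreal (2 * pi) * (\<integral>\<^sup>+b. ennreal ((norm (f b))\<^sup>2) \<partial>lborel)"
proof -
  let ?F = "\<lambda>b. ennreal ((norm (f b))\<^sup>2)"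
  let ?I = "\<integral>\<^sup>+b. ?F b \<partial>lborel"
  have "(\<integral>\<^sup>+z. ennreal (norm (f (fst z)) * norm (f (snd z)) * heat n (fst z - snd z)) \<partial>lborel) \<le>
      (\<integral>\<^sup>+z. ennreal (1/2) * (?F (fst z) * ennreal (heat n (snd z - fst z))) +
        ennreal (1/2) * (?F (snd z) * ennreal (heat n (fst z - snd z))) \<partial>lborel)"
  proof (rule nn_integral_mono)
    fix z :: "plane \<times> plane"
    let ?a = "norm (f (fst z))" and ?b = "norm (f (snd z))" and ?h = "heat n (fst z - snd z)"
    have "?a * ?b * ?h \<le> 1/2 * (?a\<^sup>2 * ?h) + 1/2 * (?b\<^sup>2 * ?h)"
      using mult_right_mono[OF sum_squares_bound[of ?a ?b] heat_nonneg[of n "fst z - snd z"]]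
      by (simp add: algebra_simps)
    then have "ennreal (?a * ?b * ?h) \<le> ennreal (1/2 * (?a\<^sup>2 * ?h) + 1/2 * (?b\<^sup>2 * ?h))"
      by (rule ennreal_leI)
    also have "\<dots> = ennreal (1/2) * (?F (fst z) * ennreal ?h) + ennreal (1/2) * (?F (snd z) * ennreal ?h)"
    proof -
      have half: "0 \<le> (1/2 :: real)" by simp
      have "ennreal (1/2 * (s * h)) = ennreal (1/2) * (ennreal s * ennreal h)" if "0 \<le> s" for s h
        by (simp only: ennreal_mult'[OF half] ennreal_mult'[OF that])
      then show ?thesis by (subst ennreal_plus) simp_all
    qed
    finally show "ennreal (?a * ?b * ?h) \<le> ennreal (1/2) * (?F (fst z) * ennreal (heat n (snd z - fst z))) +
        ennreal (1/2) * (?F (snd z) * ennreal ?h)"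
      by (simp only: heat_uminus[of n "snd z"])
  qed
  also have "\<dots> = ennreal (1/2) * (\<integral>\<^sup>+z. ?F (fst z) * ennreal (heat n (snd z - fst z)) \<partial>lborel) +
      ennreal (1/2) * (\<integral>\<^sup>+z. ?F (snd z) * ennreal (heat n (fst z - snd z)) \<partial>lborel)"
    by (subst nn_integral_add) (auto simp: nn_integral_cmult)
  also have "(\<integral>\<^sup>+z. ?F (fst z) * ennreal (heat n (snd z - fst z)) \<partial>lborel) =
      (\<integral>\<^sup>+b. \<integral>\<^sup>+c. ?F b * ennreal (heat n (c - b)) \<partial>lborel \<partial>lborel)"
    by (subst nn_integral_lborel_pair(1)) auto
  also have "(\<integral>\<^sup>+z. ?F (snd z) * ennreal (heat n (fst z - snd z)) \<partial>lborel) =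
      (\<integral>\<^sup>+b. \<integral>\<^sup>+c. ?F b * ennreal (heat n (c - b)) \<partial>lborel \<partial>lborel)"
    by (subst nn_integral_lborel_pair(2)) auto
  also have "(\<integral>\<^sup>+b. \<integral>\<^sup>+c. ?F b * ennreal (heat n (c - b)) \<partial>lborel \<partial>lborel) = ?I * ennreal (2 * pi)"
  proof -
    have "(\<integral>\<^sup>+c. ?F b * ennreal (heat n (c - b)) \<partial>lborel) = ?F b * ennreal (2 * pi)" for b
      using nn_integral_lborel_diff[of "\<lambda>c. ennreal (heat n c)" b] nn_integral_heat[OF n]
      by (simp add: nn_integral_cmult)
    then show ?thesis by (simp add: nn_integral_multc)
  qed
  also have "ennreal (1/2) * (?I * ennreal (2 * pi)) + ennreal (1/2) * (?I * ennreal (2 * pi)) =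
      ennreal (2 * pi) * ?I"
  proof -
    have "ennreal (1/2) + ennreal (1/2) = 1" by (subst ennreal_plus[symmetric]) auto
    then show ?thesis by (simp only: distrib_right[symmetric] mult_1_left mult.commute)
  qed
  finally show ?thesis .
qed

lemma integrable_mult_exp_minkowski:
  fixes f :: "plane \<Rightarrow> complex"
  assumes "integrable lborel f"
  shows "integrable lborel (\<lambda>b. f b * exp (\<i> * of_real (minkowski x b)))"
  using assms by (rule Bochner_Integration.integrable_bound) (use assms in \<open>auto simp: norm_mult\<close>)

definition fourier_minkowski :: "(plane \<Rightarrow> complex) \<Rightarrow> plane \<Rightarrow> complex" where
  "fourier_minkowski f x = (LINT b|lborel. f b * exp (\<i> * of_real (minkowski x b)))"

text \<open>The Gaussian weight makes Fubini applicable; removing it by Fatou costs only the equality.\<close>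

lemma plancherel_gauss:
  fixes f :: "plane \<Rightarrow> complex"
  assumes f: "integrable lborel f" and n: "0 < n"
  shows "(\<integral>\<^sup>+x. ennreal ((norm (fourier_minkowski f x))\<^sup>2 * gauss n x) \<partial>lborel)
    \<le> ennreal (2 * pi) * (\<integral>\<^sup>+b. ennreal ((norm (f b))\<^sup>2) \<partial>lborel)"
proof -
  have [measurable]: "f \<in> borel_measurable borel" using f by auto
  let ?F = "fourier_minkowski f"
  let ?e = "\<lambda>x b. exp (\<i> * of_real (minkowski x b))"
  have F_meas [measurable]: "?F \<in> borel_measurable borel"
    unfolding fourier_minkowski_def
    using lborel.borel_measurable_lebesgue_integral[of "\<lambda>x b. f b * ?e x b" lborel] by simp
  have bound: "norm (?F x) \<le> (LINT b|lborel. norm (f b))" for x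
    unfolding fourier_minkowski_def
    using integral_norm_bound[of lborel "\<lambda>b. f b * ?e x b"] by (simp add: norm_mult)
  have int_F: "integrable lborel (\<lambda>x. (norm (?F x))\<^sup>2 * gauss n x)"
  proof (rule Bochner_Integration.integrable_bound)
    show "integrable lborel (\<lambda>x. (LINT b|lborel. norm (f b))\<^sup>2 * gauss n x)"
      by (intro integrable_mult_right integrable_gauss n)
    show "AE x in lborel. norm ((norm (?F x))\<^sup>2 * gauss n x) \<le> norm ((LINT b|lborel. norm (f b))\<^sup>2 * gauss n x)"
      using bound by (auto intro!: mult_right_mono power_mono)
  qed measurable
  define u where "u z = f (fst z) * cnj (f (snd z))" for z
  define g where "g x z = of_real (gauss n x) * (f (fst z) * ?e x (fst z) * cnj (f (snd z) * ?e x (snd z)))" for x z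
  have [measurable]: "u \<in> borel_measurable borel" unfolding u_def by measurable
  have g_eq: "g x z = u z * (of_real (gauss n x) * ?e x (fst z - snd z))" for x z
  proof -
    have "?e x (fst z - snd z) = ?e x (fst z) * cnj (?e x (snd z))"
      by (simp add: exp_cnj minkowski_def algebra_simps flip: exp_add)
    then show ?thesis by (simp add: g_def u_def)
  qed
  have "integrable lborel (\<lambda>z. u (fst z) * of_real (gauss n (snd z)))"
    unfolding u_def using f
    by (intro integrable_lborel_prod integrable_of_real integrable_gauss n) auto
  then have "integrable (lborel \<Otimes>\<^sub>M lborel) (\<lambda>(z, x). g x z)"
    unfolding lborel_prod
    by (rule Bochner_Integration.integrable_bound) (auto simp: g_eq norm_mult split_beta')
  note Fubini = lborel_pair.Fubini_integral[OF this] and int_z = lborel_pair.integrable_fst[OF this]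
  have "complex_of_real (LINT x|lborel. (norm (?F x))\<^sup>2 * gauss n x) =
      (CLINT x|lborel. of_real (gauss n x) * (?F x * cnj (?F x)))"
    unfolding integral_complex_of_real[symmetric]
    by (intro Bochner_Integration.integral_cong) (simp_all add: complex_norm_square[symmetric] mult.commute)
  also have "\<dots> = (CLINT x|lborel. CLINT z|lborel. g x z)"
  proof (intro Bochner_Integration.integral_cong refl)
    fix x
    have "integrable lborel (\<lambda>b. f b * ?e x b)" by (rule integrable_mult_exp_minkowski[OF f])
    then show "of_real (gauss n x) * (?F x * cnj (?F x)) = (CLINT z|lborel. g x z)"
      using integral_lborel_prod[of "\<lambda>b. f b * ?e x b" "\<lambda>b. cnj (f b * ?e x b)"]
      unfolding g_def fourier_minkowski_def
      by (simp del: complex_cnj_mult add: Bochner_Integration.integral_cnj)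
  qed
  also have "\<dots> = (CLINT z|lborel. CLINT x|lborel. g x z)"
    by (rule Fubini)
  also have "\<dots> = (CLINT z|lborel. u z * of_real (heat n (fst z - snd z)))"
    unfolding g_eq by (simp add: integral_gauss_minkowski[OF n])
  finally have eq: "complex_of_real (LINT x|lborel. (norm (?F x))\<^sup>2 * gauss n x) =
      (CLINT z|lborel. u z * of_real (heat n (fst z - snd z)))" .
  have "integrable lborel (\<lambda>z. u z * of_real (heat n (fst z - snd z)))"
    using int_z unfolding g_eq by (simp add: integral_gauss_minkowski[OF n])
  then have "ennreal (norm (CLINT z|lborel. u z * of_real (heat n (fst z - snd z)))) \<le>
      (\<integral>\<^sup>+z. ennreal (norm (u z * of_real (heat n (fst z - snd z)))) \<partial>lborel)"
    by (rule integral_norm_bound_ennreal)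
  also have "\<dots> \<le> ennreal (2 * pi) * (\<integral>\<^sup>+b. ennreal ((norm (f b))\<^sup>2) \<partial>lborel)"
    using nn_integral_heat_convolution_le[OF _ n, of f] by (simp add: u_def norm_mult)
  finally have "ennreal (LINT x|lborel. (norm (?F x))\<^sup>2 * gauss n x) \<le>
      ennreal (2 * pi) * (\<integral>\<^sup>+b. ennreal ((norm (f b))\<^sup>2) \<partial>lborel)"
    unfolding eq[symmetric] by (simp add: abs_of_nonneg)
  then show ?thesis
    by (subst nn_integral_eq_integral[OF int_F]) auto
qed

lemma plancherel_le:
  fixes f :: "plane \<Rightarrow> complex"
  assumes f: "integrable lborel f"
  shows "(\<integral>\<^sup>+x. ennreal ((norm (fourier_minkowski f x))\<^sup>2) \<partial>lborel)
    \<le> ennreal ((2 * pi)\<^sup>2) * (\<integral>\<^sup>+b. ennreal ((norm (f b))\<^sup>2) \<partial>lborel)"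
proof -
  let ?F = "fourier_minkowski f" and ?I = "\<integral>\<^sup>+b. ennreal ((norm (f b))\<^sup>2) \<partial>lborel"
  have [measurable]: "f \<in> borel_measurable borel" using f by auto
  have F_meas [measurable]: "?F \<in> borel_measurable borel"
    unfolding fourier_minkowski_def
    using lborel.borel_measurable_lebesgue_integral[of "\<lambda>x b. f b * exp (\<i> * of_real (minkowski x b))" lborel]
    by simp
  \<comment> \<open>The limit is 1/(2 pi) and not 1; bringing it to the other side turns the
    constant 2 pi of \<open>plancherel_gauss\<close> into its square.\<close>
  have lim: "(\<lambda>n. gauss (real (Suc n)) x) \<longlonglongrightarrow> 1 / (2 * pi)" for x
  proof -
    have z: "(\<lambda>n. c / real (Suc n)) \<longlonglongrightarrow> 0" for c :: real
      using LIMSEQ_Suc[OF lim_const_over_n[of c]] by simp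
    have cont: "(\<lambda>n. std_normal_density (c / real (Suc n))) \<longlonglongrightarrow> std_normal_density 0" for c
      unfolding std_normal_density_def by (intro tendsto_intros z) simp
    have "(\<lambda>n. gauss (real (Suc n)) x) \<longlonglongrightarrow> std_normal_density 0 * std_normal_density 0"
      unfolding gauss_def by (intro tendsto_mult cont)
    then show ?thesis by (simp add: std_normal_density_def)
  qed
  have "(\<integral>\<^sup>+x. ennreal ((norm (?F x))\<^sup>2 * (1 / (2 * pi))) \<partial>lborel) =
      (\<integral>\<^sup>+x. liminf (\<lambda>n. ennreal ((norm (?F x))\<^sup>2 * gauss (real (Suc n)) x)) \<partial>lborel)"
    by (rule nn_integral_cong) (rule sym, intro lim_imp_Liminf tendsto_ennrealI tendsto_mult lim tendsto_const, simp)
  also have "\<dots> \<le> liminf (\<lambda>n. \<integral>\<^sup>+x. ennreal ((norm (?F x))\<^sup>2 * gauss (real (Suc n)) x) \<partial>lborel)"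
    by (intro nn_integral_liminf) auto
  also have "\<dots> \<le> ennreal (2 * pi) * ?I"
    by (intro Liminf_le always_eventually allI plancherel_gauss f) auto
  finally have le: "(\<integral>\<^sup>+x. ennreal ((norm (?F x))\<^sup>2 * (1 / (2 * pi))) \<partial>lborel) \<le> ennreal (2 * pi) * ?I" .
  have "(\<integral>\<^sup>+x. ennreal ((norm (?F x))\<^sup>2) \<partial>lborel) =
      (\<integral>\<^sup>+x. ennreal (2 * pi) * ennreal ((norm (?F x))\<^sup>2 * (1 / (2 * pi))) \<partial>lborel)"
    by (intro nn_integral_cong, subst ennreal_mult'[symmetric]) auto
  also have "\<dots> = ennreal (2 * pi) * (\<integral>\<^sup>+x. ennreal ((norm (?F x))\<^sup>2 * (1 / (2 * pi))) \<partial>lborel)"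
    by (rule nn_integral_cmult) measurable
  also have "\<dots> \<le> ennreal (2 * pi) * (ennreal (2 * pi) * ?I)"
    by (intro mult_left_mono le) auto
  also have "\<dots> = ennreal ((2 * pi)\<^sup>2) * ?I"
    by (simp add: power2_eq_square ennreal_mult'[symmetric] mult.assoc[symmetric])
  finally show ?thesis .
qed

section \<open>The kernel of the Fourier transform\<close>

lemma P_sets [measurable]: "P \<in> sets borel"
proof -
  have "P = {p \<in> space borel. 0 < fst (snd p)}" by (auto simp: P_def)
  also have "\<dots> \<in> sets borel" by measurable
  finally show ?thesis .
qed

lemma mem_P: "p \<in> P \<longleftrightarrow> 0 < fst (snd p)"
  by (auto simp: P_def)

text \<open>The Haar density as a function of q = (a, \<theta>) alone, set to 0 for nonpositive a.
  Integrals over \<open>P\<close> become integrals over the whole Lebesgue space, where Fubini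
  splits off b.\<close>

definition haar_weight :: "real \<times> real \<Rightarrow> real" where
  "haar_weight q = (if 0 < fst q then 1 / fst q ^ 3 else 0)"

lemma haar_weight_nonneg [simp]: "0 \<le> haar_weight q"
  by (simp add: haar_weight_def)

lemma haar_weight_measurable [measurable]: "haar_weight \<in> borel_measurable borel"
  unfolding haar_weight_def by measurable

lemma space_haar: "space haar = P"
  by (simp add: haar_def space_restrict_space)

lemma borel_measurable_haar: "borel_measurable haar = borel_measurable (restrict_space lborel P)"
  by (rule measurable_cong_sets) (simp_all add: haar_def)

lemma measurable_borel_haar: "f \<in> borel_measurable borel \<Longrightarrow> f \<in> borel_measurable haar"
  unfolding borel_measurable_haar by (rule measurable_restrict_space1) simp

lemma haar_extend:
  fixes f :: "affine_poincare \<Rightarrow> 'b::real_normed_vector"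
  shows "f \<in> borel_measurable haar \<Longrightarrow> (\<lambda>p. indicator P p *\<^sub>R f p) \<in> borel_measurable borel"
  unfolding borel_measurable_haar using borel_measurable_restrict_extend[of f lborel P] by simp

lemma haar_density_measurable:
  "(\<lambda>(b::plane, a::real, \<theta>::real). ennreal (1 / a ^ 3)) \<in> borel_measurable (restrict_space lborel P)"
  unfolding split_beta' by (rule measurable_restrict_space1) measurable

lemma nn_integral_haar:
  assumes "h \<in> borel_measurable haar"
  shows "(\<integral>\<^sup>+p. h p \<partial>haar) = (\<integral>\<^sup>+p. h p * ennreal (haar_weight (snd p)) \<partial>lborel)"
proof -
  have "(\<integral>\<^sup>+p. h p \<partial>haar) = (\<integral>\<^sup>+p. ennreal (1 / fst (snd p) ^ 3) * h p \<partial>restrict_space lborel P)"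
    using haar_density_measurable assms unfolding haar_def
    by (subst nn_integral_density) (auto simp: borel_measurable_haar[unfolded haar_def] split_beta')
  also have "\<dots> = (\<integral>\<^sup>+p. ennreal (1 / fst (snd p) ^ 3) * h p * indicator P p \<partial>lborel)"
    by (rule nn_integral_restrict_space) simp
  also have "\<dots> = (\<integral>\<^sup>+p. h p * ennreal (haar_weight (snd p)) \<partial>lborel)"
    by (intro nn_integral_cong) (auto simp: haar_weight_def mem_P indicator_def mult.commute)
  finally show ?thesis .
qed

lemma
  fixes h :: "affine_poincare \<Rightarrow> 'b::{banach, second_countable_topology}"
  assumes "h \<in> borel_measurable haar"
  shows integral_haar: "(LINT p|haar. h p) = (LINT p|lborel. haar_weight (snd p) *\<^sub>R h p)"
    and integrable_haar_iff: "integrable haar h \<longleftrightarrow> integrable lborel (\<lambda>p. haar_weight (snd p) *\<^sub>R h p)"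
proof -
  have meas: "(\<lambda>p::affine_poincare. 1 / fst (snd p) ^ 3) \<in> borel_measurable (restrict_space lborel P)"
    by (rule measurable_restrict_space1) measurable
  have h: "h \<in> borel_measurable (restrict_space lborel P)"
    using assms by (simp add: borel_measurable_haar)
  have AE: "AE p in restrict_space lborel P. 0 \<le> 1 / fst (snd p) ^ 3"
    by (rule AE_I2) (auto simp: space_restrict_space mem_P)
  have eq: "haar = density (restrict_space lborel P) (\<lambda>p. ennreal (1 / fst (snd p) ^ 3))"
    by (simp add: haar_def split_beta')
  have ind: "indicator P p *\<^sub>R (1 / fst (snd p) ^ 3) *\<^sub>R h p = haar_weight (snd p) *\<^sub>R h p" for p
    by (auto simp: haar_weight_def mem_P indicator_def)
  show "(LINT p|haar. h p) = (LINT p|lborel. haar_weight (snd p) *\<^sub>R h p)"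
    unfolding eq integral_density[OF h meas AE] by (subst integral_restrict_space) (simp, simp only: ind)
  show "integrable haar h \<longleftrightarrow> integrable lborel (\<lambda>p. haar_weight (snd p) *\<^sub>R h p)"
    unfolding eq integrable_density[OF h meas AE] by (subst integrable_restrict_space) (simp, simp only: ind)
qed

text \<open>Functions in \<open>L2 haar\<close> are measurable on \<open>P\<close> only, hence the indicator.\<close>

definition slice :: "(affine_poincare \<Rightarrow> complex) \<Rightarrow> real \<times> real \<Rightarrow> plane \<Rightarrow> complex" where
  "slice f q b = indicator P (b, q) *\<^sub>R f (b, q)"

lemma slice_measurable_pair:
  "f \<in> borel_measurable haar \<Longrightarrow> (\<lambda>p. slice f (snd p) (fst p)) \<in> borel_measurable borel"
  using haar_extend[of f] by (simp add: slice_def)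

lemma slice_measurable [measurable (raw)]:
  assumes "f \<in> borel_measurable haar" "g \<in> borel_measurable N" "h \<in> borel_measurable N"
  shows "(\<lambda>z. slice f (g z) (h z)) \<in> borel_measurable N"
  using measurable_compose[OF borel_measurable_Pair[OF assms(3,2)] slice_measurable_pair[OF assms(1)]]
  by simp

lemma haar_weight_slice: "haar_weight q *\<^sub>R slice f q b = haar_weight q *\<^sub>R f (b, q)"
  by (auto simp: haar_weight_def slice_def mem_P)

lemma fourier_slice_measurable [measurable (raw)]:
  assumes [measurable]: "f \<in> borel_measurable haar" "g \<in> borel_measurable N" "h \<in> borel_measurable N"
  shows "(\<lambda>z. fourier_minkowski (slice f (g z)) (h z)) \<in> borel_measurable N"
  unfolding fourier_minkowski_def
  by (rule lborel.borel_measurable_lebesgue_integral) measurable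

lemma nn_integral_L2_haar:
  assumes f: "f \<in> L2 haar"
  shows "(\<integral>\<^sup>+q. ennreal (haar_weight q) * (\<integral>\<^sup>+b. ennreal ((norm (slice f q b))\<^sup>2) \<partial>lborel) \<partial>lborel) =
    ennreal ((l2_norm haar f)\<^sup>2)"
proof -
  have f_meas [measurable]: "f \<in> borel_measurable haar" using f by (rule L2_measurable)
  have "ennreal ((l2_norm haar f)\<^sup>2) = (\<integral>\<^sup>+p. ennreal ((norm (f p))\<^sup>2) \<partial>haar)"
    by (rule nn_integral_L2[OF f, symmetric])
  also have "\<dots> = (\<integral>\<^sup>+p. ennreal ((norm (f p))\<^sup>2) * ennreal (haar_weight (snd p)) \<partial>lborel)"
    by (rule nn_integral_haar) measurable
  also have "\<dots> = (\<integral>\<^sup>+p. ennreal (haar_weight (snd p)) * ennreal ((norm (slice f (snd p) (fst p)))\<^sup>2) \<partial>lborel)"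
    by (intro nn_integral_cong) (auto simp: slice_def mem_P haar_weight_def mult.commute)
  also have "\<dots> = (\<integral>\<^sup>+q. ennreal (haar_weight q) * (\<integral>\<^sup>+b. ennreal ((norm (slice f q b))\<^sup>2) \<partial>lborel) \<partial>lborel)"
    by (subst nn_integral_lborel_pair(2)) (auto intro!: nn_integral_cong nn_integral_cmult)
  finally show ?thesis ..
qed

lemma AE_integrable_slice:
  assumes f: "integrable haar f"
  shows "AE q in lborel. integrable lborel (slice f q)"
proof -
  have "integrable lborel (\<lambda>p. haar_weight (snd p) *\<^sub>R f p)"
    using f unfolding integrable_haar_iff[OF borel_measurable_integrable[OF f]] .
  then have "integrable (lborel \<Otimes>\<^sub>M lborel) (\<lambda>(b, q). haar_weight q *\<^sub>R f (b, q))"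
    by (simp add: lborel_prod split_beta')
  then have "AE q in lborel. integrable lborel (\<lambda>b. haar_weight q *\<^sub>R f (b, q))"
    by (rule lborel_pair.AE_integrable_snd)
  then show ?thesis
  proof (rule AE_mp, intro AE_I2 impI)
    fix q :: "real \<times> real"
    assume int: "integrable lborel (\<lambda>b. haar_weight q *\<^sub>R f (b, q))"
    show "integrable lborel (slice f q)"
    proof (cases "0 < fst q")
      case True
      then have "slice f q = (\<lambda>b. fst q ^ 3 *\<^sub>R haar_weight q *\<^sub>R f (b, q))"
        by (auto simp: slice_def mem_P haar_weight_def)
      then show ?thesis using integrable_scaleR_right[OF int, of "fst q ^ 3"] by simp
    next
      case False
      then have "slice f q = (\<lambda>b. 0)" by (auto simp: slice_def mem_P)
      then show ?thesis by simp
    qed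
  qed
qed

text \<open>The inverse of \<open>orbit x\<close> on the cone of x. The light coordinates of y
  relative to x are a exp(-\<theta>) and a exp(\<theta>): their product is the square of a, and the
  second divided by the first is exp(2 \<theta>).\<close>

definition orbit_inv :: "plane \<Rightarrow> plane \<Rightarrow> real \<times> real" where
  "orbit_inv x y = (sqrt (minkowski y y / minkowski x x),
    ln ((fst y - snd y) / (fst x - snd x) / ((fst y + snd y) / (fst x + snd x))) / 2)"

text \<open>With r = sqrt |<x;x>|, the Fourier integral at x carries a from \<open>irrep\<close>, a
  r/(2 pi) from the Duflo-Moore factor at the orbit point, and a^(-3) from the Haar measure.
  Dividing the product by the polar density a r^2 leaves 1/(2 pi a^2 r).\<close>

definition fourier_kernel :: "(affine_poincare \<Rightarrow> complex) \<Rightarrow> plane \<times> plane \<Rightarrow> complex" where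
  "fourier_kernel f = (\<lambda>(x, y). let q = orbit_inv x y in
     of_real (1 / (2 * pi) / ((fst q)\<^sup>2 * sqrt \<bar>minkowski x x\<bar>)) * fourier_minkowski (slice f q) x)"

lemma fourier_kernel_measurable_borel:
  assumes [measurable]: "f \<in> borel_measurable haar"
  shows "fourier_kernel f \<in> borel_measurable borel"
  unfolding fourier_kernel_def Let_def orbit_inv_def split_beta' by measurable

context cone_space
begin

lemma measurable_borel_M_pair:
  assumes "g \<in> borel_measurable borel" shows "g \<in> borel_measurable (M \<Otimes>\<^sub>M M)"
proof -
  have [measurable]: "(\<lambda>x. x) \<in> borel_measurable M" by (intro measurable_borel_M) simp
  have "(\<lambda>p. (fst p, snd p)) \<in> borel_measurable (M \<Otimes>\<^sub>M M)"
    by (intro borel_measurable_Pair measurable_compose[OF measurable_fst] measurable_compose[OF measurable_snd])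
      simp_all
  from measurable_compose[OF this assms] show ?thesis by simp
qed

lemma orbit_inv_orbit:
  assumes x: "x \<in> cone i j" and q: "0 < fst q"
  shows "orbit_inv x (orbit x q) = q"
proof -
  obtain a \<theta> where q_eq: "q = (a, \<theta>)" and a: "0 < a" using q by (cases q) auto
  have nz: "fst x + snd x \<noteq> 0" "fst x - snd x \<noteq> 0" "minkowski x x \<noteq> 0"
    using cone_minkowski[OF i_mem j_mem x] by auto
  have "exp \<theta> / exp (- \<theta>) = exp (2 * \<theta>)"
    by (simp add: exp_diff[symmetric])
  then show ?thesis
    using a nz unfolding orbit_inv_def q_eq orbit_light_coordinates minkowski_orbit
    by (simp add: real_sqrt_mult)
qed

lemma fourier_kernel_orbit:
  assumes "x \<in> cone i j" "0 < fst q"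
  shows "fourier_kernel f (x, orbit x q) =
    of_real (1 / (2 * pi) / ((fst q)\<^sup>2 * sqrt \<bar>minkowski x x\<bar>)) * fourier_minkowski (slice f q) x"
  by (simp add: fourier_kernel_def orbit_inv_orbit[OF assms])

text \<open>The squared prefactor of the kernel times the polar density is 1/(4 pi^2 a^3): all
  powers of r cancel and the Haar weight appears. After Tonelli, Plancherel in x for fixed q costs
  (2 pi)^2, so the constant is exactly 1.\<close>

lemma
  assumes int: "integrable haar f" and f: "f \<in> L2 haar"
  shows fourier_kernel_L2: "fourier_kernel f \<in> L2 (M \<Otimes>\<^sub>M M)"
    and l2_norm_fourier_kernel_le: "l2_norm (M \<Otimes>\<^sub>M M) (fourier_kernel f) \<le> l2_norm haar f"
proof -
  let ?k = "fourier_kernel f" and ?\<Phi> = "\<lambda>x q. fourier_minkowski (slice f q) x"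
  have f_meas [measurable]: "f \<in> borel_measurable haar" using f by (rule L2_measurable)
  have k_borel [measurable]: "?k \<in> borel_measurable borel" by (rule fourier_kernel_measurable_borel) fact
  have k_meas: "?k \<in> borel_measurable (M \<Otimes>\<^sub>M M)" using k_borel by (rule measurable_borel_M_pair)
  \<comment> \<open>The square of the Duflo-Moore constant 1/(2 pi); it is the reciprocal of the
    constant in \<open>plancherel_le\<close>.\<close>
  define c where "c = 1 / (4 * pi\<^sup>2)"
  have c: "0 \<le> c" "c * (2 * pi)\<^sup>2 = 1" by (simp_all add: c_def power2_eq_square)
  have inner: "(\<integral>\<^sup>+y. ennreal ((norm (?k (x, y)))\<^sup>2) \<partial>M) =
      (\<integral>\<^sup>+q. ennreal (c * haar_weight q) * ennreal ((norm (?\<Phi> x q))\<^sup>2) \<partial>lborel)"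
    if x: "x \<in> cone i j" for x
  proof -
    have "(\<integral>\<^sup>+y. ennreal ((norm (?k (x, y)))\<^sup>2) \<partial>M) =
        (\<integral>\<^sup>+q. ennreal ((norm (?k (x, orbit x q)))\<^sup>2) * ennreal (fst q * \<bar>minkowski x x\<bar>) *
          indicator {0<..} (fst q) \<partial>lborel)"
      unfolding nn_integral_M by (rule nn_integral_cone_polar[OF _ i_mem j_mem x]) measurable
    also have "\<dots> = (\<integral>\<^sup>+q. ennreal (c * haar_weight q) * ennreal ((norm (?\<Phi> x q))\<^sup>2) \<partial>lborel)"
    proof (rule nn_integral_cong)
      fix q :: "real \<times> real"
      show "ennreal ((norm (?k (x, orbit x q)))\<^sup>2) * ennreal (fst q * \<bar>minkowski x x\<bar>) * indicator {0<..} (fst q) =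
          ennreal (c * haar_weight q) * ennreal ((norm (?\<Phi> x q))\<^sup>2)"
      proof (cases "0 < fst q")
        case True
        have m: "0 < \<bar>minkowski x x\<bar>" using cone_minkowski[OF i_mem j_mem x] by simp
        have "(norm (?k (x, orbit x q)))\<^sup>2 =
            1 / (4 * pi\<^sup>2 * fst q ^ 4 * \<bar>minkowski x x\<bar>) * (norm (?\<Phi> x q))\<^sup>2"
          unfolding fourier_kernel_orbit[OF x True] norm_mult norm_of_real power_mult_distrib power2_abs power_divide
          by (simp add: power_mult_distrib flip: power_mult)
        then have "(norm (?k (x, orbit x q)))\<^sup>2 * (fst q * \<bar>minkowski x x\<bar>) =
            c * haar_weight q * (norm (?\<Phi> x q))\<^sup>2"
          using True m by (simp add: c_def haar_weight_def eval_nat_numeral field_simps)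
        then show ?thesis
          using True c m by (simp add: ennreal_mult'[symmetric] haar_weight_def)
      qed (simp add: haar_weight_def)
    qed
    finally show ?thesis .
  qed
  have "(\<integral>\<^sup>+p. ennreal ((norm (?k p))\<^sup>2) \<partial>(M \<Otimes>\<^sub>M M)) = (\<integral>\<^sup>+x. \<integral>\<^sup>+y. ennreal ((norm (?k (x, y)))\<^sup>2) \<partial>M \<partial>M)"
    using k_meas by (subst nn_integral_fst) auto
  also have "\<dots> = (\<integral>\<^sup>+x. (\<integral>\<^sup>+q. ennreal (c * haar_weight q) * ennreal ((norm (?\<Phi> x q))\<^sup>2) \<partial>lborel) \<partial>M)"
    by (rule nn_integral_cong) (simp add: space_M inner)
  \<comment> \<open>The cone is enlarged to the whole plane, since Plancherel integrates over all
    frequencies; the share of the other three cones is given away here.\<close>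
  also have "\<dots> \<le> (\<integral>\<^sup>+x. (\<integral>\<^sup>+q. ennreal (c * haar_weight q) * ennreal ((norm (?\<Phi> x q))\<^sup>2) \<partial>lborel) \<partial>lborel)"
    unfolding nn_integral_M by (rule nn_integral_mono) (simp add: indicator_def)
  also have "\<dots> = (\<integral>\<^sup>+q. (\<integral>\<^sup>+x. ennreal (c * haar_weight q) * ennreal ((norm (?\<Phi> x q))\<^sup>2) \<partial>lborel) \<partial>lborel)"
    by (rule lborel_pair.Fubini') measurable
  also have "\<dots> = (\<integral>\<^sup>+q. ennreal (c * haar_weight q) * (\<integral>\<^sup>+x. ennreal ((norm (?\<Phi> x q))\<^sup>2) \<partial>lborel) \<partial>lborel)"
    by (rule nn_integral_cong) (rule nn_integral_cmult, measurable)
  also have "\<dots> \<le> (\<integral>\<^sup>+q. ennreal (haar_weight q) * (\<integral>\<^sup>+b. ennreal ((norm (slice f q b))\<^sup>2) \<partial>lborel) \<partial>lborel)"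
  proof (rule nn_integral_mono_AE, rule AE_mp[OF AE_integrable_slice[OF int]], intro AE_I2 impI)
    fix q :: "real \<times> real"
    assume q: "integrable lborel (slice f q)"
    let ?I = "\<integral>\<^sup>+b. ennreal ((norm (slice f q b))\<^sup>2) \<partial>lborel"
    have "ennreal (c * haar_weight q) * (\<integral>\<^sup>+x. ennreal ((norm (?\<Phi> x q))\<^sup>2) \<partial>lborel) \<le>
        ennreal (c * haar_weight q) * (ennreal ((2 * pi)\<^sup>2) * ?I)"
      by (intro mult_left_mono plancherel_le q) auto
    also have "\<dots> = ennreal (c * haar_weight q * (2 * pi)\<^sup>2) * ?I"
      by (simp only: mult.assoc[symmetric] ennreal_mult'[OF mult_nonneg_nonneg[OF c(1) haar_weight_nonneg]])
    also have "c * haar_weight q * (2 * pi)\<^sup>2 = haar_weight q"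
      using c(2) by (metis mult.commute mult.left_commute mult_1_right)
    finally show "ennreal (c * haar_weight q) * (\<integral>\<^sup>+x. ennreal ((norm (?\<Phi> x q))\<^sup>2) \<partial>lborel) \<le>
        ennreal (haar_weight q) * ?I" .
  qed
  also have "\<dots> = ennreal ((l2_norm haar f)\<^sup>2)" by (rule nn_integral_L2_haar[OF f])
  finally have le: "(\<integral>\<^sup>+p. ennreal ((norm (?k p))\<^sup>2) \<partial>(M \<Otimes>\<^sub>M M)) \<le> ennreal ((l2_norm haar f)\<^sup>2)" .
  show "?k \<in> L2 (M \<Otimes>\<^sub>M M)" "l2_norm (M \<Otimes>\<^sub>M M) ?k \<le> l2_norm haar f"
    using L2_bounded[OF k_meas le] by auto
qed

text \<open>Functions in \<open>L2 M\<close> are measurable on the cone only. The extension by zero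
  can be composed with measurable maps into the plane, which joint measurability in x and the group
  element requires.\<close>

definition extend :: "(plane \<Rightarrow> complex) \<Rightarrow> plane \<Rightarrow> complex" where
  "extend \<phi> x = indicator (cone i j) x *\<^sub>R \<phi> x"

lemma extend_measurable [measurable (raw)]:
  "\<phi> \<in> borel_measurable M \<Longrightarrow> g \<in> borel_measurable N \<Longrightarrow> (\<lambda>z. extend \<phi> (g z)) \<in> borel_measurable N"
  unfolding extend_def by (rule measurable_compose[OF _ M_extend])

lemma extend_orbit: "x \<in> cone i j \<Longrightarrow> 0 < fst q \<Longrightarrow> extend \<phi> (orbit x q) = \<phi> (orbit x q)"
  using orbit_in_cone_iff[OF i_mem j_mem, of "fst q" x "snd q"] by (simp add: extend_def)

text \<open>A jointly measurable substitute for \<open>irrep\<close> on the whole Lebesgue space,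
  equal to it for p in \<open>P\<close> and x in the cone; Fubini and measurability in p are applied
  to this version.\<close>

definition irrep_ext :: "(plane \<Rightarrow> complex) \<Rightarrow> affine_poincare \<Rightarrow> plane \<Rightarrow> complex" where
  "irrep_ext \<phi> p x = of_real (fst (snd p)) * exp (\<i> * of_real (minkowski x (fst p))) * extend \<phi> (orbit x (snd p))"

lemma irrep_ext_measurable [measurable (raw)]:
  assumes [measurable]: "\<phi> \<in> borel_measurable M" "f \<in> borel_measurable N" "g \<in> borel_measurable N"
  shows "(\<lambda>z. irrep_ext \<phi> (f z) (g z)) \<in> borel_measurable N"
  unfolding irrep_ext_def by measurable

lemma irrep_ext: "x \<in> cone i j \<Longrightarrow> p \<in> P \<Longrightarrow> irrep_ext \<phi> p x = irrep p \<phi> x"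
  by (cases p) (simp add: irrep_ext_def irrep_orbit extend_orbit mem_P)

lemma borel_measurable_ident_M [measurable]: "(\<lambda>x. x) \<in> borel_measurable M"
  by (intro measurable_borel_M) simp

text \<open>Testing against a strictly positive weight in \<open>L\<^sup>2\<close> turns the norm bound on \<open>irrep p\<close> into
  absolute convergence of the Fourier integral for almost every \<open>x\<close>.\<close>

lemma AE_integrable_irrep:
  assumes f: "integrable haar f" and \<psi>: "\<psi> \<in> L2 M"
  shows "AE x in M. integrable haar (\<lambda>p. f p * irrep p \<psi> x)"
proof -
  have f_meas [measurable]: "f \<in> borel_measurable haar" using f by simp
  have \<psi>_meas [measurable]: "\<psi> \<in> borel_measurable M" using \<psi> by (rule L2_measurable)
  interpret MP: pair_sigma_finite M "lborel :: affine_poincare measure" ..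
  obtain w where w [measurable]: "w \<in> borel_measurable M" and w_pos: "\<And>x. x \<in> space M \<Longrightarrow> 0 < w x"
    and w_L2: "(\<lambda>x. complex_of_real (w x)) \<in> L2 M"
    using L2_positive_weight by blast
  define W where "W x = complex_of_real (w x)" for x
  have W_L2: "W \<in> L2 M" using w_L2 by (simp add: W_def[abs_def])
  have [measurable]: "W \<in> borel_measurable M" unfolding W_def by measurable
  \<comment> \<open>The Haar density and the extension of f by zero off \<open>P\<close> are
    absorbed into g, so that the double integral runs over Lebesgue measure in p.\<close>
  define g where "g p = haar_weight (snd p) *\<^sub>R slice f (snd p) (fst p)" for p
  have g_meas [measurable]: "g \<in> borel_measurable borel" unfolding g_def by measurable
  have g_int: "integrable lborel g"
    using f unfolding integrable_haar_iff[OF f_meas] g_def by (simp add: haar_weight_slice)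
  have g_zero: "g p = 0" if "p \<notin> P" for p using that by (simp add: g_def haar_weight_def mem_P)
  define R where "R = irrep_ext \<psi>"
  have [measurable]: "(\<lambda>z. R (snd z) (fst z)) \<in> borel_measurable (M \<Otimes>\<^sub>M lborel)"
    unfolding R_def by measurable
  have "(\<integral>\<^sup>+x. (\<integral>\<^sup>+p. ennreal (norm (g p) * (norm (R p x) * norm (W x))) \<partial>lborel) \<partial>M) =
      (\<integral>\<^sup>+p. (\<integral>\<^sup>+x. ennreal (norm (g p) * (norm (R p x) * norm (W x))) \<partial>M) \<partial>lborel)"
    by (rule MP.Fubini'[symmetric]) (simp add: split_beta', measurable)
  also have "\<dots> \<le> (\<integral>\<^sup>+p. ennreal (norm (g p) * (l2_norm M \<psi> * l2_norm M W)) \<partial>lborel)"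
  proof (rule nn_integral_mono)
    fix p :: affine_poincare
    show "(\<integral>\<^sup>+x. ennreal (norm (g p) * (norm (R p x) * norm (W x))) \<partial>M) \<le>
        ennreal (norm (g p) * (l2_norm M \<psi> * l2_norm M W))"
    proof (cases "p \<in> P")
      case True
      obtain b a \<theta> where p: "p = (b, a, \<theta>)" and a: "0 < a" using True by (auto simp: P_def)
      have L2: "irrep p \<psi> \<in> L2 M" "l2_norm M (irrep p \<psi>) = l2_norm M \<psi>"
        using irrep_L2[OF a \<psi>] l2_norm_irrep[OF a \<psi>] by (auto simp: p)
      have "(\<integral>\<^sup>+x. ennreal (norm (g p) * (norm (R p x) * norm (W x))) \<partial>M) =
          (\<integral>\<^sup>+x. ennreal (norm (g p) * (norm (irrep p \<psi> x) * norm (W x))) \<partial>M)"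
        by (rule nn_integral_cong) (simp add: R_def irrep_ext[OF _ True] space_M)
      also have "\<dots> = ennreal (LINT x|M. norm (g p) * (norm (irrep p \<psi> x) * norm (W x)))"
        by (intro nn_integral_eq_integral integrable_mult_right integrable_norm_mult L2 W_L2) simp
      also have "\<dots> \<le> ennreal (norm (g p) * (l2_norm M \<psi> * l2_norm M W))"
        using integral_norm_mult_le[OF L2(1) W_L2] L2(2)
        by (intro ennreal_leI) (simp add: mult_left_mono)
      finally show ?thesis .
    qed (simp add: g_zero)
  qed
  also have "\<dots> < \<infinity>"
    by (subst nn_integral_eq_integral) (intro integrable_mult_left integrable_norm g_int, auto)
  finally have "AE x in M. (\<integral>\<^sup>+p. ennreal (norm (g p) * (norm (R p x) * norm (W x))) \<partial>lborel) \<noteq> \<infinity>"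
    by (intro nn_integral_PInf_AE) (auto intro!: lborel.borel_measurable_nn_integral)
  then show ?thesis
  proof (rule AE_mp, intro AE_I2 impI)
    fix x assume x: "x \<in> space M"
      and fin: "(\<integral>\<^sup>+p. ennreal (norm (g p) * (norm (R p x) * norm (W x))) \<partial>lborel) \<noteq> \<infinity>"
    have [measurable]: "(\<lambda>p. R p x) \<in> borel_measurable borel" unfolding R_def by measurable
    have "integrable lborel (\<lambda>p. norm (W x) *\<^sub>R (g p * R p x))"
      using fin by (intro integrableI_bounded) (auto simp: norm_mult mult_ac top.not_eq_extremum)
    \<comment> \<open>Strict positivity of the weight allows it to be divided out again at the fixed
      point x.\<close>
    then have "integrable lborel (\<lambda>p. (1 / norm (W x)) *\<^sub>R norm (W x) *\<^sub>R (g p * R p x))"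
      by (rule integrable_scaleR_right)
    then have int: "integrable lborel (\<lambda>p. g p * R p x)"
      using w_pos[OF x] by (simp add: W_def)
    have meas: "(\<lambda>p. f p * irrep p \<psi> x) \<in> borel_measurable haar"
    proof (rule measurable_cong[THEN iffD1])
      show "(\<lambda>p. f p * R p x) \<in> borel_measurable haar"
        by (intro borel_measurable_times f_meas measurable_borel_haar) measurable
      show "f p * R p x = f p * irrep p \<psi> x" if "p \<in> space haar" for p
        using that x by (simp add: R_def irrep_ext space_haar space_M)
    qed
    have "haar_weight (snd p) *\<^sub>R (f p * irrep p \<psi> x) = g p * R p x" for p
    proof (cases "p \<in> P")
      case True
      then show ?thesis using x by (cases p) (simp add: g_def R_def irrep_ext space_M slice_def)
    next
      case False
      then show ?thesis by (simp add: g_zero) (simp add: haar_weight_def mem_P)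
    qed
    then show "integrable haar (\<lambda>p. f p * irrep p \<psi> x)"
      unfolding integrable_haar_iff[OF meas] using int by simp
  qed
qed

lemma duflo_moore_orbit:
  "0 < a \<Longrightarrow> duflo_moore \<phi> (orbit x (a, \<theta>)) =
    of_real (1 / (2 * pi) * (a * sqrt \<bar>minkowski x x\<bar>)) * \<phi> (orbit x (a, \<theta>))"
  by (simp add: duflo_moore_def minkowski_orbit abs_mult real_sqrt_mult)

text \<open>Fubini isolates the integral over b, which is the Fourier transform of a slice; what
  remains over q is the polar form of an integral over the cone. Absolute convergence comes from
  \<open>duflo_moore \<phi>\<close> being square integrable.\<close>

lemma fourier_integral_kernel:
  assumes f: "integrable haar f" and \<phi>: "\<phi> \<in> duflo_moore_domain i j"
  shows "AE x in M. (LINT p|haar. f p * irrep p (duflo_moore \<phi>) x) = int_op M (fourier_kernel f) \<phi> x"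
proof -
  have \<psi>: "duflo_moore \<phi> \<in> L2 M" and \<phi>L2: "\<phi> \<in> L2 M" using \<phi> by (auto simp: duflo_moore_domain_def)
  have f_meas [measurable]: "f \<in> borel_measurable haar" using f by simp
  have \<phi>_meas [measurable]: "\<phi> \<in> borel_measurable M" using \<phi>L2 by (rule L2_measurable)
  have [measurable]: "fourier_kernel f \<in> borel_measurable borel"
    by (rule fourier_kernel_measurable_borel) fact
  show ?thesis
  proof (rule AE_mp[OF AE_integrable_irrep[OF f \<psi>]], intro AE_I2 impI)
    fix x assume "x \<in> space M" and int: "integrable haar (\<lambda>p. f p * irrep p (duflo_moore \<phi>) x)"
    then have x: "x \<in> cone i j" by (simp add: space_M)
    let ?r = "sqrt \<bar>minkowski x x\<bar>"
    let ?\<Phi> = "\<lambda>q. fourier_minkowski (slice f q) x"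
    have r: "0 < ?r" using cone_minkowski[OF i_mem j_mem x] by simp
    have meas: "(\<lambda>p. f p * irrep p (duflo_moore \<phi>) x) \<in> borel_measurable haar" using int by simp
    have int': "integrable (lborel \<Otimes>\<^sub>M lborel) (\<lambda>(b, q). haar_weight q *\<^sub>R (f (b, q) * irrep (b, q) (duflo_moore \<phi>) x))"
      using int unfolding integrable_haar_iff[OF meas] by (simp add: lborel_prod split_beta')
    have "(LINT p|haar. f p * irrep p (duflo_moore \<phi>) x) =
        (LINT p|(lborel \<Otimes>\<^sub>M lborel). (case p of (b, q) \<Rightarrow> haar_weight q *\<^sub>R (f (b, q) * irrep (b, q) (duflo_moore \<phi>) x)))"
      unfolding integral_haar[OF meas] by (simp add: lborel_prod split_beta')
    also have "\<dots> = (LINT q|lborel. LINT b|lborel. haar_weight q *\<^sub>R (f (b, q) * irrep (b, q) (duflo_moore \<phi>) x))"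
      using lborel_pair.integral_snd[OF int'] by simp
    also have "\<dots> = (LINT q|lborel. (fst q * \<bar>minkowski x x\<bar> * indicator {0<..} (fst q)) *\<^sub>R
        (fourier_kernel f (x, orbit x q) * extend \<phi> (orbit x q)))"
    proof (intro Bochner_Integration.integral_cong refl)
      fix q :: "real \<times> real"
      show "(LINT b|lborel. haar_weight q *\<^sub>R (f (b, q) * irrep (b, q) (duflo_moore \<phi>) x)) =
          (fst q * \<bar>minkowski x x\<bar> * indicator {0<..} (fst q)) *\<^sub>R
            (fourier_kernel f (x, orbit x q) * extend \<phi> (orbit x q))"
      proof (cases "0 < fst q")
        case True
        obtain a \<theta> where q: "q = (a, \<theta>)" and a: "0 < a" using True by (cases q) auto
        let ?c = "of_real (haar_weight q * a * (1 / (2 * pi) * (a * ?r))) * \<phi> (orbit x q)"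
        have "haar_weight q *\<^sub>R (f (b, q) * irrep (b, q) (duflo_moore \<phi>) x) =
            ?c * (slice f q b * exp (\<i> * of_real (minkowski x b)))" for b
          using a by (simp add: q irrep_orbit duflo_moore_orbit slice_def mem_P scaleR_conv_of_real)
        then have "(LINT b|lborel. haar_weight q *\<^sub>R (f (b, q) * irrep (b, q) (duflo_moore \<phi>) x)) = ?c * ?\<Phi> q"
          by (simp add: fourier_minkowski_def)
        \<comment> \<open>Both sides equal r/(2 pi a); the right side is written as polar density
          times kernel prefactor.\<close>
        also have "haar_weight q * a * (1 / (2 * pi) * (a * ?r)) =
            a * \<bar>minkowski x x\<bar> * (1 / (2 * pi) / (a\<^sup>2 * ?r))"
        proof -
          have "\<bar>minkowski x x\<bar> = ?r * ?r" by simp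
          then show ?thesis using a r by (simp add: q haar_weight_def eval_nat_numeral field_simps)
        qed
        also have "of_real (a * \<bar>minkowski x x\<bar> * (1 / (2 * pi) / (a\<^sup>2 * ?r))) * \<phi> (orbit x q) * ?\<Phi> q =
            (a * \<bar>minkowski x x\<bar>) *\<^sub>R (of_real (1 / (2 * pi) / (a\<^sup>2 * ?r)) * ?\<Phi> q * \<phi> (orbit x q))"
          by (simp only: scaleR_conv_of_real of_real_mult mult_ac)
        also have "of_real (1 / (2 * pi) / (a\<^sup>2 * ?r)) * ?\<Phi> q * \<phi> (orbit x q) =
            fourier_kernel f (x, orbit x q) * extend \<phi> (orbit x q)"
          using fourier_kernel_orbit[OF x True] extend_orbit[OF x True] by (simp add: q)
        finally show ?thesis
          using a by (simp add: q)
      qed (simp add: haar_weight_def)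
    qed
    also have "\<dots> = (LINT y|M. fourier_kernel f (x, y) * extend \<phi> y)"
      by (rule integral_cone_polar[OF x, symmetric]) measurable
    also have "\<dots> = int_op M (fourier_kernel f) \<phi> x"
      unfolding int_op_def by (intro Bochner_Integration.integral_cong) (auto simp: extend_def space_M)
    finally show "(LINT p|haar. f p * irrep p (duflo_moore \<phi>) x) = int_op M (fourier_kernel f) \<phi> x" .
  qed
qed

end

section \<open>Uniqueness and existence of the Fourier transform\<close>

lemma l2_norm_tendsto_dominated:
  assumes f: "f \<in> L2 M" and g: "\<And>n. g n \<in> borel_measurable M"
    and le: "\<And>n x. x \<in> space M \<Longrightarrow> norm (g n x) \<le> norm (f x)"
    and lim: "\<And>x. x \<in> space M \<Longrightarrow> (\<lambda>n. g n x) \<longlonglongrightarrow> f x"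
  shows "\<And>n. g n \<in> L2 M" and "(\<lambda>n. l2_norm M (\<lambda>x. g n x - f x)) \<longlonglongrightarrow> 0"
proof -
  have [measurable]: "f \<in> borel_measurable M" "\<And>n. g n \<in> borel_measurable M"
    using f g by (auto intro: L2_measurable)
  show "g n \<in> L2 M" for n
    by (rule L2_I[OF g], rule Bochner_Integration.integrable_bound[OF L2_integrable[OF f]])
      (auto intro!: power_mono le)
  have "(\<lambda>n. LINT x|M. (norm (g n x - f x))\<^sup>2) \<longlonglongrightarrow> (LINT x|M. 0)"
  proof (rule integral_dominated_convergence[where w="\<lambda>x. 4 * (norm (f x))\<^sup>2"])
    show "AE x in M. (\<lambda>n. (norm (g n x - f x))\<^sup>2) \<longlonglongrightarrow> 0"
    proof (rule AE_I2)
      fix x assume "x \<in> space M"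
      from lim[OF this] have "(\<lambda>n. (norm (g n x - f x))\<^sup>2) \<longlonglongrightarrow> (norm (f x - f x))\<^sup>2"
        by (intro tendsto_intros)
      then show "(\<lambda>n. (norm (g n x - f x))\<^sup>2) \<longlonglongrightarrow> 0" by simp
    qed
    show "AE x in M. norm ((norm (g n x - f x))\<^sup>2) \<le> 4 * (norm (f x))\<^sup>2" for n
    proof (rule AE_I2)
      fix x assume "x \<in> space M"
      then have "norm (g n x - f x) \<le> 2 * norm (f x)"
        using le[of x n] norm_triangle_ineq4[of "g n x" "f x"] by linarith
      then have "(norm (g n x - f x))\<^sup>2 \<le> (2 * norm (f x))\<^sup>2" by (intro power_mono) auto
      then show "norm ((norm (g n x - f x))\<^sup>2) \<le> 4 * (norm (f x))\<^sup>2" by (simp add: power_mult_distrib)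
    qed
  qed (use f in \<open>auto simp: L2_integrable\<close>)
  then have "(\<lambda>n. sqrt (LINT x|M. (norm (g n x - f x))\<^sup>2)) \<longlonglongrightarrow> sqrt (LINT x|M. 0)"
    by (intro tendsto_real_sqrt)
  then show "(\<lambda>n. l2_norm M (\<lambda>x. g n x - f x)) \<longlonglongrightarrow> 0"
    by (simp add: l2_norm_def)
qed

lemma L2_lincomb [intro]: "f \<in> L2 M \<Longrightarrow> g \<in> L2 M \<Longrightarrow> (\<lambda>x. \<alpha> * f x + \<beta> * g x) \<in> L2 M"
  by (intro L2_add L2_scale)

lemma l2_norm_diff_lincomb_le:
  assumes "u \<in> L2 M" "v \<in> L2 M" "w \<in> L2 M"
  shows "l2_norm M (\<lambda>x. u x - (\<alpha> * v x + \<beta> * w x)) \<le>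
    l2_norm M u + (norm \<alpha> * l2_norm M v + norm \<beta> * l2_norm M w)"
proof -
  define s where "s x = \<alpha> * v x + \<beta> * w x" for x
  have s: "s \<in> L2 M" unfolding s_def using assms by auto
  have "l2_norm M (\<lambda>x. u x - s x) \<le> l2_norm M u + l2_norm M s"
    using l2_norm_triangle[OF assms(1) L2_uminus[OF s]] by simp
  moreover have "l2_norm M s \<le> l2_norm M (\<lambda>x. \<alpha> * v x) + l2_norm M (\<lambda>x. \<beta> * w x)"
    unfolding s_def using assms by (intro l2_norm_triangle L2_scale)
  ultimately show ?thesis by (simp add: l2_norm_scale s_def)
qed

lemma slice_diff: "slice (\<lambda>p. f p - g p) q = (\<lambda>b. slice f q b - slice g q b)"
  by (auto simp: slice_def scaleR_diff_right)

text \<open>The point (x, y) selects one particular slice through \<open>orbit_inv\<close>, so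
  integrability of every slice, not merely of almost every one, gives an identity at all points.
  Truncated functions satisfy this.\<close>

lemma fourier_kernel_diff:
  assumes "\<And>q. integrable lborel (slice f q)" "\<And>q. integrable lborel (slice g q)"
  shows "fourier_kernel (\<lambda>p. f p - g p) = (\<lambda>z. fourier_kernel f z - fourier_kernel g z)"
  using integrable_mult_exp_minkowski[OF assms(1)] integrable_mult_exp_minkowski[OF assms(2)]
  by (auto simp: fourier_kernel_def Let_def slice_diff fourier_minkowski_def
      left_diff_distrib right_diff_distrib)

text \<open>The cut at a = 1/(n+1) keeps away from the boundary of \<open>P\<close>, where the Haar
  density blows up. The bounds on p and on the value of f make every slice bounded with bounded
  support. Using \<open>Suc n\<close> keeps the divisor positive at n = 0.\<close>

definition truncate :: "nat \<Rightarrow> (affine_poincare \<Rightarrow> complex) \<Rightarrow> affine_poincare \<Rightarrow> complex" where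
  "truncate n f p = (if norm p \<le> real (Suc n) \<and> 1 / real (Suc n) \<le> fst (snd p) \<and>
     norm (f p) \<le> real (Suc n) then f p else 0)"

lemma truncate_measurable:
  assumes f [measurable]: "f \<in> borel_measurable haar"
  shows "truncate n f \<in> borel_measurable haar"
proof -
  have [measurable]: "(\<lambda>p::affine_poincare. norm p) \<in> borel_measurable haar"
    "(\<lambda>p::affine_poincare. fst (snd p)) \<in> borel_measurable haar"
    by (intro measurable_borel_haar; measurable)+
  show ?thesis unfolding truncate_def by measurable
qed

lemma truncate_tendsto:
  assumes "p \<in> P" shows "(\<lambda>n. truncate n f p) \<longlonglongrightarrow> f p"
proof (rule tendsto_eventually)
  obtain N where N: "max (norm p) (max (1 / fst (snd p)) (norm (f p))) \<le> real N"
    using real_arch_simple by blast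
  show "\<forall>\<^sub>F n in sequentially. truncate n f p = f p"
    using eventually_ge_at_top[of N]
  proof eventually_elim
    case (elim n)
    then have "real N \<le> real (Suc n)" by simp
    then have "norm p \<le> real (Suc n)" "1 / fst (snd p) \<le> real (Suc n)" "norm (f p) \<le> real (Suc n)"
      using N by linarith+
    then show ?case using assms by (simp add: truncate_def mem_P field_simps)
  qed
qed

lemma integrable_bounded_support:
  fixes g :: "'a::euclidean_space \<Rightarrow> complex"
  assumes "g \<in> borel_measurable borel" "\<And>x. norm (g x) \<le> C" "\<And>x. r < norm x \<Longrightarrow> g x = 0"
  shows "integrable lborel g"
proof (rule Bochner_Integration.integrable_bound)
  show "integrable lborel (\<lambda>x. C * indicator (cball (0::'a) r) x)"
    by (intro integrable_mult_right integrable_real_indicator emeasure_bounded_finite) auto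
  have "norm (g x) \<le> norm (C * indicator (cball (0::'a) r) x)" for x
    using assms(2)[of x] assms(3)[of x] by (cases "norm x \<le> r") (auto simp: indicator_def)
  then show "AE x in lborel. norm (g x) \<le> norm (C * indicator (cball (0::'a) r) x)" by simp
qed (use assms in simp)

lemma integrable_slice_truncate:
  assumes f: "f \<in> borel_measurable haar"
  shows "integrable lborel (slice (truncate n f) q)"
proof (rule integrable_bounded_support[where C="real (Suc n)" and r="real (Suc n)"])
  have "truncate n f \<in> borel_measurable haar" using f by (rule truncate_measurable)
  then show "slice (truncate n f) q \<in> borel_measurable borel" by measurable
  show "norm (slice (truncate n f) q b) \<le> real (Suc n)" for b
    by (auto simp: slice_def truncate_def indicator_def)
  show "slice (truncate n f) q b = 0" if "real (Suc n) < norm b" for b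
    using that norm_fst_le[of b q] by (auto simp: slice_def truncate_def)
qed

lemma integrable_truncate:
  assumes f: "f \<in> borel_measurable haar"
  shows "integrable haar (truncate n f)"
proof -
  have t: "truncate n f \<in> borel_measurable haar" using f by (rule truncate_measurable)
  let ?N = "real (Suc n)"
  have "integrable lborel (\<lambda>p. haar_weight (snd p) *\<^sub>R truncate n f p)"
  proof (rule integrable_bounded_support[where C="?N ^ 3 * ?N" and r="?N"])
    have "(\<lambda>p. haar_weight (snd p) *\<^sub>R (indicator P p *\<^sub>R truncate n f p)) \<in> borel_measurable borel"
      using haar_extend[OF t] by measurable
    also have "(\<lambda>p. haar_weight (snd p) *\<^sub>R (indicator P p *\<^sub>R truncate n f p)) =
        (\<lambda>p. haar_weight (snd p) *\<^sub>R truncate n f p)"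
      by (auto simp: haar_weight_def mem_P)
    finally show "(\<lambda>p. haar_weight (snd p) *\<^sub>R truncate n f p) \<in> borel_measurable borel" .
    fix p :: affine_poincare
    show "haar_weight (snd p) *\<^sub>R truncate n f p = 0" if "?N < norm p"
      using that by (simp add: truncate_def)
    show "norm (haar_weight (snd p) *\<^sub>R truncate n f p) \<le> ?N ^ 3 * ?N"
    proof (cases "truncate n f p = 0")
      case False
      then have p: "1 / ?N \<le> fst (snd p)" "norm (truncate n f p) \<le> ?N"
        by (auto simp: truncate_def split: if_splits)
      have "0 < 1 / ?N" by simp
      then have a: "0 < fst (snd p)" using p(1) by linarith
      have "1 / fst (snd p) \<le> ?N" using p(1) a by (simp add: field_simps)
      then have "(1 / fst (snd p)) ^ 3 \<le> ?N ^ 3" using a by (intro power_mono) auto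
      then have "haar_weight (snd p) \<le> ?N ^ 3" using a by (simp add: haar_weight_def power_one_over)
      then have "haar_weight (snd p) * norm (truncate n f p) \<le> ?N ^ 3 * ?N"
        using p by (intro mult_mono) auto
      then show ?thesis by simp
    qed simp
  qed
  then show ?thesis by (simp add: integrable_haar_iff[OF t])
qed

section \<open>The Fourier transform on one cone\<close>

context cone_space
begin

text \<open>Cutting \<phi> off where |<x;x>| exceeds n makes the Duflo-Moore multiplier bounded on
  the remaining set, and dominated convergence gives the approximation.\<close>

lemma duflo_moore_domain_dense:
  assumes \<phi>: "\<phi> \<in> L2 M"
  obtains s where "\<And>n. s n \<in> duflo_moore_domain i j" "(\<lambda>n. l2_norm M (\<lambda>x. s n x - \<phi> x)) \<longlonglongrightarrow> 0"
proof -
  have [measurable]: "\<phi> \<in> borel_measurable M" using \<phi> by (rule L2_measurable)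
  define s where "s n x = of_bool (\<bar>minkowski x x\<bar> \<le> real n) * \<phi> x" for n :: nat and x
  have ind: "(\<lambda>x. of_bool (\<bar>minkowski x x\<bar> \<le> real n) * c x) \<in> borel_measurable M"
    if "c \<in> borel_measurable borel" for n :: nat and c :: "plane \<Rightarrow> complex"
    using that unfolding of_bool_def by (intro measurable_borel_M) measurable
  have meas: "s n \<in> borel_measurable M" for n
    unfolding s_def using ind[of "\<lambda>_. 1" n] by (intro borel_measurable_times) auto
  have lim: "(\<lambda>n. s n x) \<longlonglongrightarrow> \<phi> x" for x
  proof (rule tendsto_eventually)
    obtain N where "\<bar>minkowski x x\<bar> \<le> real N" using real_arch_simple by blast
    then show "\<forall>\<^sub>F n in sequentially. s n x = \<phi> x"
      by (intro eventually_sequentiallyI[of N]) (auto simp: s_def intro: order_trans)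
  qed
  have le: "norm (s n x) \<le> norm (\<phi> x)" for n x
    by (simp add: s_def norm_mult)
  note s = l2_norm_tendsto_dominated[OF \<phi> meas le lim]
  have "s n \<in> duflo_moore_domain i j" for n
  proof -
    have "(\<lambda>x. of_bool (\<bar>minkowski x x\<bar> \<le> real n) * of_real (1 / (2 * pi) * sqrt \<bar>minkowski x x\<bar>) * \<phi> x) \<in> L2 M"
    proof (rule L2_mult_bounded[OF \<phi>])
      show "(\<lambda>x. of_bool (\<bar>minkowski x x\<bar> \<le> real n) * complex_of_real (1 / (2 * pi) * sqrt \<bar>minkowski x x\<bar>))
          \<in> borel_measurable M"
        by (rule ind) measurable
      show "norm (of_bool (\<bar>minkowski x x\<bar> \<le> real n) * complex_of_real (1 / (2 * pi) * sqrt \<bar>minkowski x x\<bar>))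
          \<le> 1 / (2 * pi) * sqrt (real n)" for x
        by (auto simp: norm_mult norm_divide intro!: divide_right_mono)
    qed
    then have "duflo_moore (s n) \<in> L2 M"
      by (simp add: duflo_moore_def s_def mult.assoc mult.left_commute)
    then show ?thesis using s(1) by (simp add: duflo_moore_domain_def)
  qed
  then show ?thesis using that s(2) by blast
qed

text \<open>On the Duflo-Moore domain the operator on the left is the integral operator whose kernel
  belongs to d = h - (\<alpha> f + \<beta> g), and that kernel has norm at most that of d; density
  does the rest. An estimate, rather than an identity for d = 0, is what approximating sequences
  require, since there d is only small.\<close>

lemma fourier_L1_L2_lincomb_le:
  assumes H: "is_fourier_L1_L2 h i j C" and F: "is_fourier_L1_L2 f i j A" and G: "is_fourier_L1_L2 g i j B"
    and \<phi>: "\<phi> \<in> L2 M"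
  shows "l2_norm M (\<lambda>x. C \<phi> x - (\<alpha> * A \<phi> x + \<beta> * B \<phi> x)) \<le>
    l2_norm haar (\<lambda>p. h p - (\<alpha> * f p + \<beta> * g p)) * l2_norm M \<phi>"
proof -
  define d where "d p = h p - (\<alpha> * f p + \<beta> * g p)" for p
  define D where "D \<phi> x = C \<phi> x - (\<alpha> * A \<phi> x + \<beta> * B \<phi> x)" for \<phi> x
  have int: "integrable haar h" "integrable haar f" "integrable haar g"
    and L2: "h \<in> L2 haar" "f \<in> L2 haar" "g \<in> L2 haar"
    and bd: "bounded_operator M C" "bounded_operator M A" "bounded_operator M B"
    using H F G by (auto simp: is_fourier_L1_L2_def hilbert_schmidt_def)
  have d: "integrable haar d" "d \<in> L2 haar"
    unfolding d_def using int L2 by (auto intro: L2_diff L2_lincomb)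
  have D: "bounded_operator M D"
    unfolding D_def using bounded_operator_minus[OF bd(1) bounded_operator_lincomb[OF bd(2,3)]] .
  have dom: "l2_norm M (D \<psi>) \<le> l2_norm haar d * l2_norm M \<psi>" if \<psi>: "\<psi> \<in> duflo_moore_domain i j" for \<psi>
  proof -
    have \<psi>L2: "\<psi> \<in> L2 M" "duflo_moore \<psi> \<in> L2 M" using \<psi> by (auto simp: duflo_moore_domain_def)
    have "AE x in M. C \<psi> x = (LINT p|haar. h p * irrep p (duflo_moore \<psi>) x)"
      "AE x in M. A \<psi> x = (LINT p|haar. f p * irrep p (duflo_moore \<psi>) x)"
      "AE x in M. B \<psi> x = (LINT p|haar. g p * irrep p (duflo_moore \<psi>) x)"
      using H F G \<psi> by (auto simp: is_fourier_L1_L2_def)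
    moreover note AE_integrable_irrep[OF int(1) \<psi>L2(2)] AE_integrable_irrep[OF int(2) \<psi>L2(2)]
      AE_integrable_irrep[OF int(3) \<psi>L2(2)] fourier_integral_kernel[OF d(1) \<psi>]
    ultimately have "AE x in M. D \<psi> x = int_op M (fourier_kernel d) \<psi> x"
    proof eventually_elim
      case (elim x)
      let ?R = "\<lambda>p. irrep p (duflo_moore \<psi>) x"
      have "(LINT p|haar. d p * ?R p) = (LINT p|haar. h p * ?R p - (\<alpha> * (f p * ?R p) + \<beta> * (g p * ?R p)))"
        by (simp add: d_def algebra_simps)
      also have "\<dots> = D \<psi> x"
        using elim(1-6) by (simp add: D_def)
      finally show ?case using elim(7) by simp
    qed
    then have "l2_norm M (D \<psi>) = l2_norm M (int_op M (fourier_kernel d) \<psi>)"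
      using d \<psi>L2 by (intro l2_norm_cong_AE L2_measurable bounded_operator_L2[OF D] int_op_L2 fourier_kernel_L2)
    also have "\<dots> \<le> l2_norm (M \<Otimes>\<^sub>M M) (fourier_kernel d) * l2_norm M \<psi>"
      using d \<psi>L2 by (intro int_op_norm_le fourier_kernel_L2)
    also have "\<dots> \<le> l2_norm haar d * l2_norm M \<psi>"
      using d by (intro mult_right_mono l2_norm_fourier_kernel_le) auto
    finally show ?thesis .
  qed
  obtain s where s: "\<And>n. s n \<in> duflo_moore_domain i j" "(\<lambda>n. l2_norm M (\<lambda>x. s n x - \<phi> x)) \<longlonglongrightarrow> 0"
    using duflo_moore_domain_dense[OF \<phi>] by blast
  have sL2: "s n \<in> L2 M" for n using s(1)[of n] by (simp add: duflo_moore_domain_def)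
  obtain c where c: "0 \<le> c" "\<And>f. f \<in> L2 M \<Longrightarrow> l2_norm M (D f) \<le> c * l2_norm M f"
    using bounded_operator_bound[OF D] by blast
  let ?e = "\<lambda>n. l2_norm M (\<lambda>x. s n x - \<phi> x)"
  \<comment> \<open>The uncontrolled bound c of D multiplies only the approximation error, so it
    disappears in the limit and the constant valid on the dense domain survives.\<close>
  have "l2_norm M (D \<phi>) \<le> c * ?e n + l2_norm haar d * (?e n + l2_norm M \<phi>)" for n
  proof -
    have "l2_norm M (D \<phi>) \<le> l2_norm M (\<lambda>x. D \<phi> x - D (s n) x) + l2_norm M (D (s n))"
      by (intro l2_norm_triangle_minus bounded_operator_L2[OF D] \<phi> sL2)
    also have "l2_norm M (\<lambda>x. D \<phi> x - D (s n) x) \<le> c * ?e n"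
      using c(2)[OF L2_diff[OF \<phi> sL2[of n]]]
      by (simp add: bounded_operator_diff_norm[OF D \<phi> sL2] l2_norm_minus_commute[of M \<phi>])
    also have "l2_norm M (D (s n)) \<le> l2_norm haar d * l2_norm M (s n)"
      by (rule dom) (rule s)
    also have "l2_norm haar d * l2_norm M (s n) \<le> l2_norm haar d * (?e n + l2_norm M \<phi>)"
      by (intro mult_left_mono l2_norm_triangle_minus sL2 \<phi>) simp
    finally show ?thesis by simp
  qed
  moreover have "(\<lambda>n. c * ?e n + l2_norm haar d * (?e n + l2_norm M \<phi>)) \<longlonglongrightarrow>
      c * 0 + l2_norm haar d * (0 + l2_norm M \<phi>)"
    by (intro tendsto_intros s)
  ultimately have "l2_norm M (D \<phi>) \<le> c * 0 + l2_norm haar d * (0 + l2_norm M \<phi>)"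
    by (intro LIMSEQ_le_const) auto
  then show ?thesis by (simp add: D_def[abs_def] d_def[abs_def])
qed

text \<open>For \<open>\<alpha> = 1\<close> and \<open>\<beta> = 0\<close> this is the uniqueness of the Fourier transform.\<close>

lemma is_fourier_lincomb:
  assumes H: "is_fourier h i j C" and F: "is_fourier f i j A" and G: "is_fourier g i j B"
    and L2: "h \<in> L2 haar" "f \<in> L2 haar" "g \<in> L2 haar"
    and eq: "\<And>p. h p = \<alpha> * f p + \<beta> * g p" and \<phi>: "\<phi> \<in> L2 M"
  shows "AE x in M. C \<phi> x = \<alpha> * A \<phi> x + \<beta> * B \<phi> x"
proof -
  obtain h' C' where H': "\<And>n. is_fourier_L1_L2 (h' n) i j (C' n)"
    "(\<lambda>n. l2_norm haar (\<lambda>p. h' n p - h p)) \<longlonglongrightarrow> 0"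
    "(\<lambda>n. hs_norm M (\<lambda>\<phi> x. C' n \<phi> x - C \<phi> x)) \<longlonglongrightarrow> 0"
    using H unfolding is_fourier_def by blast
  obtain f' A' where F': "\<And>n. is_fourier_L1_L2 (f' n) i j (A' n)"
    "(\<lambda>n. l2_norm haar (\<lambda>p. f' n p - f p)) \<longlonglongrightarrow> 0"
    "(\<lambda>n. hs_norm M (\<lambda>\<phi> x. A' n \<phi> x - A \<phi> x)) \<longlonglongrightarrow> 0"
    using F unfolding is_fourier_def by blast
  obtain g' B' where G': "\<And>n. is_fourier_L1_L2 (g' n) i j (B' n)"
    "(\<lambda>n. l2_norm haar (\<lambda>p. g' n p - g p)) \<longlonglongrightarrow> 0"
    "(\<lambda>n. hs_norm M (\<lambda>\<phi> x. B' n \<phi> x - B \<phi> x)) \<longlonglongrightarrow> 0"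
    using G unfolding is_fourier_def by blast
  have hs: "hilbert_schmidt M C" "hilbert_schmidt M A" "hilbert_schmidt M B"
    using H F G by (auto simp: is_fourier_def)
  have hs': "hilbert_schmidt M (C' n)" "hilbert_schmidt M (A' n)" "hilbert_schmidt M (B' n)" for n
    using H'(1) F'(1) G'(1) by (auto simp: is_fourier_L1_L2_def)
  have L2': "h' n \<in> L2 haar" "f' n \<in> L2 haar" "g' n \<in> L2 haar" for n
    using H'(1) F'(1) G'(1) by (auto simp: is_fourier_L1_L2_def)
  have img: "T \<phi> \<in> L2 M" if "hilbert_schmidt M T" for T
    using that \<phi> by (auto simp: hilbert_schmidt_def intro: bounded_operator_L2)
  let ?N = "l2_norm M \<phi>"
  define \<epsilon> where "\<epsilon> n = l2_norm haar (\<lambda>p. h' n p - h p) +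
    (norm \<alpha> * l2_norm haar (\<lambda>p. f' n p - f p) + norm \<beta> * l2_norm haar (\<lambda>p. g' n p - g p))" for n
  define \<delta> where "\<delta> n = hs_norm M (\<lambda>\<phi> x. C' n \<phi> x - C \<phi> x) * ?N +
    (norm \<alpha> * (hs_norm M (\<lambda>\<phi> x. A' n \<phi> x - A \<phi> x) * ?N) + norm \<beta> * (hs_norm M (\<lambda>\<phi> x. B' n \<phi> x - B \<phi> x) * ?N))" for n
  have "l2_norm M (\<lambda>x. C \<phi> x - (\<alpha> * A \<phi> x + \<beta> * B \<phi> x)) \<le> \<epsilon> n * ?N + \<delta> n" for n
  proof -
    define u where "u x = C' n \<phi> x - (\<alpha> * A' n \<phi> x + \<beta> * B' n \<phi> x)" for x
    define v where "v x = (C' n \<phi> x - C \<phi> x) - (\<alpha> * (A' n \<phi> x - A \<phi> x) + \<beta> * (B' n \<phi> x - B \<phi> x))" for x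
    have uv: "u \<in> L2 M" "v \<in> L2 M"
      unfolding u_def v_def by (intro L2_diff L2_lincomb img hs hs')+
    have "(\<lambda>x. C \<phi> x - (\<alpha> * A \<phi> x + \<beta> * B \<phi> x)) = (\<lambda>x. u x + - v x)"
      by (auto simp: u_def v_def algebra_simps)
    then have "l2_norm M (\<lambda>x. C \<phi> x - (\<alpha> * A \<phi> x + \<beta> * B \<phi> x)) \<le> l2_norm M u + l2_norm M v"
      using l2_norm_triangle[OF uv(1) L2_uminus[OF uv(2)]] by simp
    moreover have "l2_norm M u \<le> \<epsilon> n * ?N"
    proof -
      have "l2_norm M u \<le> l2_norm haar (\<lambda>p. h' n p - (\<alpha> * f' n p + \<beta> * g' n p)) * ?N"
        unfolding u_def by (rule fourier_L1_L2_lincomb_le[OF H'(1) F'(1) G'(1) \<phi>])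
      \<comment> \<open>Subtracting h - (\<alpha> f + \<beta> g), which is 0 by hypothesis, leaves
        only the three approximation errors.\<close>
      also have "(\<lambda>p. h' n p - (\<alpha> * f' n p + \<beta> * g' n p)) =
          (\<lambda>p. (h' n p - h p) - (\<alpha> * (f' n p - f p) + \<beta> * (g' n p - g p)))"
        by (auto simp: eq algebra_simps)
      also have "l2_norm haar \<dots> * ?N \<le> \<epsilon> n * ?N"
        unfolding \<epsilon>_def by (intro mult_right_mono l2_norm_diff_lincomb_le L2_diff L2 L2') simp
      finally show ?thesis .
    qed
    moreover have "l2_norm M v \<le> \<delta> n"
    proof -
      have "l2_norm M v \<le> l2_norm M (\<lambda>x. C' n \<phi> x - C \<phi> x) +
          (norm \<alpha> * l2_norm M (\<lambda>x. A' n \<phi> x - A \<phi> x) + norm \<beta> * l2_norm M (\<lambda>x. B' n \<phi> x - B \<phi> x))"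
        unfolding v_def by (intro l2_norm_diff_lincomb_le L2_diff img hs hs')
      also have "\<dots> \<le> \<delta> n"
        unfolding \<delta>_def
        by (intro add_mono mult_left_mono l2_norm_diff_le_hs_norm hs hs' \<phi>) auto
      finally show ?thesis .
    qed
    ultimately show ?thesis by linarith
  qed
  moreover have "(\<lambda>n. \<epsilon> n * ?N + \<delta> n) \<longlonglongrightarrow>
      (0 + (norm \<alpha> * 0 + norm \<beta> * 0)) * ?N + (0 * ?N + (norm \<alpha> * (0 * ?N) + norm \<beta> * (0 * ?N)))"
    unfolding \<epsilon>_def \<delta>_def by (intro tendsto_intros H' F' G')
  ultimately have "l2_norm M (\<lambda>x. C \<phi> x - (\<alpha> * A \<phi> x + \<beta> * B \<phi> x)) \<le> 0"
    by (intro LIMSEQ_le_const[of "\<lambda>n. \<epsilon> n * ?N + \<delta> n"]) auto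
  then show ?thesis
    by (intro l2_norm_diff_eq_0 img hs L2_lincomb antisym) auto
qed

lemma hs_norm_int_op_diff_le:
  assumes K: "K \<in> L2 (M \<Otimes>\<^sub>M M)" and L: "L \<in> L2 (M \<Otimes>\<^sub>M M)"
  shows "hs_norm M (\<lambda>\<phi> x. int_op M K \<phi> x - int_op M L \<phi> x) \<le> l2_norm (M \<Otimes>\<^sub>M M) (\<lambda>p. K p - L p)"
proof -
  have "(\<Sum>\<^sub>\<infinity>e\<in>some_onb M. (l2_norm M (\<lambda>x. int_op M K e x - int_op M L e x))\<^sup>2) \<le>
      (l2_norm (M \<Otimes>\<^sub>M M) (\<lambda>p. K p - L p))\<^sup>2"
  proof (rule kernel_infsum_le)
    show "bounded_operator M (\<lambda>\<phi> x. int_op M K \<phi> x - int_op M L \<phi> x)"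
      by (intro bounded_operator_minus bounded_operator_int_op K L)
    show "AE x in M. int_op M K \<phi> x - int_op M L \<phi> x = int_op M (\<lambda>p. K p - L p) \<phi> x" if "\<phi> \<in> L2 M" for \<phi>
      using int_op_diff[OF K L that] by eventually_elim simp
  qed (intro L2_diff K L)
  then show ?thesis by (simp add: hs_norm_def real_le_lsqrt)
qed

text \<open>Truncations of f are integrable and converge to f in mean square, and by the contraction
  estimate their kernels form a Cauchy sequence. Completing kernels instead of operators makes the
  limit an integral operator with the right norm bound at once.\<close>

lemma is_fourier_exists:
  assumes f: "f \<in> L2 haar"
  obtains K where "K \<in> L2 (M \<Otimes>\<^sub>M M)" "l2_norm (M \<Otimes>\<^sub>M M) K \<le> l2_norm haar f"
    "is_fourier f i j (int_op M K)"
proof -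
  have f_meas: "f \<in> borel_measurable haar" using f by (rule L2_measurable)
  define F where "F n = truncate n f" for n
  have meas: "F n \<in> borel_measurable haar" for n
    unfolding F_def by (rule truncate_measurable[OF f_meas])
  have lim: "(\<lambda>n. F n p) \<longlonglongrightarrow> f p" if "p \<in> space haar" for p
    using truncate_tendsto that by (simp add: F_def space_haar)
  have le: "norm (F n p) \<le> norm (f p)" for n p by (simp add: F_def truncate_def)
  note F = l2_norm_tendsto_dominated[OF f meas le lim]
  have int: "integrable haar (F n)" for n
    unfolding F_def by (rule integrable_truncate[OF f_meas])
  have slice: "integrable lborel (slice (F n) q)" for n q
    unfolding F_def by (rule integrable_slice_truncate[OF f_meas])
  define k where "k n = fourier_kernel (F n)" for n
  have k: "k n \<in> L2 (M \<Otimes>\<^sub>M M)" "l2_norm (M \<Otimes>\<^sub>M M) (k n) \<le> l2_norm haar (F n)" for n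
    unfolding k_def using fourier_kernel_L2[OF int F(1)] l2_norm_fourier_kernel_le[OF int F(1)] by auto
  have k_diff: "l2_norm (M \<Otimes>\<^sub>M M) (\<lambda>z. k m z - k n z) \<le> l2_norm haar (\<lambda>p. F m p - F n p)" for m n
    using l2_norm_fourier_kernel_le[of "\<lambda>p. F m p - F n p"] int F(1)
    unfolding k_def fourier_kernel_diff[OF slice slice, symmetric] by auto
  obtain K where K: "K \<in> L2 (M \<Otimes>\<^sub>M M)" "(\<lambda>n. l2_norm (M \<Otimes>\<^sub>M M) (\<lambda>z. k n z - K z)) \<longlonglongrightarrow> 0"
  proof (rule L2_complete)
    show "k n \<in> L2 (M \<Otimes>\<^sub>M M)" for n by (rule k)
    fix e :: real assume "0 < e"
    then have "\<forall>\<^sub>F n in sequentially. l2_norm haar (\<lambda>p. F n p - f p) < e / 2"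
      using F(2) by (intro order_tendstoD) auto
    then obtain N where N: "\<And>n. n \<ge> N \<Longrightarrow> l2_norm haar (\<lambda>p. F n p - f p) < e / 2"
      by (auto simp: eventually_sequentially)
    show "\<exists>N. \<forall>m\<ge>N. \<forall>n\<ge>N. l2_norm (M \<Otimes>\<^sub>M M) (\<lambda>z. k m z - k n z) < e"
    proof (intro exI[of _ N] allI impI)
      fix m n assume "m \<ge> N" "n \<ge> N"
      have "l2_norm (M \<Otimes>\<^sub>M M) (\<lambda>z. k m z - k n z) \<le> l2_norm haar (\<lambda>p. F m p - F n p)" by (rule k_diff)
      also have "\<dots> \<le> l2_norm haar (\<lambda>p. F m p - f p) + l2_norm haar (\<lambda>p. f p - F n p)"
        by (intro l2_norm_triangle_diff F f)
      also have "\<dots> < e"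
        using N[OF \<open>m \<ge> N\<close>] N[OF \<open>n \<ge> N\<close>] by (simp add: l2_norm_minus_commute[of haar f])
      finally show "l2_norm (M \<Otimes>\<^sub>M M) (\<lambda>z. k m z - k n z) < e" .
    qed
  qed
  have "l2_norm (M \<Otimes>\<^sub>M M) K \<le> l2_norm (M \<Otimes>\<^sub>M M) (\<lambda>z. k n z - K z) +
      (l2_norm haar (\<lambda>p. F n p - f p) + l2_norm haar f)" for n
  proof -
    have "l2_norm (M \<Otimes>\<^sub>M M) K \<le> l2_norm (M \<Otimes>\<^sub>M M) (\<lambda>z. K z - k n z) + l2_norm (M \<Otimes>\<^sub>M M) (k n)"
      by (intro l2_norm_triangle_minus K k)
    moreover have "l2_norm haar (F n) \<le> l2_norm haar (\<lambda>p. F n p - f p) + l2_norm haar f"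
      by (intro l2_norm_triangle_minus F f)
    ultimately show ?thesis
      using k(2)[of n] by (simp add: l2_norm_minus_commute[of _ K])
  qed
  moreover have "(\<lambda>n. l2_norm (M \<Otimes>\<^sub>M M) (\<lambda>z. k n z - K z) +
      (l2_norm haar (\<lambda>p. F n p - f p) + l2_norm haar f)) \<longlonglongrightarrow> 0 + (0 + l2_norm haar f)"
    by (intro tendsto_intros K F)
  ultimately have "l2_norm (M \<Otimes>\<^sub>M M) K \<le> 0 + (0 + l2_norm haar f)"
    by (intro LIMSEQ_le_const) auto
  moreover have "is_fourier f i j (int_op M K)"
    unfolding is_fourier_def
  proof (intro conjI exI allI)
    show "hilbert_schmidt M (int_op M K)" by (rule hilbert_schmidt_int_op[OF K(1)])
    show "is_fourier_L1_L2 (F n) i j (int_op M (k n))" for n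
      unfolding is_fourier_L1_L2_def
    proof (intro conjI ballI)
      show "hilbert_schmidt M (int_op M (k n))" by (rule hilbert_schmidt_int_op[OF k(1)])
      show "AE x in M. int_op M (k n) \<phi> x = (LINT p|haar. F n p * irrep p (duflo_moore \<phi>) x)"
        if "\<phi> \<in> duflo_moore_domain i j" for \<phi>
        using fourier_integral_kernel[OF int that, of n] unfolding k_def by eventually_elim simp
    qed (rule int, rule F)
    show "(\<lambda>n. l2_norm haar (\<lambda>p. F n p - f p)) \<longlonglongrightarrow> 0" by (rule F)
    show "(\<lambda>n. hs_norm M (\<lambda>\<phi> x. int_op M (k n) \<phi> x - int_op M K \<phi> x)) \<longlonglongrightarrow> 0"
    proof (rule tendsto_sandwich[OF _ _ tendsto_const K(2)])
      show "\<forall>\<^sub>F n in sequentially. 0 \<le> hs_norm M (\<lambda>\<phi> x. int_op M (k n) \<phi> x - int_op M K \<phi> x)"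
        by (intro always_eventually allI) (simp add: hs_norm_def infsum_nonneg)
    qed (intro always_eventually allI hs_norm_int_op_diff_le k K)
  qed
  ultimately show ?thesis using that K(1) by simp
qed

lemma is_fourier_fourier: "f \<in> L2 haar \<Longrightarrow> is_fourier f i j (fourier f i j)"
  unfolding fourier_def using is_fourier_exists[of f] by (metis someI)

lemma bounded_operator_fourier: "f \<in> L2 haar \<Longrightarrow> bounded_operator M (fourier f i j)"
  using is_fourier_fourier[of f] by (auto simp: is_fourier_def hilbert_schmidt_def)

text \<open>The choice in \<open>fourier\<close> need not be the integral operator constructed
  above; uniqueness transfers the kernel and its norm bound to whatever was chosen.\<close>

lemma fourier_kernel_exists:
  assumes f: "f \<in> L2 haar"
  obtains K where "K \<in> L2 (M \<Otimes>\<^sub>M M)" "l2_norm (M \<Otimes>\<^sub>M M) K \<le> l2_norm haar f"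
    "\<And>\<phi>. \<phi> \<in> L2 M \<Longrightarrow> AE x in M. fourier f i j \<phi> x = int_op M K \<phi> x"
proof -
  obtain K where K: "K \<in> L2 (M \<Otimes>\<^sub>M M)" "l2_norm (M \<Otimes>\<^sub>M M) K \<le> l2_norm haar f"
    "is_fourier f i j (int_op M K)"
    using is_fourier_exists[OF f] by blast
  have "AE x in M. fourier f i j \<phi> x = int_op M K \<phi> x" if "\<phi> \<in> L2 M" for \<phi>
    using is_fourier_lincomb[OF is_fourier_fourier[OF f] K(3) K(3) f f f, of 1 0, OF _ that] by simp
  then show ?thesis using that K by blast
qed

lemma fourier_lincomb:
  assumes "f \<in> L2 haar" "g \<in> L2 haar" "\<phi> \<in> L2 M"
  shows "AE x in M. fourier (\<lambda>p. \<alpha> * f p + \<beta> * g p) i j \<phi> x =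
    \<alpha> * fourier f i j \<phi> x + \<beta> * fourier g i j \<phi> x"
  using assms by (intro is_fourier_lincomb[of "\<lambda>p. \<alpha> * f p + \<beta> * g p" _ f _ g] is_fourier_fourier L2_lincomb) auto

end

section \<open>The pseudo-differential operator\<close>

context sigma_finite_measure
begin

definition adjoint_kernel :: "('a \<times> 'a \<Rightarrow> complex) \<Rightarrow> 'a \<times> 'a \<Rightarrow> complex" where
  "adjoint_kernel K = (\<lambda>(x, y). cnj (K (y, x)))"

lemma
  assumes K: "K \<in> L2 (M \<Otimes>\<^sub>M M)"
  shows adjoint_kernel_L2: "adjoint_kernel K \<in> L2 (M \<Otimes>\<^sub>M M)"
    and l2_norm_adjoint_kernel: "l2_norm (M \<Otimes>\<^sub>M M) (adjoint_kernel K) = l2_norm (M \<Otimes>\<^sub>M M) K"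
proof -
  interpret MM: pair_sigma_finite M M ..
  have [measurable]: "K \<in> borel_measurable (M \<Otimes>\<^sub>M M)" using K by (rule L2_measurable)
  have meas: "adjoint_kernel K \<in> borel_measurable (M \<Otimes>\<^sub>M M)"
    unfolding adjoint_kernel_def by measurable
  have "(\<integral>\<^sup>+z. ennreal ((norm (adjoint_kernel K z))\<^sup>2) \<partial>(M \<Otimes>\<^sub>M M)) =
      (\<integral>\<^sup>+z. ennreal ((norm (K z))\<^sup>2) \<partial>distr (M \<Otimes>\<^sub>M M) (M \<Otimes>\<^sub>M M) (\<lambda>(x, y). (y, x)))"
    by (subst nn_integral_distr) (auto simp: adjoint_kernel_def intro!: nn_integral_cong)
  also have "\<dots> = ennreal ((l2_norm (M \<Otimes>\<^sub>M M) K)\<^sup>2)"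
    unfolding MM.distr_pair_swap[symmetric] by (rule nn_integral_L2[OF K])
  finally have eq: "(\<integral>\<^sup>+z. ennreal ((norm (adjoint_kernel K z))\<^sup>2) \<partial>(M \<Otimes>\<^sub>M M)) =
      ennreal ((l2_norm (M \<Otimes>\<^sub>M M) K)\<^sup>2)" .
  show L2: "adjoint_kernel K \<in> L2 (M \<Otimes>\<^sub>M M)" using eq by (intro L2_bounded_I(1)[OF meas]) auto
  show "l2_norm (M \<Otimes>\<^sub>M M) (adjoint_kernel K) = l2_norm (M \<Otimes>\<^sub>M M) K"
    using eq unfolding nn_integral_L2[OF L2] by (simp add: power2_eq_iff_nonneg)
qed

lemma L2_tensor:
  assumes f: "f \<in> L2 M" and g: "g \<in> L2 M"
  shows "(\<lambda>(x, y). f x * g y) \<in> L2 (M \<Otimes>\<^sub>M M)"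
proof (rule L2_bounded_I(1))
  have [measurable]: "f \<in> borel_measurable M" "g \<in> borel_measurable M"
    using f g by (auto intro: L2_measurable)
  show "(\<lambda>(x, y). f x * g y) \<in> borel_measurable (M \<Otimes>\<^sub>M M)" by measurable
  have "(\<integral>\<^sup>+z. ennreal ((norm (case z of (x, y) \<Rightarrow> f x * g y))\<^sup>2) \<partial>(M \<Otimes>\<^sub>M M)) =
      (\<integral>\<^sup>+x. \<integral>\<^sup>+y. ennreal ((norm (f x))\<^sup>2) * ennreal ((norm (g y))\<^sup>2) \<partial>M \<partial>M)"
    by (subst nn_integral_fst[symmetric])
      (auto simp: norm_mult power_mult_distrib ennreal_mult' intro!: nn_integral_cong)
  also have "\<dots> = ennreal ((l2_norm M f)\<^sup>2 * (l2_norm M g)\<^sup>2)"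
    by (simp add: nn_integral_cmult nn_integral_multc nn_integral_L2 f g ennreal_mult')
  finally show "(\<integral>\<^sup>+z. ennreal ((norm (case z of (x, y) \<Rightarrow> f x * g y))\<^sup>2) \<partial>(M \<Otimes>\<^sub>M M)) \<le>
      ennreal ((l2_norm M f)\<^sup>2 * (l2_norm M g)\<^sup>2)" by simp
qed

lemma l2_inner_int_op:
  assumes K: "K \<in> L2 (M \<Otimes>\<^sub>M M)" and f: "f \<in> L2 M" and g: "g \<in> L2 M"
  shows "l2_inner M (int_op M K f) g = l2_inner M f (int_op M (adjoint_kernel K) g)"
proof -
  interpret MM: pair_sigma_finite M M ..
  have "integrable (M \<Otimes>\<^sub>M M) (\<lambda>z. K z * (case z of (x, y) \<Rightarrow> cnj (g x) * f y))"
    by (intro integrable_L2_mult K L2_tensor L2_cnj f g)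
  then have int: "integrable (M \<Otimes>\<^sub>M M) (\<lambda>(x, y). K (x, y) * (cnj (g x) * f y))"
    by (simp add: split_beta')
  have "l2_inner M (int_op M K f) g = (LINT x|M. LINT y|M. K (x, y) * (cnj (g x) * f y))"
  proof -
    have "(LINT y|M. K (x, y) * (cnj (g x) * f y)) = (LINT y|M. K (x, y) * f y * cnj (g x))" for x
      by (simp only: mult_ac)
    then show ?thesis
      unfolding l2_inner_def int_op_def by (simp only: integral_mult_left_zero)
  qed
  also have "\<dots> = (LINT y|M. LINT x|M. K (x, y) * (cnj (g x) * f y))"
    by (rule MM.Fubini_integral[OF int, symmetric])
  also have "\<dots> = (LINT y|M. LINT x|M. f y * cnj (adjoint_kernel K (y, x) * g x))"
    by (simp add: adjoint_kernel_def mult_ac)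
  also have "\<dots> = l2_inner M f (int_op M (adjoint_kernel K) g)"
    unfolding l2_inner_def int_op_def
    by (simp del: complex_cnj_mult)
  finally show ?thesis .
qed

end

text \<open>Limits along a net need not be measurable; with countable E one increasing sequence of
  finite sets computes the sum at all points simultaneously.\<close>

lemma borel_measurable_has_sum:
  fixes f :: "'a \<Rightarrow> 'b \<Rightarrow> complex"
  assumes "countable E" and f: "\<And>e. e \<in> E \<Longrightarrow> f e \<in> borel_measurable N"
    and sum: "\<And>x. x \<in> space N \<Longrightarrow> ((\<lambda>e. f e x) has_sum g x) E"
  shows "g \<in> borel_measurable N"
proof -
  obtain F where F: "\<And>n. finite (F n)" "\<And>n. F n \<subseteq> E" "incseq F"
      "filterlim F (finite_subsets_at_top E) sequentially"
    using assms(1) by (rule countable_exhaustion) blast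
  show ?thesis
  proof (rule borel_measurable_LIMSEQ_metric)
    show "(\<lambda>x. \<Sum>e\<in>F n. f e x) \<in> borel_measurable N" for n
      using f F(2) by (intro borel_measurable_sum) blast
    show "(\<lambda>n. \<Sum>e\<in>F n. f e x) \<longlonglongrightarrow> g x" if "x \<in> space N" for x
      using sum[OF that] F(4) unfolding has_sum_def by (rule filterlim_compose)
  qed
qed

context separable_L2
begin

text \<open>Moving the kernel operator to the other side turns each term into the inner product of
  \<open>V e\<close> with the adjoint of S applied to e. Cauchy-Schwarz, first in each term and then
  over e, bounds the sum of moduli by the product of two Hilbert-Schmidt norms.\<close>

lemma
  assumes S: "hilbert_schmidt M S" and V: "\<And>e. e \<in> some_onb M \<Longrightarrow> V e \<in> L2 M"
    and summable: "(\<lambda>e. (l2_norm M (V e))\<^sup>2) summable_on some_onb M"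
    and le: "(\<Sum>\<^sub>\<infinity>e\<in>some_onb M. (l2_norm M (V e))\<^sup>2) \<le> c\<^sup>2" and c: "0 \<le> c"
  shows trace_abs_summable: "(\<lambda>e. norm (l2_inner M (S (V e)) e)) summable_on some_onb M"
    and trace_le: "norm (\<Sum>\<^sub>\<infinity>e\<in>some_onb M. l2_inner M (S (V e)) e) \<le>
      l2_norm (M \<Otimes>\<^sub>M M) (hs_kernel M S) * c"
proof -
  let ?E = "some_onb M" and ?K = "hs_kernel M S"
  let ?A = "int_op M (adjoint_kernel ?K)"
  have S_bd: "bounded_operator M S" using S by (simp add: hilbert_schmidt_def)
  have K: "?K \<in> L2 (M \<Otimes>\<^sub>M M)" by (rule hs_kernel_L2[OF S])
  note K' = adjoint_kernel_L2[OF K]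
  have A_sum: "(\<Sum>e\<in>F. (l2_norm M (?A e))\<^sup>2) \<le> (l2_norm (M \<Otimes>\<^sub>M M) ?K)\<^sup>2" if "finite F" "F \<subseteq> ?E" for F
    using sum_int_op_le[OF some_onb_orthonormal that K', of "\<lambda>e. e" "\<lambda>e. e"]
    by (simp add: l2_norm_adjoint_kernel[OF K] some_onb_L2)
  have term_le: "norm (l2_inner M (S (V e)) e) \<le> l2_norm M (V e) * l2_norm M (?A e)" if e: "e \<in> ?E" for e
  proof -
    have "l2_inner M (S (V e)) e = l2_inner M (int_op M ?K (V e)) e"
      using hs_kernel_int_op[OF S V[OF e]]
      by (intro l2_inner_cong_AE L2_measurable bounded_operator_L2[OF S_bd] int_op_L2[OF K] V[OF e]
          some_onb_L2[OF e]) auto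
    also have "\<dots> = l2_inner M (V e) (?A e)"
      by (intro l2_inner_int_op K V[OF e] some_onb_L2[OF e])
    finally show ?thesis
      using cauchy_schwarz[OF V[OF e] int_op_L2[OF K' some_onb_L2[OF e]]] by simp
  qed
  have fin: "(\<Sum>e\<in>F. norm (l2_inner M (S (V e)) e)) \<le> l2_norm (M \<Otimes>\<^sub>M M) ?K * c"
    if F: "finite F" "F \<subseteq> ?E" for F
  proof -
    have "(\<Sum>e\<in>F. (l2_norm M (V e))\<^sup>2) \<le> c\<^sup>2"
      using finite_sum_le_infsum[OF summable F] le by simp
    have "(\<Sum>e\<in>F. norm (l2_inner M (S (V e)) e)) \<le> (\<Sum>e\<in>F. l2_norm M (V e) * l2_norm M (?A e))"
      using F term_le by (intro sum_mono) auto
    also have "\<dots> \<le> sqrt ((\<Sum>e\<in>F. (l2_norm M (V e))\<^sup>2) * (\<Sum>e\<in>F. (l2_norm M (?A e))\<^sup>2))"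
      by (intro real_le_rsqrt Cauchy_Schwarz_ineq_sum)
    also have "\<dots> \<le> sqrt (c\<^sup>2 * (l2_norm (M \<Otimes>\<^sub>M M) ?K)\<^sup>2)"
      by (intro real_sqrt_le_mono mult_mono A_sum F sum_nonneg) (fact | simp)+
    also have "\<dots> = l2_norm (M \<Otimes>\<^sub>M M) ?K * c"
      using c by (simp add: real_sqrt_mult mult.commute)
    finally show ?thesis .
  qed
  show s: "(\<lambda>e. norm (l2_inner M (S (V e)) e)) summable_on ?E"
    by (rule nonneg_bdd_above_summable_on) (auto intro!: bdd_aboveI2 fin)
  have "norm (\<Sum>\<^sub>\<infinity>e\<in>?E. l2_inner M (S (V e)) e) \<le> (\<Sum>\<^sub>\<infinity>e\<in>?E. norm (l2_inner M (S (V e)) e))"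
    by (rule norm_infsum_bound[OF s])
  also have "\<dots> \<le> l2_norm (M \<Otimes>\<^sub>M M) ?K * c"
    by (rule infsum_le_finite_sums[OF s]) (auto intro: fin)
  finally show "norm (\<Sum>\<^sub>\<infinity>e\<in>?E. l2_inner M (S (V e)) e) \<le> l2_norm (M \<Otimes>\<^sub>M M) ?K * c" .
qed

end

lemma l2_inner_duflo_moore: "l2_inner M (duflo_moore f) g = l2_inner M f (duflo_moore g)"
  unfolding l2_inner_def duflo_moore_def
  by (intro Bochner_Integration.integral_cong) (auto simp: mult_ac)

section \<open>The trace on one cone as a function of the group element\<close>

context cone_space
begin

text \<open>The adjoint of \<open>irrep p\<close> has the isometry \<open>irrep p\<close> as its own
  adjoint. Composing the Fourier transform with it on the right therefore costs nothing in
  Hilbert-Schmidt norm, and the bound is uniform in p.\<close>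

lemma fourier_adjoint_irrep_summable:
  assumes f: "f \<in> L2 haar" and p: "p \<in> P"
  shows "(\<lambda>e. (l2_norm M (fourier f i j (adjoint_op M (irrep p) e)))\<^sup>2) summable_on some_onb M"
    and "(\<Sum>\<^sub>\<infinity>e\<in>some_onb M. (l2_norm M (fourier f i j (adjoint_op M (irrep p) e)))\<^sup>2) \<le> (l2_norm haar f)\<^sup>2"
proof -
  let ?U = "adjoint_op M (irrep p)"
  have U: "e \<in> L2 M \<Longrightarrow> ?U e \<in> L2 M" for e
    using bounded_operator_L2[OF bounded_operator_adjoint_irrep[OF p]] .
  have W: "irrep p g \<in> L2 M" "l2_norm M (irrep p g) = l2_norm M g" if "g \<in> L2 M" for g
    using p irrep_L2[OF _ that] l2_norm_irrep[OF _ that] by (auto simp: P_def)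
  have UW: "l2_inner M (?U e) g = l2_inner M e (irrep p g)" if "e \<in> L2 M" "g \<in> L2 M" for e g
    using l2_inner_adjoint_irrep[OF p that(2,1)] by (subst (1 2) l2_inner_cnj) simp
  obtain K where K: "K \<in> L2 (M \<Otimes>\<^sub>M M)" "l2_norm (M \<Otimes>\<^sub>M M) K \<le> l2_norm haar f"
    "\<And>\<phi>. \<phi> \<in> L2 M \<Longrightarrow> AE x in M. fourier f i j \<phi> x = int_op M K \<phi> x"
    using fourier_kernel_exists[OF f] by blast
  have eq: "l2_norm M (fourier f i j (?U e)) = l2_norm M (int_op M K (?U e))" if "e \<in> some_onb M" for e
    using K(3)[OF U[OF some_onb_L2[OF that]]]
    by (intro l2_norm_cong_AE L2_measurable bounded_operator_L2[OF bounded_operator_fourier[OF f]]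
        int_op_L2[OF K(1)] U some_onb_L2 that)
  note int_op = summable_int_op[OF some_onb_orthonormal K(1), of ?U "irrep p"]
    infsum_int_op_le[OF some_onb_orthonormal K(1), of ?U "irrep p"]
  show "(\<lambda>e. (l2_norm M (fourier f i j (?U e)))\<^sup>2) summable_on some_onb M"
    using int_op(1) by (simp add: eq U W UW some_onb_L2 cong: summable_on_cong)
  have "(\<Sum>\<^sub>\<infinity>e\<in>some_onb M. (l2_norm M (int_op M K (?U e)))\<^sup>2) \<le> (l2_norm (M \<Otimes>\<^sub>M M) K)\<^sup>2"
    using int_op(2) by (simp add: U W UW some_onb_L2)
  also have "\<dots> \<le> (l2_norm haar f)\<^sup>2" using K(2) by (intro power_mono) auto
  finally show "(\<Sum>\<^sub>\<infinity>e\<in>some_onb M. (l2_norm M (fourier f i j (?U e)))\<^sup>2) \<le> (l2_norm haar f)\<^sup>2"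
    by (simp add: eq cong: infsum_cong)
qed

lemma l2_inner_irrep_measurable:
  assumes f: "f \<in> L2 M" and g: "g \<in> L2 M"
  shows "(\<lambda>p. l2_inner M (irrep p f) g) \<in> borel_measurable haar"
proof (rule measurable_cong[THEN iffD1])
  have [measurable]: "f \<in> borel_measurable M" "g \<in> borel_measurable M"
    using f g by (auto intro: L2_measurable)
  have "(\<lambda>p. LINT x|M. irrep_ext f p x * cnj (g x)) \<in> borel_measurable borel"
    by (rule borel_measurable_lebesgue_integral) (simp add: split_beta', measurable)
  then show "(\<lambda>p. LINT x|M. irrep_ext f p x * cnj (g x)) \<in> borel_measurable haar"
    by (rule measurable_borel_haar)
  show "(LINT x|M. irrep_ext f p x * cnj (g x)) = l2_inner M (irrep p f) g" if "p \<in> space haar" for p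
    using that unfolding l2_inner_def space_haar
    by (intro Bochner_Integration.integral_cong) (auto simp: irrep_ext space_M)
qed

context
  fixes \<sigma> :: op_symbol
  assumes symbol: "operator_valued_symbol \<sigma>"
    and hs: "\<And>p. p \<in> P \<Longrightarrow> hilbert_schmidt M (dm_symbol \<sigma> p i j)"
begin

lemma bounded_operator_dm_symbol: "p \<in> P \<Longrightarrow> bounded_operator M (dm_symbol \<sigma> p i j)"
  using hs by (simp add: hilbert_schmidt_def)

text \<open>Approximating \<open>g\<close> in the domain of the Duflo--Moore operator moves the unbounded factor from
  the symbol to a fixed vector, where weak measurability of \<open>\<sigma>\<close> applies.\<close>

lemma dm_symbol_measurable:
  assumes f: "f \<in> L2 M" and g: "g \<in> L2 M"
  shows "(\<lambda>p. l2_inner M (dm_symbol \<sigma> p i j f) g) \<in> borel_measurable haar"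
proof -
  obtain s where s: "\<And>n. s n \<in> duflo_moore_domain i j" "(\<lambda>n. l2_norm M (\<lambda>x. s n x - g x)) \<longlonglongrightarrow> 0"
    using duflo_moore_domain_dense[OF g] by blast
  have sL2: "s n \<in> L2 M" "duflo_moore (s n) \<in> L2 M" for n
    using s(1)[of n] by (auto simp: duflo_moore_domain_def)
  show ?thesis
  proof (rule borel_measurable_LIMSEQ_metric)
    show "(\<lambda>p. l2_inner M (dm_symbol \<sigma> p i j f) (s n)) \<in> borel_measurable haar" for n
      using symbol i_mem j_mem f sL2(2)[of n]
      unfolding operator_valued_symbol_def dm_symbol_def l2_inner_duflo_moore by blast
    show "(\<lambda>n. l2_inner M (dm_symbol \<sigma> p i j f) (s n)) \<longlonglongrightarrow> l2_inner M (dm_symbol \<sigma> p i j f) g"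
      if "p \<in> space haar" for p
    proof -
      have "dm_symbol \<sigma> p i j f \<in> L2 M"
        using that f by (intro bounded_operator_L2[OF bounded_operator_dm_symbol]) (simp add: space_haar)
      then have "(\<lambda>n. cnj (l2_inner M (s n) (dm_symbol \<sigma> p i j f))) \<longlonglongrightarrow>
          cnj (l2_inner M g (dm_symbol \<sigma> p i j f))"
        by (intro tendsto_cnj l2_inner_tendsto sL2 s(2) g)
      then show ?thesis by (simp only: l2_inner_cnj[symmetric])
    qed
  qed
qed

definition trace_term :: "(affine_poincare \<Rightarrow> complex) \<Rightarrow> affine_poincare \<Rightarrow> (plane \<Rightarrow> complex) \<Rightarrow> complex" where
  "trace_term f p e = l2_inner M (dm_symbol \<sigma> p i j (fourier f i j (adjoint_op M (irrep p) e))) e"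

definition fourier_trace :: "(affine_poincare \<Rightarrow> complex) \<Rightarrow> affine_poincare \<Rightarrow> complex" where
  "fourier_trace f p = op_trace M (\<lambda>\<phi>. dm_symbol \<sigma> p i j (fourier f i j (adjoint_op M (irrep p) \<phi>)))"

lemma fourier_adjoint_irrep_L2:
  "f \<in> L2 haar \<Longrightarrow> p \<in> P \<Longrightarrow> e \<in> L2 M \<Longrightarrow> fourier f i j (adjoint_op M (irrep p) e) \<in> L2 M"
  by (intro bounded_operator_L2[OF bounded_operator_fourier]
      bounded_operator_L2[OF bounded_operator_adjoint_irrep])

text \<open>Absolute summability shows that the infinite sum in \<open>op_trace\<close> is a genuine
  sum and not the default value 0; measurability and linearity in f both rely on this.\<close>

lemma
  assumes f: "f \<in> L2 haar" and p: "p \<in> P"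
  shows trace_term_has_sum: "(trace_term f p has_sum fourier_trace f p) (some_onb M)"
    and fourier_trace_le: "norm (fourier_trace f p) \<le>
      l2_norm (M \<Otimes>\<^sub>M M) (hs_kernel M (dm_symbol \<sigma> p i j)) * l2_norm haar f"
proof -
  let ?V = "\<lambda>e. fourier f i j (adjoint_op M (irrep p) e)"
  have V: "e \<in> some_onb M \<Longrightarrow> ?V e \<in> L2 M" for e
    by (intro fourier_adjoint_irrep_L2 f p some_onb_L2)
  note trace = trace_abs_summable[OF hs[OF p] V fourier_adjoint_irrep_summable[OF f p]]
    trace_le[OF hs[OF p] V fourier_adjoint_irrep_summable[OF f p]]
  show "(trace_term f p has_sum fourier_trace f p) (some_onb M)"
    using Infinite_Sum.abs_summable_summable[OF trace(1)]
    unfolding trace_term_def fourier_trace_def op_trace_def by (intro has_sum_infsum) auto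
  show "norm (fourier_trace f p) \<le>
      l2_norm (M \<Otimes>\<^sub>M M) (hs_kernel M (dm_symbol \<sigma> p i j)) * l2_norm haar f"
    using trace(2) by (simp add: fourier_trace_def op_trace_def)
qed

text \<open>Two nested countable expansions. The trace is a series over e, and each of its terms is
  a series over k whose summands are products: one factor involves only the symbol at fixed vectors,
  the other is a conjugated matrix coefficient of \<open>irrep p\<close>.\<close>

lemma fourier_trace_measurable:
  assumes f: "f \<in> L2 haar"
  shows "fourier_trace f \<in> borel_measurable haar"
proof (rule borel_measurable_has_sum[OF countable_some_onb])
  show "((\<lambda>e. trace_term f p e) has_sum fourier_trace f p) (some_onb M)" if "p \<in> space haar" for p
    using trace_term_has_sum[OF f] that by (simp add: space_haar)
  obtain K where K: "K \<in> L2 (M \<Otimes>\<^sub>M M)"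
    "\<And>\<phi>. \<phi> \<in> L2 M \<Longrightarrow> AE x in M. fourier f i j \<phi> x = int_op M K \<phi> x"
    using fourier_kernel_exists[OF f] by blast
  fix e assume "e \<in> some_onb M"
  then have e: "e \<in> L2 M" by (rule some_onb_L2)
  let ?g = "\<lambda>p. fourier f i j (adjoint_op M (irrep p) e)"
  show "(\<lambda>p. trace_term f p e) \<in> borel_measurable haar"
  proof (rule borel_measurable_has_sum[OF countable_some_onb])
    show "((\<lambda>k. l2_inner M (?g p) k * l2_inner M (dm_symbol \<sigma> p i j k) e) has_sum trace_term f p e) (some_onb M)"
      if "p \<in> space haar" for p
      unfolding trace_term_def using that
      by (intro bounded_operator_inner_series[OF some_onb countable_some_onb] bounded_operator_dm_symbol
          fourier_adjoint_irrep_L2 f e) (simp_all add: space_haar)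
    fix k assume "k \<in> some_onb M"
    then have k: "k \<in> L2 M" by (rule some_onb_L2)
    \<comment> \<open>The Fourier transform is moved off the moving vector onto k. The resulting
      vector does not depend on p, so the dependence on p is left to \<open>irrep p\<close>
      alone.\<close>
    let ?h = "int_op M (adjoint_kernel K) k"
    have h: "?h \<in> L2 M" by (intro int_op_L2 adjoint_kernel_L2 K k)
    have eq: "cnj (l2_inner M (irrep p ?h) e) = l2_inner M (?g p) k" if "p \<in> space haar" for p
    proof -
      have p: "p \<in> P" using that by (simp add: space_haar)
      have U: "adjoint_op M (irrep p) e \<in> L2 M"
        by (intro bounded_operator_L2[OF bounded_operator_adjoint_irrep[OF p]] e)
      have "l2_inner M (?g p) k = l2_inner M (int_op M K (adjoint_op M (irrep p) e)) k"
        using K(2)[OF U]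
        by (intro l2_inner_cong_AE L2_measurable fourier_adjoint_irrep_L2 int_op_L2 f p e k K U) auto
      also have "\<dots> = l2_inner M (adjoint_op M (irrep p) e) ?h"
        by (intro l2_inner_int_op K U k)
      also have "\<dots> = cnj (l2_inner M (irrep p ?h) e)"
        using l2_inner_adjoint_irrep[OF p h e] by (subst l2_inner_cnj) simp
      finally show ?thesis ..
    qed
    have "(\<lambda>p. cnj (l2_inner M (irrep p ?h) e)) \<in> borel_measurable haar"
      using l2_inner_irrep_measurable[OF h e] by measurable
    then have "(\<lambda>p. l2_inner M (?g p) k) \<in> borel_measurable haar"
      by (rule measurable_cong[THEN iffD1, rotated]) (rule eq)
    then show "(\<lambda>p. l2_inner M (?g p) k * l2_inner M (dm_symbol \<sigma> p i j k) e) \<in> borel_measurable haar"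
      using dm_symbol_measurable[OF k e] by (rule borel_measurable_times)
  qed
qed

text \<open>Linearity of the chosen Fourier transform and of the symbol holds only almost everywhere
  in x. The inner products with e absorb the null sets, so the identity is exact at every p in
  \<open>P\<close>.\<close>

lemma fourier_trace_lincomb:
  assumes f: "f \<in> L2 haar" and g: "g \<in> L2 haar" and p: "p \<in> P"
  shows "fourier_trace (\<lambda>q. \<alpha> * f q + \<beta> * g q) p = \<alpha> * fourier_trace f p + \<beta> * fourier_trace g p"
proof -
  let ?h = "\<lambda>q. \<alpha> * f q + \<beta> * g q" and ?S = "dm_symbol \<sigma> p i j"
  let ?V = "\<lambda>f e. fourier f i j (adjoint_op M (irrep p) e)"
  have S: "bounded_operator M ?S" by (rule bounded_operator_dm_symbol[OF p])
  have h: "?h \<in> L2 haar" using f g by auto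
  have "trace_term ?h p e = \<alpha> * trace_term f p e + \<beta> * trace_term g p e" if "e \<in> some_onb M" for e
  proof -
    have e: "e \<in> L2 M" using that by (rule some_onb_L2)
    have V: "?V f e \<in> L2 M" "?V g e \<in> L2 M" "?V ?h e \<in> L2 M"
      by (intro fourier_adjoint_irrep_L2 f g h p e)+
    have SV: "?S (?V f e) \<in> L2 M" "?S (?V g e) \<in> L2 M" "?S (?V ?h e) \<in> L2 M"
      by (intro bounded_operator_L2[OF S] V)+
    have "AE x in M. ?V ?h e x = \<alpha> * ?V f e x + \<beta> * ?V g e x"
      by (intro fourier_lincomb f g bounded_operator_L2[OF bounded_operator_adjoint_irrep[OF p]] e)
    then have "AE x in M. ?S (?V ?h e) x = ?S (\<lambda>x. \<alpha> * ?V f e x + \<beta> * ?V g e x) x"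
      by (intro bounded_operator_cong_AE[OF S] V L2_lincomb)
    moreover note bounded_operator_add[OF S L2_scale[OF V(1), of \<alpha>] L2_scale[OF V(2), of \<beta>]]
      bounded_operator_scale[OF S V(1), of \<alpha>] bounded_operator_scale[OF S V(2), of \<beta>]
    ultimately have "AE x in M. ?S (?V ?h e) x = \<alpha> * ?S (?V f e) x + \<beta> * ?S (?V g e) x"
      by eventually_elim simp
    then have "trace_term ?h p e = l2_inner M (\<lambda>x. \<alpha> * ?S (?V f e) x + \<beta> * ?S (?V g e) x) e"
      unfolding trace_term_def by (intro l2_inner_cong_AE L2_measurable SV L2_lincomb e) auto
    also have "\<dots> = \<alpha> * trace_term f p e + \<beta> * trace_term g p e"
      unfolding trace_term_def using SV e by (simp add: l2_inner_add_left l2_inner_scale_left L2_scale)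
    finally show ?thesis .
  qed
  moreover have "((\<lambda>e. \<alpha> * trace_term f p e + \<beta> * trace_term g p e) has_sum
      (\<alpha> * fourier_trace f p + \<beta> * fourier_trace g p)) (some_onb M)"
    by (intro has_sum_add has_sum_cmult_right trace_term_has_sum f g p)
  ultimately have "(trace_term ?h p has_sum (\<alpha> * fourier_trace f p + \<beta> * fourier_trace g p)) (some_onb M)"
    by (simp cong: has_sum_cong)
  then show ?thesis
    using trace_term_has_sum[OF h p] has_sum_unique by blast
qed

end

end

section \<open>Summation over the four cones\<close>

lemma l2_norm_mono:
  assumes f: "f \<in> borel_measurable M" and g: "g \<in> L2 M"
    and le: "\<And>x. x \<in> space M \<Longrightarrow> norm (f x) \<le> norm (g x)"
  shows "f \<in> L2 M" and "l2_norm M f \<le> l2_norm M g"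
proof -
  have "(\<integral>\<^sup>+x. ennreal ((norm (f x))\<^sup>2) \<partial>M) \<le> (\<integral>\<^sup>+x. ennreal ((norm (g x))\<^sup>2) \<partial>M)"
    by (intro nn_integral_mono ennreal_leI power_mono le) auto
  also have "\<dots> = ennreal ((l2_norm M g)\<^sup>2)" by (rule nn_integral_L2[OF g])
  finally show "f \<in> L2 M" "l2_norm M f \<le> l2_norm M g"
    using L2_bounded[OF f] by auto
qed

theorem theorem4p1:
  fixes \<sigma> :: op_symbol
  assumes "operator_valued_symbol \<sigma>"
    and "\<And>p i j. p \<in> P \<Longrightarrow> i \<in> {1, 2} \<Longrightarrow> j \<in> {1, 2} \<Longrightarrow>
           hilbert_schmidt (cone_measure i j) (dm_symbol \<sigma> p i j)"
    and "\<And>i j. i \<in> {1, 2} \<Longrightarrow> j \<in> {1, 2} \<Longrightarrow> G \<sigma> i j \<in> L2 haar"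
  shows "bounded_operator haar (pseudo_diff \<sigma>) \<and>
         op_norm haar (pseudo_diff \<sigma>) \<le>
           l2_norm haar (G \<sigma> 1 1) + l2_norm haar (G \<sigma> 2 1) +
           l2_norm haar (G \<sigma> 1 2) + l2_norm haar (G \<sigma> 2 2)"
proof -
  define tr where "tr i j f p = op_trace (cone_measure i j)
      (\<lambda>\<phi>. dm_symbol \<sigma> p i j (fourier f i j (adjoint_op (cone_measure i j) (irrep p) \<phi>)))"
    for i j f p
  define k where "k i j p = l2_norm (cone_measure i j \<Otimes>\<^sub>M cone_measure i j)
      (hs_kernel (cone_measure i j) (dm_symbol \<sigma> p i j))" for i j p
  define m where "m p = modular p powr (- 1 / 2)" for p
  \<comment> \<open>The pointwise majorant: the operator applied to f is bounded at p by g p times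
    the norm of f, and the triangle inequality for g produces the four norms in the claim.\<close>
  define g where "g p = (\<Sum>i\<in>{1, 2}. \<Sum>j\<in>{1, 2}. G \<sigma> i j p)" for p
  define C where "C = l2_norm haar (G \<sigma> 1 1) + l2_norm haar (G \<sigma> 2 1) +
    l2_norm haar (G \<sigma> 1 2) + l2_norm haar (G \<sigma> 2 2)"
  have tr_meas: "tr i j f \<in> borel_measurable haar"
    and tr_le: "\<And>p. p \<in> P \<Longrightarrow> norm (tr i j f p) \<le> k i j p * l2_norm haar f"
    and tr_lin: "\<And>h \<alpha> \<beta> p. h \<in> L2 haar \<Longrightarrow> p \<in> P \<Longrightarrow>
      tr i j (\<lambda>q. \<alpha> * f q + \<beta> * h q) p = \<alpha> * tr i j f p + \<beta> * tr i j h p"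
    if ij: "i \<in> {1, 2}" "j \<in> {1, 2}" and f: "f \<in> L2 haar" for i j f
  proof -
    interpret cone_space i j using ij by unfold_locales
    have hs: "\<And>p. p \<in> P \<Longrightarrow> hilbert_schmidt (cone_measure i j) (dm_symbol \<sigma> p i j)"
      using assms(2) ij by blast
    have eq: "tr i j = fourier_trace \<sigma>"
      by (intro ext) (simp add: tr_def fourier_trace_def[OF assms(1) hs])
    show "tr i j f \<in> borel_measurable haar"
      unfolding eq by (rule fourier_trace_measurable[OF assms(1) hs f])
    show "norm (tr i j f p) \<le> k i j p * l2_norm haar f" if "p \<in> P" for p
      unfolding eq k_def by (rule fourier_trace_le[OF assms(1) hs f that])
    show "tr i j (\<lambda>q. \<alpha> * f q + \<beta> * h q) p = \<alpha> * tr i j f p + \<beta> * tr i j h p"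
      if "h \<in> L2 haar" "p \<in> P" for h \<alpha> \<beta> p
      unfolding eq by (rule fourier_trace_lincomb[OF assms(1) hs f that])
  qed
  have T: "pseudo_diff \<sigma> f p = of_real (m p) * (\<Sum>i\<in>{1, 2}. \<Sum>j\<in>{1, 2}. tr i j f p)" for f p
    by (simp add: pseudo_diff_def m_def tr_def)
  have m_meas: "(\<lambda>p. complex_of_real (m p)) \<in> borel_measurable haar"
    unfolding m_def modular_def split_beta' by (rule measurable_borel_haar) measurable
  have T_meas: "pseudo_diff \<sigma> f \<in> borel_measurable haar" if "f \<in> L2 haar" for f
    unfolding T[abs_def] using m_meas tr_meas that
    by (intro borel_measurable_times borel_measurable_sum)
  have G_eq: "G \<sigma> i j p = of_real (m p * k i j p)" for i j p
    by (simp add: G_def m_def k_def)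
  have g_L2: "g \<in> L2 haar"
    unfolding g_def by (intro L2_sum assms(3))
  have g_le: "l2_norm haar g \<le> C"
  proof -
    have "l2_norm haar g \<le> (\<Sum>i\<in>{1, 2}. l2_norm haar (\<lambda>p. \<Sum>j\<in>{1, 2}. G \<sigma> i j p))"
      unfolding g_def by (intro l2_norm_sum_le L2_sum assms(3))
    also have "\<dots> \<le> (\<Sum>i\<in>{1, 2}. \<Sum>j\<in>{1, 2}. l2_norm haar (G \<sigma> i j))"
      by (intro sum_mono l2_norm_sum_le assms(3))
    finally show ?thesis by (simp add: C_def)
  qed
  have T_le: "norm (pseudo_diff \<sigma> f p) \<le> norm (of_real (l2_norm haar f) * g p)"
    if f: "f \<in> L2 haar" and p: "p \<in> P" for f p
  proof -
    have m: "0 \<le> m p" by (simp add: m_def)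
    have "norm (\<Sum>i\<in>{1, 2}. \<Sum>j\<in>{1, 2}. tr i j f p) \<le> (\<Sum>i\<in>{1, 2}. \<Sum>j\<in>{1, 2}. k i j p * l2_norm haar f)"
      by (intro sum_norm_le tr_le f p)
    then have "norm (pseudo_diff \<sigma> f p) \<le> m p * (\<Sum>i\<in>{1, 2}. \<Sum>j\<in>{1, 2}. k i j p * l2_norm haar f)"
      unfolding T norm_mult norm_of_real abs_of_nonneg[OF m] using m by (rule mult_left_mono)
    also have "\<dots> = l2_norm haar f * (\<Sum>i\<in>{1, 2}. \<Sum>j\<in>{1, 2}. m p * k i j p)"
      by (simp add: algebra_simps)
    also have "\<dots> = norm (complex_of_real (l2_norm haar f * (\<Sum>i\<in>{1, 2}. \<Sum>j\<in>{1, 2}. m p * k i j p)))"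
      unfolding norm_of_real using m
      by (intro abs_of_nonneg[symmetric] mult_nonneg_nonneg sum_nonneg) (auto simp: k_def)
    also have "\<dots> = norm (of_real (l2_norm haar f) * g p)"
      by (simp only: g_def G_eq of_real_mult of_real_sum)
    finally show ?thesis .
  qed
  have T_L2: "pseudo_diff \<sigma> f \<in> L2 haar"
    and T_norm: "l2_norm haar (pseudo_diff \<sigma> f) \<le> C * l2_norm haar f" if f: "f \<in> L2 haar" for f
  proof -
    note mono = l2_norm_mono[OF T_meas[OF f] L2_scale[OF g_L2, of "of_real (l2_norm haar f)"]]
    show "pseudo_diff \<sigma> f \<in> L2 haar" using mono(1) T_le[OF f] by (simp add: space_haar)
    have "l2_norm haar (pseudo_diff \<sigma> f) \<le> l2_norm haar f * l2_norm haar g"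
      using mono(2) T_le[OF f] by (simp add: space_haar l2_norm_scale)
    also have "\<dots> \<le> C * l2_norm haar f"
      using mult_right_mono[OF g_le, of "l2_norm haar f"] by (simp add: mult.commute)
    finally show "l2_norm haar (pseudo_diff \<sigma> f) \<le> C * l2_norm haar f" .
  qed
  have T_lin: "AE p in haar. pseudo_diff \<sigma> (\<lambda>q. \<alpha> * f q + \<beta> * h q) p =
      \<alpha> * pseudo_diff \<sigma> f p + \<beta> * pseudo_diff \<sigma> h p"
    if "f \<in> L2 haar" "h \<in> L2 haar" for f h \<alpha> \<beta>
    using that by (intro AE_I2) (simp add: T tr_lin space_haar algebra_simps)
  have "bounded_operator haar (pseudo_diff \<sigma>)"
    unfolding bounded_operator_def
  proof (intro conjI ballI allI exI[of _ C])
    show "AE p in haar. pseudo_diff \<sigma> (\<lambda>q. f q + h q) p = pseudo_diff \<sigma> f p + pseudo_diff \<sigma> h p"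
      if "f \<in> L2 haar" "h \<in> L2 haar" for f h
      using T_lin[OF that, of 1 1] by simp
    show "AE p in haar. pseudo_diff \<sigma> (\<lambda>q. c * f q) p = c * pseudo_diff \<sigma> f p"
      if "f \<in> L2 haar" for f c
      using T_lin[OF that that, of c 0] by simp
  qed (rule T_L2 T_norm, assumption)+
  moreover have "op_norm haar (pseudo_diff \<sigma>) \<le> C"
    unfolding op_norm_def
  proof (rule cSUP_least)
    show "L2 haar \<noteq> {}" using L2_zero by blast
    fix f assume f: "f \<in> L2 haar"
    \<comment> \<open>For a null function f the quotient in \<open>op_norm\<close> is a division by
      0, hence 0, and nonnegativity of C is what settles that case.\<close>
    have "0 \<le> C" by (simp add: C_def)
    then show "l2_norm haar (pseudo_diff \<sigma> f) / l2_norm haar f \<le> C"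
      using T_norm[OF f] l2_norm_nonneg[of haar f]
      by (cases "l2_norm haar f = 0") (simp_all add: pos_divide_le_eq less_le)
  qed
  ultimately show ?thesis by (simp add: C_def)
qed

end
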